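(* Let $\mathsf P_1,\dots,\mathsf P_r$ be indecomposable polytopes, none of them a single point, in parallelogramic position, with $\dim(\mathsf P_1+\dots+\mathsf P_r)\ge3$. Let $\mathscr F$ be a subset of the facets of $\mathsf P_1+\dots+\mathsf P_r$. Then the deformation cone $\mathbb{DC}\big((\mathsf P_1+\dots+\mathsf P_r)_{\mathscr F}\big)$ is a simplicial cone whose dimension is the number of connected components of the graph of stacking $\Gamma_{\mathsf P_1,\dots,\mathsf P_r}(\mathscr F)$.
   Context: A polytope $\mathsf R$ is a deformation of a polytope $\mathsf P$ if $\lambda\mathsf P=\mathsf R+\mathsf R'$ for some $\lambda>0$ and polytope $\mathsf R'$. Then each vertex $p$ of $\mathsf P$ has an associated vertex $q(p)$ of $\mathsf R$ (maximized by the same linear functionals), and for every edge $e=pp'$ of $\mathsf P$ there is $\lambda_e\ge0$ with $q(p)-q(p')=\lambda_e(p-p')$. The vector $(\lambda_e)_e\in\mathbb R_{\ge0}^{E(\mathsf P)}$ is the edge-deformation vector of $\mathsf R$; the deformation cone $\mathbb{DC}(\mathsf P)$ is the cone of edge-deformation vectors of all deformations of $\mathsf P$. A cone is simplicial if its rays are linearly independent. $\mathsf P$ is indecomposable if its only deformations are $\lambda\mathsf P+t$, $\lambda\ge0$. Parallelogramic position: a vector $v$ is $2$-generic with respect to $\mathsf P$ if there are no two edges $xy$, $ab$ in a common $2$-face of $\mathsf P$ with $v=\alpha(y-x)+\beta(b-a)$, $\alpha,\beta\in\mathbb R$. Two polytopes $\mathsf P,\mathsf Q$ are in parallelogramic position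 if every edge direction of $\mathsf P$ is $2$-generic with respect to $\mathsf Q$, every edge direction of $\mathsf Q$ is $2$-generic with respect to $\mathsf P$, and no edge of $\mathsf P$ is parallel to an edge of $\mathsf Q$. A collection $\mathsf P_1,\dots,\mathsf P_r$ is in parallelogramic position if for every $i$ the polytopes $\mathsf P_i$ and $\sum_{j\ne i}\mathsf P_j$ are. Stacking: for a facet $\mathsf G$ of a full-dimensional polytope $\mathsf P$ (working in its affine hull), let $H^-_{\mathsf G}$ be the closed half-space bounded by the hyperplane spanned by $\mathsf G$ and containing $\mathsf P$, and $H^+_{\mathsf G}$ the opposite closed half-space. A vertex stacking on a facet $\mathsf F$ is $\mathsf P_{\mathsf F,q}=\mathrm{conv}(\mathsf P\cup\{q\})$ with $q\in\mathrm{int}\big(H^+_{\mathsf F}\cap\bigcap_{\mathsf G\ne\mathsf F}H^-_{\mathsf G}\big)$; all facets other than $\mathsf F$ remain facets. For a set $\mathscr F$ of facets, $\mathsf P_{\mathscr F}$ denotes any polytope obtained by successively stacking a vertex on each facet of $\mathscr F$ (its combinatorial type does not depend on choices, and the statement holds for any choice of stacking points). Graph of stacking: $\Gamma_{\mathsf P_1,\dots,\mathsf P_r}(\mathscr F)$ has node set $[r]$, with an arc between $i$ and $j$ if some facet $\mathsf F\in\mathscr F$ contains both an edge parallel to an edge of $\mathsf P_i$ and an edge parallel to an edge of $\mathsf P_j$. *)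

theory Defs
  imports "HOL-Analysis.Analysis" "HOL-Library.Function_Algebras"
begin

(* Edge-deformation vectors are real functions on sets of points (the edges), so the pointwise
   vector space structure is needed for span, dim, independent, conic, face_of. *)
instantiation "fun" :: (type, real_vector) real_vector
begin

definition scaleR_fun :: "real \<Rightarrow> ('a \<Rightarrow> 'b) \<Rightarrow> 'a \<Rightarrow> 'b"
  where "scaleR_fun c f = (\<lambda>x. c *\<^sub>R f x)"

instance
  by standard (auto simp: scaleR_fun_def scaleR_add_right scaleR_add_left)

end


subsection \<open>Deformations and the deformation cone\<close>

(* The sum of two sets, and sums of families of sets, are Minkowski sums (Set_Algebras). *)
definition deformation_of :: "'a::euclidean_space set \<Rightarrow> 'a set \<Rightarrow> bool"
  where "deformation_of P R \<longleftrightarrow>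
    polytope R \<and> (\<exists>c>0. \<exists>R'. polytope R' \<and> (*\<^sub>R) c ` P = R + R')"

definition indecomposable_polytope :: "'a::euclidean_space set \<Rightarrow> bool"
  where "indecomposable_polytope P \<longleftrightarrow>
    polytope P \<and> (\<forall>R. deformation_of P R \<longrightarrow> (\<exists>c\<ge>0. \<exists>t. R = (\<lambda>x. c *\<^sub>R x + t) ` P))"

definition associated_vertex :: "'a::euclidean_space set \<Rightarrow> 'a set \<Rightarrow> 'a \<Rightarrow> 'a \<Rightarrow> bool"
  where "associated_vertex P R p q \<longleftrightarrow>
    q extreme_point_of R \<and>
    (\<forall>a. (\<forall>x\<in>P. a \<bullet> x \<le> a \<bullet> p) \<longrightarrow> (\<forall>y\<in>R. a \<bullet> y \<le> a \<bullet> q))"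

(* Vectors indexed by the edges of P are functions on all sets, vanishing off the edges. *)
definition edge_deformation_vector ::
    "'a::euclidean_space set \<Rightarrow> 'a set \<Rightarrow> ('a set \<Rightarrow> real) \<Rightarrow> bool"
  where "edge_deformation_vector P R l \<longleftrightarrow>
    (\<forall>e. \<not> e edge_of P \<longrightarrow> l e = 0) \<and>
    (\<forall>e. e edge_of P \<longrightarrow> 0 \<le> l e) \<and>
    (\<exists>q. (\<forall>p. p extreme_point_of P \<longrightarrow> associated_vertex P R p (q p)) \<and>
         (\<forall>p p'. closed_segment p p' edge_of P \<longrightarrow>
            q p - q p' = l (closed_segment p p') *\<^sub>R (p - p')))"

definition deformation_cone :: "'a::euclidean_space set \<Rightarrow> ('a set \<Rightarrow> real) set"
  where "deformation_cone P = {l. \<exists>R. deformation_of P R \<and> edge_deformation_vector P R l}"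


subsection \<open>Simplicial cones\<close>

definition ray_generator :: "'v::real_vector set \<Rightarrow> 'v \<Rightarrow> bool"
  where "ray_generator C v \<longleftrightarrow> v \<noteq> 0 \<and> (conic hull {v}) face_of C"

(* Cones are polyhedral. Pointedness is required since a cone containing a line has no
   one-dimensional face that is a ray. V ranges over sets with at most one generator per ray. *)
definition simplicial_cone :: "'v::real_vector set \<Rightarrow> bool"
  where "simplicial_cone C \<longleftrightarrow>
    (\<exists>S. finite S \<and> C = convex_cone hull S) \<and>
    C \<inter> uminus ` C = {0} \<and>
    (\<forall>V. (\<forall>v\<in>V. ray_generator C v) \<and> inj_on (\<lambda>v. conic hull {v}) V \<longrightarrow> independent V)"


subsection \<open>Parallelogramic position\<close>

definition edge_direction :: "'a::euclidean_space set \<Rightarrow> 'a \<Rightarrow> bool"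
  where "edge_direction P v \<longleftrightarrow> (\<exists>x y. closed_segment x y edge_of P \<and> v = y - x)"

definition parallel_vectors :: "'a::real_vector \<Rightarrow> 'a \<Rightarrow> bool"
  where "parallel_vectors u v \<longleftrightarrow> (\<exists>c. c \<noteq> 0 \<and> u = c *\<^sub>R v)"

definition two_generic :: "'a::euclidean_space set \<Rightarrow> 'a \<Rightarrow> bool"
  where "two_generic P v \<longleftrightarrow>
    \<not> (\<exists>F x y a b \<alpha> \<beta>. F face_of P \<and> aff_dim F = 2 \<and>
        closed_segment x y edge_of P \<and> closed_segment x y \<subseteq> F \<and>
        closed_segment a b edge_of P \<and> closed_segment a b \<subseteq> F \<and>
        closed_segment x y \<noteq> closed_segment a b \<and>
        v = \<alpha> *\<^sub>R (y - x) + \<beta> *\<^sub>R (b - a))"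

definition parallelogramic_position :: "'a::euclidean_space set \<Rightarrow> 'a set \<Rightarrow> bool"
  where "parallelogramic_position P Q \<longleftrightarrow>
    (\<forall>v. edge_direction P v \<longrightarrow> two_generic Q v) \<and>
    (\<forall>w. edge_direction Q w \<longrightarrow> two_generic P w) \<and>
    \<not> (\<exists>v w. edge_direction P v \<and> edge_direction Q w \<and> parallel_vectors v w)"

definition parallelogramic_family :: "'i set \<Rightarrow> ('i \<Rightarrow> 'a::euclidean_space set) \<Rightarrow> bool"
  where "parallelogramic_family I P \<longleftrightarrow>
    (\<forall>i\<in>I. parallelogramic_position (P i) (\<Sum>j\<in>I - {i}. P j))"


subsection \<open>Vertex stacking\<close>

(* The inequality defining the facet G is unique on the affine hull of P up to a positive factor,
   so quantifying over all of them in the two half-spaces does not depend on choices. *)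
definition facet_inequality :: "'a::euclidean_space set \<Rightarrow> 'a set \<Rightarrow> 'a \<Rightarrow> real \<Rightarrow> bool"
  where "facet_inequality P G a b \<longleftrightarrow> P \<subseteq> {x. a \<bullet> x \<le> b} \<and> G = P \<inter> {x. a \<bullet> x = b}"

definition inner_halfspace :: "'a::euclidean_space set \<Rightarrow> 'a set \<Rightarrow> 'a set"
  where "inner_halfspace P G =
    {x \<in> affine hull P. \<forall>a b. facet_inequality P G a b \<longrightarrow> a \<bullet> x \<le> b}"

definition outer_halfspace :: "'a::euclidean_space set \<Rightarrow> 'a set \<Rightarrow> 'a set"
  where "outer_halfspace P G =
    {x \<in> affine hull P. \<forall>a b. facet_inequality P G a b \<longrightarrow> b \<le> a \<bullet> x}"

definition stacking_region :: "'a::euclidean_space set \<Rightarrow> 'a set \<Rightarrow> 'a set"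
  where "stacking_region P F =
    (top_of_set (affine hull P)) interior_of
      (outer_halfspace P F \<inter> (\<Inter>G\<in>{G. G facet_of P \<and> G \<noteq> F}. inner_halfspace P G))"

(* stacked P Fs Q: Q arises from P by stacking a vertex on each facet in Fs, in some order. *)
inductive stacked :: "'a::euclidean_space set \<Rightarrow> 'a set set \<Rightarrow> 'a set \<Rightarrow> bool" for P where
  none: "stacked P {} P"
| stack: "stacked P Fs Q \<Longrightarrow> F facet_of P \<Longrightarrow> F \<notin> Fs \<Longrightarrow> F facet_of Q \<Longrightarrow>
    q \<in> stacking_region Q F \<Longrightarrow> stacked P (insert F Fs) (convex hull (Q \<union> {q}))"


subsection \<open>The graph of stacking\<close>

definition stacking_arcs ::
    "'i set \<Rightarrow> ('i \<Rightarrow> 'a::euclidean_space set) \<Rightarrow> 'a set set \<Rightarrow> ('i \<times> 'i) set"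
  where "stacking_arcs I P Fs =
    {(i, j). i \<in> I \<and> j \<in> I \<and> (\<exists>F\<in>Fs.
        (\<exists>u v. edge_direction F u \<and> edge_direction (P i) v \<and> parallel_vectors u v) \<and>
        (\<exists>u v. edge_direction F u \<and> edge_direction (P j) v \<and> parallel_vectors u v))}"

definition graph_components :: "'i set \<Rightarrow> ('i \<times> 'i) set \<Rightarrow> 'i set set"
  where "graph_components V A = V // {(i, j). i \<in> V \<and> j \<in> V \<and> (i, j) \<in> (A \<union> A\<inverse>)\<^sup>*}"

end

theory Submission
  imports Defs
begin

text \<open>A weak Minkowski summand of a polytope \<open>Q\<close> is the same as a map on the vertices of \<open>Q\<close> that rescales
  every edge by a nonnegative factor (Shephard), so the deformation cone consists of the vectors of such
  factors. Every 2-face of a sum \<open>A + B\<close> in parallelogramic position is a translate of a 2-face of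
  \<open>A\<close> or of \<open>B\<close>, or a parallelogram; hence the part of a deformation that moves along edges parallel to
  edges of \<open>A\<close> closes up around every 2-face and integrates to a map on the vertices. This map depends only on
  the \<open>A\<close>-component of a vertex, so it is a deformation of \<open>A\<close>, and indecomposability of \<open>A\<close>
  makes the factors on these edges equal. Applied to each summand, this identifies the deformation cone of the
  sum with a nonnegative orthant having one coordinate per summand. The triangles at a vertex stacked on \<open>F\<close> force all edges of
  \<open>F\<close> and all new edges to share one factor and impose nothing else, which identifies the coordinates of the
  summands met by \<open>F\<close>.\<close>


subsection \<open>Faces and vertex figures\<close>

text \<open>That weights closing up around all 2-faces integrate to the vertices is a topological
  fact: the 2-skeleton of a polytope is simply connected. Linear programming replaces the topology
  here. The simplex method, applied to vertex figures, shows that the improving edges at a vertex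
  are connected through 2-faces, and this is what a sweep of the vertices by a generic functional
  requires. The same device explains why the integrated map depends only on the
  \<open>A\<close>-component: two vertices of the sum over the same vertex \<open>a\<close> of
  \<open>A\<close> are exposed by functionals whose only maximizer on \<open>A\<close> is
  \<open>a\<close>; such functionals form a convex cone, so a parametric simplex path between the
  two vertices never moves in \<open>A\<close>. Dimension at least 3 makes every facet at least
  two-dimensional. Then a stacking destroys no edge, because the only proper face that disappears is
  the facet itself. Hence the edges of the sum survive all stackings, and the conditions imposed by
  the stackings can be stated on these edges alone.\<close>

definition maxface :: "'a::euclidean_space set \<Rightarrow> 'a \<Rightarrow> 'a set"
  where "maxface P c = {x \<in> P. \<forall>y\<in>P. c \<bullet> y \<le> c \<bullet> x}"

lemma maxface_face_of:
  assumes "convex P"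
  shows "maxface P c face_of P"
proof (cases "maxface P c = {}")
  case False
  then obtain x where x: "x \<in> P" "\<forall>y\<in>P. c \<bullet> y \<le> c \<bullet> x"
    by (auto simp: maxface_def)
  have "maxface P c = P \<inter> {y. c \<bullet> y = c \<bullet> x}"
    using x by (auto simp: maxface_def intro: antisym)
  then show ?thesis
    using face_of_Int_supporting_hyperplane_le[OF assms, of c "c \<bullet> x"] x by simp
qed auto

lemma maxface_nonempty:
  assumes "compact P" "P \<noteq> {}"
  shows "maxface P c \<noteq> {}"
proof -
  have "continuous_on P (\<lambda>x. c \<bullet> x)"
    by (intro continuous_intros)
  from continuous_attains_sup[OF assms this] show ?thesis
    by (auto simp: maxface_def)
qed

text \<open>Faces of a polytope are exposed, and the supporting functional of a nonempty face serves
  as the objective.\<close>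

lemma face_of_polytope_maxface:
  assumes "polytope P" "F face_of P" "F \<noteq> {}"
  obtains c where "F = maxface P c"
proof -
  have "F exposed_face_of P"
    using assms exposed_face_of_polyhedron polytope_imp_polyhedron by blast
  then obtain a b where ab: "P \<subseteq> {x. a \<bullet> x \<le> b}" "F = P \<inter> {x. a \<bullet> x = b}"
    by (auto simp: exposed_face_of_def)
  obtain x where "x \<in> F" using assms by blast
  with ab have x: "x \<in> P" "a \<bullet> x = b" by auto
  have "F = maxface P a"
  proof (intro set_eqI iffI)
    fix y assume "y \<in> maxface P a"
    then have "y \<in> P" "a \<bullet> y \<ge> b" using x by (auto simp: maxface_def)
    then show "y \<in> F" using ab(1) by (auto simp: ab(2) intro: antisym)
  qed (use ab in \<open>auto simp: maxface_def\<close>)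
  then show thesis by (rule that)
qed

text \<open>Maximizing over a sum means maximizing over each summand separately. This compatibility
  is the reason for describing faces by functionals.\<close>

lemma maxface_plus: "maxface (A + B) c = maxface A c + maxface B c"
proof (intro set_eqI iffI)
  fix x assume x: "x \<in> maxface (A + B) c"
  then obtain a b where ab: "a \<in> A" "b \<in> B" "x = a + b"
    by (auto simp: maxface_def set_plus_def)
  have *: "c \<bullet> (a' + b') \<le> c \<bullet> (a + b)" if "a' \<in> A" "b' \<in> B" for a' b'
    using x that ab by (auto simp: maxface_def set_plus_def)
  have "a \<in> maxface A c" "b \<in> maxface B c"
    using *[OF _ ab(2)] *[OF ab(1)] ab by (auto simp: maxface_def inner_add_right)
  then show "x \<in> maxface A c + maxface B c"
    using ab by (auto simp: set_plus_def)
next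
  fix x assume "x \<in> maxface A c + maxface B c"
  then show "x \<in> maxface (A + B) c"
    by (auto simp: maxface_def set_plus_def inner_add_right add_mono)
qed

section \<open>Vertices, edges and minimal faces\<close>

lemma polytope_has_vertex:
  fixes P :: "'a::euclidean_space set"
  assumes "polytope P" "P \<noteq> {}"
  obtains v where "v extreme_point_of P"
  using extreme_point_exists_convex[OF polytope_imp_compact polytope_imp_convex] assms by metis

lemma finite_vertices:
  fixes P :: "'a::euclidean_space set"
  shows "polytope P \<Longrightarrow> finite {v. v extreme_point_of P}"
  by (rule finite_polyhedron_extreme_points[OF polytope_imp_polyhedron])

lemma polytope_hull_vertices:
  fixes P :: "'a::euclidean_space set"
  shows "polytope P \<Longrightarrow> P = convex hull {v. v extreme_point_of P}"
  by (rule Krein_Milman_Minkowski[OF polytope_imp_compact polytope_imp_convex])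

lemma maxface_has_vertex:
  fixes P :: "'a::euclidean_space set"
  assumes "polytope P" "P \<noteq> {}"
  obtains v where "v extreme_point_of P" "v \<in> maxface P c"
proof -
  have f: "maxface P c face_of P"
    by (simp add: assms maxface_face_of polytope_imp_convex)
  obtain v where "v extreme_point_of maxface P c"
    using polytope_has_vertex[of "maxface P c"] face_of_polytope_polytope[OF assms(1) f]
      maxface_nonempty[of P c] assms polytope_imp_compact by metis
  then show thesis
    using that extreme_point_of_face[OF f] by blast
qed

lemma vertex_maxface:
  assumes "polytope P" "v extreme_point_of P"
  obtains c where "maxface P c = {v}"
  using assms face_of_polytope_maxface[of P "{v}"] face_of_singleton by (metis insert_not_empty)

lemma edge_vertices:
  fixes P :: "'a::euclidean_space set"
  assumes "closed_segment x y edge_of P"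
  shows "x extreme_point_of P" "y extreme_point_of P" "x \<noteq> y" "x \<in> P" "y \<in> P"
proof -
  have f: "closed_segment x y face_of P" and d: "aff_dim (closed_segment x y) = 1"
    using assms by (auto simp: edge_of_def)
  show "x extreme_point_of P" "y extreme_point_of P"
    using extreme_point_of_face[OF f] by (auto simp: extreme_point_of_segment)
  show "x \<noteq> y" using d by auto
  show "x \<in> P" "y \<in> P" using f face_of_imp_subset by fastforce+
qed

lemma edge_of_face_eq: "F face_of P \<Longrightarrow> e edge_of F \<longleftrightarrow> e edge_of P \<and> e \<subseteq> F"
  by (auto simp: edge_of_def face_of_face)

lemma edge_is_segment:
  fixes P :: "'a::euclidean_space set"
  assumes "compact P" "convex P" "e edge_of P"
  obtains x y where "e = closed_segment x y" "x \<noteq> y"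
proof -
  have f: "e face_of P" and d: "aff_dim e = 1"
    using assms by (auto simp: edge_of_def)
  then have "e \<noteq> {}" by auto
  moreover have "compact e" "convex e"
    using f assms face_of_imp_compact face_of_imp_convex by blast+
  moreover have "collinear e" by (simp add: collinear_aff_dim d)
  ultimately obtain x y where "e = closed_segment x y"
    using compact_convex_collinear_segment by blast
  then show thesis using that d by force
qed

lemma aff_dim_segment: "aff_dim (closed_segment x (y::'a::euclidean_space)) = (if x = y then 0 else 1)"
  by (simp add: segment_convex_hull aff_dim_convex_hull aff_dim_2)

text \<open>The intersection of all faces containing \<open>m\<close> works: were \<open>m\<close>
  outside its relative interior, it would lie in a facet of that face, and this facet would be a
  smaller face containing \<open>m\<close>.\<close>

lemma minimal_face:
  fixes P :: "'a::euclidean_space set"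
  assumes "polytope P" "m \<in> P"
  obtains G where "G face_of P" "m \<in> rel_interior G"
proof -
  let ?G = "\<Inter>{F. F face_of P \<and> m \<in> F}"
  have ne: "{F. F face_of P \<and> m \<in> F} \<noteq> {}"
    using assms face_of_refl polytope_imp_convex by blast
  have f: "?G face_of P"
    by (rule face_of_Inter[OF ne]) auto
  have G: "polytope ?G" using face_of_polytope_polytope[OF assms(1) f] .
  have "m \<in> rel_interior ?G"
  proof (rule ccontr)
    assume "m \<notin> rel_interior ?G"
    moreover have "m \<in> ?G" by auto
    ultimately obtain F where F: "F facet_of ?G" "m \<in> F"
      using rel_interior_of_polyhedron[of ?G] G polytope_imp_polyhedron by blast
    then have "F face_of P"
      using f face_of_trans facet_of_imp_face_of by blast
    with F have "?G \<subseteq> F" by blast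
    then have "F = ?G" using F facet_of_imp_subset by blast
    then show False using F by simp
  qed
  with f that show thesis by blast
qed

text \<open>Puts a relative interior point strictly inside a segment that starts at a prescribed
  point, the form in which the defining property of faces applies.\<close>

lemma rel_interior_extend:
  fixes S :: "'a::euclidean_space set"
  assumes "convex S" "m \<in> rel_interior S" "y \<in> S" "y \<noteq> m"
  obtains y' where "y' \<in> S" "m \<in> open_segment y y'"
proof -
  have "y \<in> affine hull S" using assms hull_inc by fast
  from convex_rel_interior_if[OF assms(1,2)] this obtain e where
    e: "e > 1" "(1 - e) *\<^sub>R y + e *\<^sub>R m \<in> S" by fastforce
  let ?y = "(1 - e) *\<^sub>R y + e *\<^sub>R m"
  have "?y - y = e *\<^sub>R (m - y)" by (simp add: algebra_simps)
  then have ne: "?y \<noteq> y" using e assms by auto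
  have "m = (1 - 1/e) *\<^sub>R y + (1/e) *\<^sub>R ?y"
    using e by (simp add: algebra_simps) 
  then have "m \<in> open_segment y ?y"
    unfolding in_segment using e ne by (metis divide_less_eq_1_pos less_trans zero_less_divide_1_iff zero_less_one)
  with e that show thesis by blast
qed

text \<open>Take a functional exposing \<open>v\<close> and the level halfway between its value at
  \<open>v\<close> and its largest value at another vertex. The hyperplane at this level cuts
  \<open>P\<close> in the vertex figure of \<open>v\<close>.\<close>

lemma vertex_separation:
  fixes P :: "'a::euclidean_space set"
  assumes "polytope P" "v extreme_point_of P"
  obtains h \<beta> where "h \<bullet> v > \<beta>" "\<And>x. x extreme_point_of P \<Longrightarrow> x \<noteq> v \<Longrightarrow> h \<bullet> x < \<beta>"
proof -
  obtain h where h: "maxface P h = {v}" by (rule vertex_maxface[OF assms])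
  have lt: "h \<bullet> x < h \<bullet> v" if "x extreme_point_of P" "x \<noteq> v" for x
  proof (rule ccontr)
    assume "\<not> h \<bullet> x < h \<bullet> v"
    moreover have "v \<in> maxface P h" "x \<in> P"
      using h that(1) by (auto simp: extreme_point_of_def)
    ultimately have "x \<in> maxface P h" unfolding maxface_def by (auto intro: order_trans)
    with h that show False by auto
  qed
  let ?V = "{x. x extreme_point_of P} - {v}"
  have fin: "finite ?V" using finite_vertices assms by blast
  show thesis
  proof (cases "?V = {}")
    case True
    then show thesis using that[of "h \<bullet> v - 1" h] by auto
  next
    case False
    define M where "M = Max ((\<bullet>) h ` ?V)"
    have "M \<in> (\<bullet>) h ` ?V" unfolding M_def by (rule Max_in) (use fin False in auto)
    then have M: "M < h \<bullet> v" using lt by auto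
    have "h \<bullet> x \<le> M" if "x extreme_point_of P" "x \<noteq> v" for x
      unfolding M_def by (rule Max_ge) (use fin that in auto)
    with M that[of "(M + h \<bullet> v)/2" h] show thesis by force
  qed
qed

section \<open>Faces of the vertex figure\<close>

lemma crossing_point:
  fixes h x y :: "'a::euclidean_space"
  assumes "h \<bullet> x > \<beta>" "h \<bullet> y < \<beta>"
  obtains z where "z \<in> open_segment x y" "h \<bullet> z = \<beta>"
proof -
  define t where "t = (h \<bullet> x - \<beta>) / (h \<bullet> x - h \<bullet> y)"
  have t: "0 < t" "t < 1" using assms by (auto simp: t_def field_simps)
  have ne: "x \<noteq> y" using assms by auto
  have "h \<bullet> ((1 - t) *\<^sub>R x + t *\<^sub>R y) = h \<bullet> x - t * (h \<bullet> x - h \<bullet> y)"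
    by (simp add: inner_add_right algebra_simps)
  also have "\<dots> = \<beta>" using assms by (simp add: t_def)
  finally show thesis
    using that[of "(1 - t) *\<^sub>R x + t *\<^sub>R y"] t ne unfolding in_segment by blast
qed

lemma open_segment_affine:
  fixes x y :: "'a::euclidean_space"
  assumes "z \<in> open_segment x y"
  shows "y \<in> affine hull {x, z}"
proof -
  obtain t where t: "0 < t" "z = (1 - t) *\<^sub>R x + t *\<^sub>R y"
    using assms by (auto simp: in_segment)
  have "y = (1 - 1/t) *\<^sub>R x + (1/t) *\<^sub>R z"
    unfolding t(2) using t(1) by (simp add: algebra_simps)
  then show ?thesis
    unfolding affine_hull_2 using diff_add_cancel by blast
qed

lemma convex_hull_less:
  fixes h :: "'a::euclidean_space"
  assumes "x \<in> convex hull V" "\<And>v. v \<in> V \<Longrightarrow> h \<bullet> v < \<beta>"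
  shows "h \<bullet> x < \<beta>"
proof -
  have "convex hull V \<subseteq> {x. h \<bullet> x < \<beta>}"
    by (rule hull_minimal) (use assms convex_halfspace_lt in auto)
  with assms show ?thesis by auto
qed

text \<open>\<open>G\<close> is the smallest face containing a relative interior point
  \<open>m\<close> of \<open>E\<close>. Its section by the hyperplane is \<open>E\<close>, and it
  contains \<open>v\<close>, since otherwise all its vertices, and with them \<open>m\<close>, would
  lie below the hyperplane. A segment in \<open>G\<close> that crosses the hyperplane does so in
  \<open>E\<close>; hence \<open>v\<close> and \<open>E\<close> span \<open>G\<close>. The dimension
  rises by one because \<open>v\<close> is off the hyperplane.\<close>

lemma vertex_figure_face:
  fixes P :: "'a::euclidean_space set"
  assumes P: "polytope P" and v: "v extreme_point_of P" and hv: "h \<bullet> v > \<beta>"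
    and hx: "\<And>x. x extreme_point_of P \<Longrightarrow> x \<noteq> v \<Longrightarrow> h \<bullet> x < \<beta>"
    and E: "E face_of (P \<inter> {x. h \<bullet> x = \<beta>})" "E \<noteq> {}"
  obtains G where "G face_of P" "insert v E \<subseteq> G" "aff_dim G = aff_dim E + 1"
proof -
  let ?H = "{x. h \<bullet> x = \<beta>}"
  have cE: "convex E" using E face_of_imp_convex by blast
  obtain m where m: "m \<in> rel_interior E"
    using E cE rel_interior_eq_empty by blast
  have EK: "E \<subseteq> P \<inter> ?H" using E face_of_imp_subset by blast
  have mE: "m \<in> E" using m rel_interior_subset by blast
  then have mP: "m \<in> P" and hm: "h \<bullet> m = \<beta>" using EK by auto
  obtain G where G: "G face_of P" "m \<in> rel_interior G"
    using minimal_face P mP by blast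
  have mG: "m \<in> G" using G rel_interior_subset by blast
  have cG: "convex G" using G face_of_imp_convex by blast
  have GP: "G \<subseteq> P" using G face_of_imp_subset by blast
  have pG: "polytope G" using G P face_of_polytope_polytope by blast
  have EG: "E \<subseteq> G"
  proof
    fix y assume y: "y \<in> E"
    show "y \<in> G"
    proof (cases "y = m")
      case False
      then obtain y' where "y' \<in> E" "m \<in> open_segment y y'"
        using rel_interior_extend cE m y by metis
      then show ?thesis using face_ofD[OF G(1)] mG EK y by blast
    qed (use mG in auto)
  qed
  have GH: "G \<inter> ?H \<subseteq> E"
  proof
    fix y assume y: "y \<in> G \<inter> ?H"
    show "y \<in> E"
    proof (cases "y = m")
      case False
      then obtain y' where y': "y' \<in> G" "m \<in> open_segment y y'"
        using rel_interior_extend cG G y by (metis IntD1)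
      then obtain t where t: "0 < t" "m = (1 - t) *\<^sub>R y + t *\<^sub>R y'"
        by (auto simp: in_segment)
      have "\<beta> = (1 - t) * \<beta> + t * (h \<bullet> y')"
        using y hm t(2) by (simp add: inner_add_right)
      then have "t * (h \<bullet> y' - \<beta>) = 0" unfolding right_diff_distrib left_diff_distrib
        by linarith
      then have "h \<bullet> y' = \<beta>" using t(1) by auto
      then show ?thesis using face_ofD[OF E(1) y'(2)] y y' GP mE by blast
    qed (use mE in auto)
  qed
  have vG: "v \<in> G"
  proof (rule ccontr)
    assume "v \<notin> G"
    then have "h \<bullet> w < \<beta>" if "w extreme_point_of G" for w
      using that hx extreme_point_of_face[OF G(1)] by metis
    then have "h \<bullet> m < \<beta>"
      using convex_hull_less[of m "{w. w extreme_point_of G}"] mG polytope_hull_vertices[OF pG] by auto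
    then show False using hm by simp
  qed
  have low: "y \<in> affine hull (insert v E)" if y: "y \<in> G" "h \<bullet> y < \<beta>" for y
  proof -
    obtain z where z: "z \<in> open_segment v y" "h \<bullet> z = \<beta>"
      using crossing_point[OF hv y(2)] by blast
    have "z \<in> closed_segment v y" using open_closed_segment[OF z(1)]  .
    then have "z \<in> G" using closed_segment_subset[OF vG y(1) cG] by blast
    then have "z \<in> E" using GH z by auto
    then have "affine hull {v, z} \<subseteq> affine hull (insert v E)" by (intro hull_mono) auto
    then show ?thesis using open_segment_affine[OF z(1)] by blast
  qed
  \<comment> \<open>A point of \<open>G\<close> on the same side as \<open>v\<close> cannot be
    joined to \<open>v\<close> across the hyperplane. Prolonging the segment from \<open>v\<close>
    beyond \<open>m\<close> supplies a second base point \<open>w\<close> on the other side.\<close>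
  have "v \<noteq> m" using hv hm by auto
  then obtain w where w: "w \<in> G" "m \<in> open_segment v w"
    using rel_interior_extend cG G vG by metis
  have hw: "h \<bullet> w < \<beta>"
  proof -
    obtain t where t: "0 < t" "t < 1" "m = (1 - t) *\<^sub>R v + t *\<^sub>R w"
      using w by (auto simp: in_segment)
    then have "\<beta> = (1 - t) * (h \<bullet> v) + t * (h \<bullet> w)"
      using hm by (simp add: inner_add_right)
    moreover have "(1 - t) * (h \<bullet> v) > (1 - t) * \<beta>" using t hv by simp
    ultimately have "t * (h \<bullet> w) < t * \<beta>" by (simp add: algebra_simps)
    then show ?thesis using t by simp
  qed
  have high: "y \<in> affine hull (insert v E)" if y: "y \<in> G" "h \<bullet> y > \<beta>" for y
  proof -
    obtain z where z: "z \<in> open_segment y w" "h \<bullet> z = \<beta>"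
      using crossing_point[OF y(2) hw] by blast
    have "z \<in> closed_segment y w" using open_closed_segment[OF z(1)]  .
    then have "z \<in> G" using closed_segment_subset[OF y(1) w(1) cG] by blast
    then have "z \<in> E" using GH z by auto
    then have "{w, z} \<subseteq> affine hull (insert v E)"
      using low[OF w(1) hw] by (auto intro: hull_inc)
    then have "affine hull {w, z} \<subseteq> affine hull (insert v E)" 
      by (simp add: hull_minimal)
    then show ?thesis using open_segment_affine[of z w y] z open_segment_commute by blast
  qed
  have "G \<subseteq> affine hull (insert v E)"
  proof
    fix y assume "y \<in> G"
    then show "y \<in> affine hull (insert v E)"
      using low[of y] high[of y] GH hull_inc[of y "insert v E"]
      by (cases "h \<bullet> y = \<beta>") force+
  qed
  then have "aff_dim G = aff_dim (insert v E)"
    using EG vG by (metis aff_dim_affine_hull aff_dim_subset antisym insert_subset)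
  also have "\<dots> = aff_dim E + 1"
  proof -
    have "affine hull E \<subseteq> ?H" by (rule hull_minimal) (use EK affine_hyperplane in auto)
    then have "v \<notin> affine hull E" using hv by auto
    then show ?thesis by (simp add: aff_dim_insert)
  qed
  finally show thesis using that[OF G(1)] EG vG by auto
qed

text \<open>The zero-dimensional case of \<open>vertex_figure_face\<close>: the face through
  \<open>v\<close> and \<open>u\<close> has dimension one, and \<open>u\<close> is neither of its
  ends.\<close>

lemma vertex_figure_vertex:
  fixes P :: "'a::euclidean_space set"
  assumes P: "polytope P" and v: "v extreme_point_of P" and hv: "h \<bullet> v > \<beta>"
    and hx: "\<And>x. x extreme_point_of P \<Longrightarrow> x \<noteq> v \<Longrightarrow> h \<bullet> x < \<beta>"
    and u: "u extreme_point_of (P \<inter> {x. h \<bullet> x = \<beta>})"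
  obtains w where "closed_segment v w edge_of P" "u \<in> open_segment v w"
proof -
  have "{u} face_of (P \<inter> {x. h \<bullet> x = \<beta>})" using u by (simp add: face_of_singleton)
  from vertex_figure_face[OF P v hv hx this]
  obtain G where G: "G face_of P" "insert v {u} \<subseteq> G" "aff_dim G = aff_dim {u} + 1" by blast
  then have e: "G edge_of P" by (simp add: edge_of_def)
  obtain x y where xy: "G = closed_segment x y"
    using edge_is_segment[OF polytope_imp_compact[OF P] polytope_imp_convex[OF P] e] by metis
  have "v extreme_point_of G" using extreme_point_of_face[OF G(1)] v G by blast
  then have "v = x \<or> v = y" by (simp add: xy extreme_point_of_segment)
  then obtain w where w: "G = closed_segment v w" using xy closed_segment_commute by metis
  have hu: "h \<bullet> u = \<beta>" using u by (auto simp: extreme_point_of_def)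
  have "w extreme_point_of P" "w \<noteq> v" using edge_vertices[of v w P] e w by auto
  then have "h \<bullet> w < \<beta>" by (rule hx)
  then have "u \<noteq> v" "u \<noteq> w" using hv hu by auto
  then have "u \<in> open_segment v w" using G w by (auto simp: open_segment_def)
  then show thesis using that e w by blast
qed

section \<open>The simplex method and connectedness of the edge graph\<close>

lemma open_segment_functional:
  fixes c x y z :: "'a::euclidean_space"
  assumes "z \<in> open_segment x y"
  shows "c \<bullet> z > c \<bullet> x \<longleftrightarrow> c \<bullet> y > c \<bullet> x"
proof -
  obtain t where t: "0 < t" "z = (1 - t) *\<^sub>R x + t *\<^sub>R y"
    using assms by (auto simp: in_segment)
  have "c \<bullet> z - c \<bullet> x = t * (c \<bullet> y - c \<bullet> x)"
    unfolding t(2) by (simp add: inner_add_right algebra_simps)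
  then show ?thesis using t(1) by (metis diff_gt_0_iff_gt zero_less_mult_pos zero_less_mult_iff)
qed

lemma polytope_hyperplane_section:
  fixes P :: "'a::euclidean_space set"
  shows "polytope P \<Longrightarrow> polytope (P \<inter> {x. h \<bullet> x = \<beta>})"
  by (intro polytope_Int_polyhedron polyhedron_hyperplane)

text \<open>The segment from \<open>v\<close> to an optimal vertex meets the vertex figure in a
  point better than \<open>v\<close>. A vertex of the vertex figure that maximizes \<open>c\<close>
  is at least as good, and it lies on an edge at \<open>v\<close>.\<close>

lemma exists_improving_edge:
  fixes P :: "'a::euclidean_space set"
  assumes P: "polytope P" and v: "v extreme_point_of P" and nmax: "v \<notin> maxface P c"
  obtains w where "closed_segment v w edge_of P" "c \<bullet> w > c \<bullet> v"
proof -
  have vP: "v \<in> P" using v by (auto simp: extreme_point_of_def)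
  obtain z where z: "z extreme_point_of P" "z \<in> maxface P c"
    using maxface_has_vertex[OF P] vP by blast
  have cz: "c \<bullet> z > c \<bullet> v"
    using nmax z vP by (force simp: maxface_def)
  obtain h \<beta> where h: "h \<bullet> v > \<beta>" "\<And>x. x extreme_point_of P \<Longrightarrow> x \<noteq> v \<Longrightarrow> h \<bullet> x < \<beta>"
    using vertex_separation[OF P v] by metis
  have "z \<noteq> v" using cz by auto
  then have "h \<bullet> z < \<beta>" using h z by blast
  then obtain y where y: "y \<in> open_segment v z" "h \<bullet> y = \<beta>"
    using crossing_point h by blast
  let ?K = "P \<inter> {x. h \<bullet> x = \<beta>}"
  have "y \<in> P"
    using open_closed_segment[OF y(1)] closed_segment_subset[OF vP _ polytope_imp_convex[OF P], of z] z(2)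
    by (auto simp: maxface_def)
  then have yK: "y \<in> ?K" using y by auto
  have "polytope ?K" by (rule polytope_hyperplane_section[OF P])
  then obtain u where u: "u extreme_point_of ?K" "u \<in> maxface ?K c"
    using maxface_has_vertex[of ?K] yK by (metis empty_iff)
  have "c \<bullet> v < c \<bullet> y" using open_segment_functional[OF y(1)] cz by blast
  also have "\<dots> \<le> c \<bullet> u" using u yK by (auto simp: maxface_def)
  finally have cu: "c \<bullet> u > c \<bullet> v" .
  obtain w where w: "closed_segment v w edge_of P" "u \<in> open_segment v w"
    using vertex_figure_vertex[OF P v h u(1)] by blast
  then show thesis using that open_segment_functional[OF w(2)] cu by blast
qed

text \<open>Each improving edge lowers the number of strictly better vertices, so the walk
  terminates.\<close>

lemma reach_maxface:
  fixes P :: "'a::euclidean_space set"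
  assumes P: "polytope P" and v: "v extreme_point_of P"
  obtains w where "w extreme_point_of P" "w \<in> maxface P c"
    "(v, w) \<in> {(x, y). closed_segment x y edge_of P \<and> c \<bullet> x < c \<bullet> y}\<^sup>*"
proof -
  let ?R = "{(x, y). closed_segment x y edge_of P \<and> c \<bullet> x < c \<bullet> y}"
  have "\<exists>w. w extreme_point_of P \<and> w \<in> maxface P c \<and> (v, w) \<in> ?R\<^sup>*"
    using v
  proof (induction "card {x. x extreme_point_of P \<and> c \<bullet> x > c \<bullet> v}" arbitrary: v rule: less_induct)
    case less
    show ?case
    proof (cases "v \<in> maxface P c")
      case False
      obtain u where u: "closed_segment v u edge_of P" "c \<bullet> u > c \<bullet> v"
        using exists_improving_edge[OF P less.prems False] by blast
      have uv: "u extreme_point_of P" using u edge_vertices by blast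
      have "card {x. x extreme_point_of P \<and> c \<bullet> x > c \<bullet> u} < card {x. x extreme_point_of P \<and> c \<bullet> x > c \<bullet> v}"
        by (rule psubset_card_mono) (use finite_vertices[OF P] u uv in auto)
      from less.hyps[OF this uv] obtain w where
        w: "w extreme_point_of P" "w \<in> maxface P c" "(u, w) \<in> ?R\<^sup>*" by blast
      have "(v, u) \<in> ?R" using u by auto
      with w show ?thesis by (meson converse_rtrancl_into_rtrancl)
    qed (use less.prems in blast)
  qed
  then show thesis using that by blast
qed

text \<open>After the optimal face is reached, a second walk inside it, guided by a functional
  exposing \<open>w\<close>, leads to the prescribed vertex. There \<open>c\<close> is constant,
  whence the weak inequality.\<close>

lemma reach_vertex:
  fixes P :: "'a::euclidean_space set"
  assumes P: "polytope P" and v: "v extreme_point_of P" and w: "w extreme_point_of P" "w \<in> maxface P c"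
  shows "(v, w) \<in> {(x, y). closed_segment x y edge_of P \<and> c \<bullet> x \<le> c \<bullet> y}\<^sup>*"
proof -
  let ?R = "{(x, y). closed_segment x y edge_of P \<and> c \<bullet> x \<le> c \<bullet> y}"
  let ?M = "maxface P c"
  obtain m where m: "m extreme_point_of P" "m \<in> ?M"
    "(v, m) \<in> {(x, y). closed_segment x y edge_of P \<and> c \<bullet> x < c \<bullet> y}\<^sup>*"
    using reach_maxface[OF P v] by blast
  have fM: "?M face_of P" by (simp add: maxface_face_of polytope_imp_convex P)
  have pM: "polytope ?M" using face_of_polytope_polytope[OF P fM] .
  have mM: "m extreme_point_of ?M" "w extreme_point_of ?M"
    using extreme_point_of_face[OF fM] m w by auto
  obtain k where k: "maxface ?M k = {w}" by (rule vertex_maxface[OF pM mM(2)])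
  obtain w' where w': "w' extreme_point_of ?M" "w' \<in> maxface ?M k"
    "(m, w') \<in> {(x, y). closed_segment x y edge_of ?M \<and> k \<bullet> x < k \<bullet> y}\<^sup>*"
    using reach_maxface[OF pM mM(1)] by blast
  have "{(x, y). closed_segment x y edge_of ?M \<and> k \<bullet> x < k \<bullet> y} \<subseteq> ?R"
  proof clarify
    fix x y assume e: "closed_segment x y edge_of ?M"
    then have "x \<in> ?M" "y \<in> ?M" using edge_vertices by blast+
    then show "closed_segment x y edge_of P \<and> c \<bullet> x \<le> c \<bullet> y"
      using e edge_of_face_eq[OF fM] by (auto simp: maxface_def)
  qed
  from subsetD[OF rtrancl_mono[OF this] w'(3)] have "(m, w) \<in> ?R\<^sup>*" using w'(2) k by simp
  moreover have "(v, m) \<in> ?R\<^sup>*"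
    by (rule subsetD[OF rtrancl_mono m(3)]) auto
  ultimately show ?thesis by (rule rtrancl_trans[rotated])
qed

lemma vertices_connected:
  fixes P :: "'a::euclidean_space set"
  assumes "polytope P" "v extreme_point_of P" "w extreme_point_of P"
  shows "(v, w) \<in> {(x, y). closed_segment x y edge_of P}\<^sup>*"
proof -
  \<comment> \<open>For the zero functional every vertex is optimal and monotonicity is
    vacuous.\<close>
  have "w \<in> maxface P 0" using assms by (auto simp: maxface_def extreme_point_of_def)
  from reach_vertex[OF assms this] show ?thesis by simp
qed

text \<open>Connectedness of the part of the vertex figure that lies in an open half-space.\<close>

lemma improving_edges_connected:
  fixes P :: "'a::euclidean_space set"
  assumes P: "polytope P"
    and w: "closed_segment v w edge_of P" "c \<bullet> w > c \<bullet> v"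
    and w': "closed_segment v w' edge_of P" "c \<bullet> w' > c \<bullet> v"
  shows "(w, w') \<in> {(x, y). closed_segment v x edge_of P \<and> c \<bullet> x > c \<bullet> v \<and>
           closed_segment v y edge_of P \<and> c \<bullet> y > c \<bullet> v \<and>
           (\<exists>G. G face_of P \<and> aff_dim G = 2 \<and> closed_segment v x \<subseteq> G \<and> closed_segment v y \<subseteq> G)}\<^sup>*"
    (is "_ \<in> ?L\<^sup>*")
proof -
  have v: "v extreme_point_of P" using w edge_vertices by blast
  obtain h \<beta> where h: "h \<bullet> v > \<beta>" "\<And>x. x extreme_point_of P \<Longrightarrow> x \<noteq> v \<Longrightarrow> h \<bullet> x < \<beta>"
    using vertex_separation[OF P v] by metis
  define K where "K = P \<inter> {x. h \<bullet> x = \<beta>}"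
  have pK: "polytope K" unfolding K_def by (rule polytope_hyperplane_section[OF P])
  \<comment> \<open>An edge at \<open>v\<close> meets the hyperplane in a single point, and the
    slice of a face is a face of the section.\<close>
  have crossing: "\<exists>u. u extreme_point_of K \<and> u \<in> open_segment v x"
    if e: "closed_segment v x edge_of P" for x
  proof -
    have "x extreme_point_of P" "x \<noteq> v" using edge_vertices[OF e] by auto
    then obtain u where u: "u \<in> open_segment v x" "h \<bullet> u = \<beta>"
      using crossing_point h by blast
    have "closed_segment v x \<inter> {x. h \<bullet> x = \<beta>} = {u}"
    proof -
      have "z = u" if z: "z \<in> closed_segment v x" "h \<bullet> z = \<beta>" for z
      proof -
        obtain s t where s: "z = (1 - s) *\<^sub>R v + s *\<^sub>R x" and t: "u = (1 - t) *\<^sub>R v + t *\<^sub>R x"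
          using z u by (auto simp: in_segment)
        have "(1 - s) * (h \<bullet> v) + s * (h \<bullet> x) = (1 - t) * (h \<bullet> v) + t * (h \<bullet> x)"
          using z(2) u(2) unfolding s t by (simp add: inner_add_right)
        then have "(s - t) * (h \<bullet> x - h \<bullet> v) = 0" by (simp add: algebra_simps)
        moreover have "h \<bullet> x - h \<bullet> v \<noteq> 0"
          using h \<open>x extreme_point_of P\<close> \<open>x \<noteq> v\<close> by fastforce
        ultimately show ?thesis by (simp add: s t)
      qed
      then show ?thesis using u by (auto simp: open_segment_def)
    qed
    moreover have "closed_segment v x \<inter> {x. h \<bullet> x = \<beta>} face_of K"
      unfolding K_def by (rule face_of_slice) (use e convex_hyperplane in \<open>auto simp: edge_of_def\<close>)
    ultimately show ?thesis using u face_of_singleton by metis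
  qed
  obtain u where u: "u extreme_point_of K" "u \<in> open_segment v w" using crossing[OF w(1)] by blast
  obtain u' where u': "u' extreme_point_of K" "u' \<in> open_segment v w'" using crossing[OF w'(1)]
    by blast
  have K0: "K \<noteq> {}" using u by (auto simp: extreme_point_of_def)
  \<comment> \<open>Monotone paths in the section from both given edges end at this common maximizer
    of \<open>c\<close>.\<close>
  obtain t where t: "t extreme_point_of K" "t \<in> maxface K c"
    using maxface_has_vertex[OF pK K0] by blast
  have same: "x = y" if "closed_segment v x edge_of P" "closed_segment v y edge_of P"
    "z \<in> open_segment v x" "z \<in> open_segment v y" for x y z
  proof -
    have f: "closed_segment v x face_of P" using that by (simp add: edge_of_def)
    have "y \<in> closed_segment v x"
      using face_ofD[OF f that(4)] that(3) edge_vertices[OF that(2)] segment_open_subset_closed by blast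
    then have "y extreme_point_of closed_segment v x"
      using extreme_point_of_face[OF f] edge_vertices[OF that(2)] by blast
    then show "x = y" using edge_vertices[OF that(2)] by (auto simp: extreme_point_of_segment)
  qed
  \<comment> \<open>An edge of the section spans a 2-face together with \<open>v\<close>, so a path
    in the section is a walk among the edges at \<open>v\<close>. As \<open>c\<close> never falls
    along it, every edge visited is improving.\<close>
  have main: "\<forall>y. closed_segment v y edge_of P \<longrightarrow> z \<in> open_segment v y \<longrightarrow> c \<bullet> z > c \<bullet> v \<and> (x, y) \<in> ?L\<^sup>*"
    if z: "(u0, z) \<in> {(x, y). closed_segment x y edge_of K \<and> c \<bullet> x \<le> c \<bullet> y}\<^sup>*"
      and x: "closed_segment v x edge_of P" "c \<bullet> x > c \<bullet> v" and u0: "u0 \<in> open_segment v x"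
    for u0 x z
    using z
  proof (induction rule: rtrancl_induct)
    case base
    show ?case
      using same[OF x(1)] u0 open_segment_functional[OF u0, of c] x(2) by blast
  next
    case (step a b)
    have e: "closed_segment a b edge_of K" and cab: "c \<bullet> a \<le> c \<bullet> b" using step
      by auto
    have ab: "a extreme_point_of K" "b extreme_point_of K" using edge_vertices[OF e] by auto
    obtain y where y: "closed_segment v y edge_of P" "a \<in> open_segment v y"
      using vertex_figure_vertex[OF P v h] ab(1) K_def by metis
    have ca: "c \<bullet> a > c \<bullet> v" and xy: "(x, y) \<in> ?L\<^sup>*" using step.IH y by auto
    then have cy: "c \<bullet> y > c \<bullet> v" using open_segment_functional[OF y(2)] by blast
    have cb: "c \<bullet> b > c \<bullet> v" using ca cab by simp
    show ?case
    proof (intro allI impI conjI)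
      fix y' assume y': "closed_segment v y' edge_of P" "b \<in> open_segment v y'"
      have cy': "c \<bullet> y' > c \<bullet> v" using open_segment_functional[OF y'(2)] cb by blast
      have "closed_segment a b face_of P \<inter> {x. h \<bullet> x = \<beta>}" "closed_segment a b \<noteq> {}"
        using e by (auto simp: edge_of_def K_def)
      from vertex_figure_face[OF P v h this] obtain G where
        G: "G face_of P" "insert v (closed_segment a b) \<subseteq> G" "aff_dim G = aff_dim (closed_segment a b) + 1" by blast
      have "aff_dim G = 2" using G(3) e by (simp add: edge_of_def)
      moreover have "closed_segment v y \<subseteq> G"
      proof -
        have "y \<in> G" using face_ofD[OF G(1) y(2)] G(2) edge_vertices[OF y(1)] by auto
        then show ?thesis using G closed_segment_subset face_of_imp_convex by (metis insert_subset)
      qed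
      moreover have "closed_segment v y' \<subseteq> G"
      proof -
        have "y' \<in> G" using face_ofD[OF G(1) y'(2)] G(2) edge_vertices[OF y'(1)] by auto
        then show ?thesis using G closed_segment_subset face_of_imp_convex by (metis insert_subset)
      qed
      ultimately have "(y, y') \<in> ?L" using y y' cy cy' G(1) by auto
      then show "(x, y') \<in> ?L\<^sup>*" using xy by (rule rtrancl_into_rtrancl[rotated])
    qed (use cb in auto)
  qed
  obtain y where y: "closed_segment v y edge_of P" "t \<in> open_segment v y"
    using vertex_figure_vertex[OF P v h] t(1) K_def by metis
  have "(w, y) \<in> ?L\<^sup>*"
    using main[OF reach_vertex[OF pK u(1) t] w u(2)] y by blast
  moreover have "(w', y) \<in> ?L\<^sup>*"
    using main[OF reach_vertex[OF pK u'(1) t] w' u'(2)] y by blast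
  moreover have "sym ?L" by (rule symI) auto
  then have "sym (?L\<^sup>*)" by (rule sym_rtrancl)
  ultimately show ?thesis by (meson symD rtrancl_trans)
qed


subsection \<open>Weak Minkowski summands\<close>

text \<open>The functionals that agree on two given points form a hyperplane, and finitely many
  hyperplanes do not fill the space because their union is negligible.\<close>

lemma exists_injective_functional:
  fixes S :: "'a::euclidean_space set"
  assumes "finite S"
  obtains h where "inj_on ((\<bullet>) h) S"
proof -
  let ?D = "(\<lambda>(x, y). x - y) ` {(x, y) \<in> S \<times> S. x \<noteq> y}"
  let ?N = "\<Union>d\<in>?D. {h. d \<bullet> h = 0}"
  have "finite {(x, y) \<in> S \<times> S. x \<noteq> y}"
    by (rule finite_subset[of _ "S \<times> S"]) (use assms in auto)
  then have "negligible ?N"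
    by (intro negligible_Union finite_imageI) (auto intro!: negligible_hyperplane)
  then have "?N \<noteq> UNIV" using non_negligible_UNIV by metis
  then obtain h where h: "h \<notin> ?N" by blast
  have "inj_on ((\<bullet>) h) S"
  proof (rule inj_onI, rule ccontr)
    fix x y assume "x \<in> S" "y \<in> S" "h \<bullet> x = h \<bullet> y" "x \<noteq> y"
    then have "h \<in> ?N"
      by (intro UN_I[of "x - y"]) (auto simp: inner_diff_left inner_diff_right inner_commute)
    with h show False by blast
  qed
  then show thesis by (rule that)
qed

text \<open>The vertices are processed from top to bottom with respect to a generic functional; the
  connectedness of the improving edges makes the value at a new vertex independent of the edge
  along which it is defined.\<close>

lemma edge_weights_potential:
  fixes P :: "'a::euclidean_space set" and w :: "'a \<Rightarrow> 'a \<Rightarrow> 'b::ab_group_add"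
  assumes P: "polytope P"
    and anti: "\<And>x y. closed_segment x y edge_of P \<Longrightarrow> w y x = - w x y"
    and two: "\<And>G. G face_of P \<Longrightarrow> aff_dim G = 2 \<Longrightarrow>
       \<exists>\<gamma>. \<forall>x y. closed_segment x y edge_of G \<longrightarrow> \<gamma> x - \<gamma> y = w x y"
  obtains g where "\<And>x y. closed_segment x y edge_of P \<Longrightarrow> g x - g y = w x y"
proof -
  let ?V = "{x. x extreme_point_of P}"
  have fin: "finite ?V" by (rule finite_vertices[OF P])
  obtain h where h: "inj_on ((\<bullet>) h) ?V" using exists_injective_functional[OF fin] by blast
  \<comment> \<open>\<open>S\<close> is closed upwards with respect to \<open>h\<close>, and the
    induction removes its lowest vertex \<open>v\<close>. Upward closure ensures that all improving
    neighbours of \<open>v\<close> have been treated.\<close>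
  have main: "\<exists>g. \<forall>x\<in>S. \<forall>y\<in>S. closed_segment x y edge_of P \<longrightarrow> g x - g y = w x y"
    if "S \<subseteq> ?V" "\<forall>x\<in>S. \<forall>y\<in>?V. h \<bullet> y > h \<bullet> x \<longrightarrow> y \<in> S" for S
    using that
  proof (induction "card S" arbitrary: S rule: less_induct)
    case less
    have fS: "finite S" using less.prems(1) fin finite_subset by blast
    show ?case
    proof (cases "S = {}")
      case False
      obtain v where v: "v \<in> S" "\<And>x. x \<in> S \<Longrightarrow> h \<bullet> v \<le> h \<bullet> x"
        using finite_has_minimal[of "(\<bullet>) h ` S"] fS False
        by (metis (no_types, lifting) arg_min_if_finite(1) arg_min_least)
      have vV: "v extreme_point_of P" using v less.prems by auto
      have vS: "h \<bullet> v < h \<bullet> x" if "x \<in> S" "x \<noteq> v" for x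
        using v(2)[OF that(1)] h that less.prems(1) v(1) by (metis inj_onD less_eq_real_def subsetD)
      let ?S = "S - {v}"
      have up: "y \<in> ?S" if "y extreme_point_of P" "h \<bullet> y > h \<bullet> v" for y
        using less.prems(2) v(1) that by auto
      have "card ?S < card S" using v fS by (meson card_Diff1_less)
      moreover have "?S \<subseteq> ?V" using less.prems by blast
      moreover have "\<forall>x\<in>?S. \<forall>y\<in>?V. h \<bullet> y > h \<bullet> x \<longrightarrow> y \<in> ?S"
      proof (intro ballI impI)
        fix x y assume "x \<in> ?S" "y \<in> ?V" "h \<bullet> x < h \<bullet> y"
        moreover from this have "h \<bullet> v < h \<bullet> y" using vS[of x] by auto
        ultimately show "y \<in> ?S" using up by auto
      qed
      ultimately have "\<exists>g. \<forall>x\<in>?S. \<forall>y\<in>?S. closed_segment x y edge_of P \<longrightarrow> g x - g y = w x y"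
        by (rule less.hyps)
      then obtain g where g: "\<And>x y. x \<in> ?S \<Longrightarrow> y \<in> ?S \<Longrightarrow> closed_segment x y edge_of P \<Longrightarrow> g x - g y = w x y"
        by metis
      show ?thesis
      proof (cases "v \<in> maxface P h")
        case True
        \<comment> \<open>Here the lowest vertex of \<open>S\<close> is optimal on all of
          \<open>P\<close>, so \<open>S\<close> is a single point and spans no edge.\<close>
        have "x = v" if "x \<in> S" for x
        proof (rule ccontr)
          assume "x \<noteq> v"
          then have "h \<bullet> v < h \<bullet> x" using vS[OF that] by blast
          moreover have "x \<in> P" using that less.prems(1) by (auto simp: extreme_point_of_def)
          ultimately show False using True by (auto simp: maxface_def)
        qed
        then have "\<not> closed_segment x y edge_of P" if "x \<in> S" "y \<in> S" for x y
          using edge_vertices(3)[of x y P] that by metis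
        then show ?thesis by blast
      next
        case False
        obtain u where u: "closed_segment v u edge_of P" "h \<bullet> u > h \<bullet> v"
          using exists_improving_edge[OF P vV False] by blast
        \<comment> \<open>Above \<open>v\<close>, the function \<open>g\<close> and the potential
          \<open>\<gamma>\<close> of the 2-face have the same increments. Monotone paths from
          \<open>a\<close> and from \<open>b\<close> reach the same top vertex \<open>t\<close> of
          the face and stay above \<open>v\<close>, so \<open>g - \<gamma>\<close> takes the same
          value at \<open>a\<close> and \<open>b\<close>.\<close>
        have face_const: "g a + w v a = g b + w v b"
          if ab: "closed_segment v a edge_of P" "h \<bullet> a > h \<bullet> v" "closed_segment v b edge_of P" "h \<bullet> b > h \<bullet> v"
            and G: "G face_of P" "aff_dim G = 2" "closed_segment v a \<subseteq> G" "closed_segment v b \<subseteq> G"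
          for a b G
        proof -
          obtain \<gamma> where \<gamma>: "\<And>x y. closed_segment x y edge_of G \<Longrightarrow> \<gamma> x - \<gamma> y = w x y"
            using two[OF G(1,2)] by blast
          have pG: "polytope G" using face_of_polytope_polytope[OF P G(1)] .
          have eG: "closed_segment v a edge_of G" "closed_segment v b edge_of G"
            using ab G edge_of_face_eq[OF G(1)] by auto
          have nG: "G \<noteq> {}" using G(3) by auto
          obtain t where t: "t extreme_point_of G" "t \<in> maxface G h"
            using maxface_has_vertex[OF pG nG] by blast
          have *: "h \<bullet> z \<ge> h \<bullet> x \<and> g z - \<gamma> z = g x - \<gamma> x"
            if "(x, z) \<in> {(x, y). closed_segment x y edge_of G \<and> h \<bullet> x \<le> h \<bullet> y}\<^sup>*" "h \<bullet> x > h \<bullet> v" for x z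
            using that
          proof (induction rule: rtrancl_induct)
            case (step y z)
            then have y: "h \<bullet> y \<ge> h \<bullet> x" "g y - \<gamma> y = g x - \<gamma> x" and e: "closed_segment y z edge_of G"
              and yz: "h \<bullet> y \<le> h \<bullet> z" by auto
            have eP: "closed_segment y z edge_of P" using e edge_of_face_eq[OF G(1)] by blast
            then have "y \<in> ?S" "z \<in> ?S"
              using edge_vertices[OF eP] up y yz step.prems by force+
            from g[OF this eP] \<gamma>[OF e] have "g y - g z = \<gamma> y - \<gamma> z" by simp
            then have "g z - \<gamma> z = g y - \<gamma> y" by (simp add: algebra_simps)
            then show ?case using y yz by auto
          qed auto
          have "g t - \<gamma> t = g a - \<gamma> a"
            using *[OF reach_vertex[OF pG edge_vertices(2)[OF eG(1)] t] ab(2)] by blast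
          moreover have "g t - \<gamma> t = g b - \<gamma> b"
            using *[OF reach_vertex[OF pG edge_vertices(2)[OF eG(2)] t] ab(4)] by blast
          ultimately have "(g a - \<gamma> a) + \<gamma> v = (g b - \<gamma> b) + \<gamma> v" by simp
          then have "g a + (\<gamma> v - \<gamma> a) = g b + (\<gamma> v - \<gamma> b)"
            by (simp add: algebra_simps)
          then show ?thesis using \<gamma>[OF eG(1)] \<gamma>[OF eG(2)] by simp
        qed
        have const: "g u + w v u = g y + w v y" if y: "closed_segment v y edge_of P" "h \<bullet> y > h \<bullet> v" for y
          using improving_edges_connected[OF P u y]
        proof (induction rule: rtrancl_induct)
          case (step a b)
          then show ?case using face_const[of a b] by auto
        qed simp
        \<comment> \<open>The value at \<open>v\<close> is forced by the one improving edge to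
          \<open>u\<close>; by \<open>const\<close> it suits every other edge from \<open>v\<close>
          into \<open>S\<close>.\<close>
        define g' where "g' = g(v := g u + w v u)"
        have v': "g' v - g' y = w v y" if "y \<in> S" "closed_segment v y edge_of P" for y
        proof -
          have "y \<noteq> v" using edge_vertices(3)[OF that(2)] by simp
          then show ?thesis using const[OF that(2)] vS[OF that(1)] by (simp add: g'_def)
        qed
        have "g' x - g' y = w x y" if "x \<in> S" "y \<in> S" "closed_segment x y edge_of P" for x y
        proof -
          consider "x = v" | "y = v" | "x \<noteq> v" "y \<noteq> v" by blast
          then show ?thesis
          proof cases
            case 1
            then show ?thesis using v' that by blast
          next
            case 2
            then have e: "closed_segment v x edge_of P" using that closed_segment_commute by metis
            have "g' x - g' y = - (g' v - g' x)" using 2 by simp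
            also have "\<dots> = w x y" using v'[OF that(1) e] anti[OF e] 2 by simp
            finally show ?thesis .
          next
            case 3
            then show ?thesis using g[of x y] that by (simp add: g'_def)
          qed
        qed
        then show ?thesis by blast
      qed
    qed auto
  qed
  from main[of ?V] obtain g where "\<forall>x\<in>?V. \<forall>y\<in>?V. closed_segment x y edge_of P \<longrightarrow> g x - g y = w x y" by auto
  then show thesis using that[of g] edge_vertices by blast
qed

text \<open>The content of an edge-deformation vector with the deforming polytope eliminated. Values
  of \<open>l\<close> off the edges and of \<open>f\<close> off the vertices are
  unconstrained.\<close>

definition edge_map :: "'a::euclidean_space set \<Rightarrow> ('a set \<Rightarrow> real) \<Rightarrow> ('a \<Rightarrow> 'a) \<Rightarrow> bool"
  where "edge_map P l f \<longleftrightarrow> (\<forall>x y. closed_segment x y edge_of P \<longrightarrow>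
    0 \<le> l (closed_segment x y) \<and> f x - f y = l (closed_segment x y) *\<^sub>R (x - y))"

text \<open>On an edge path along which \<open>c\<close> does not fall, \<open>f\<close> moves by
  nonnegative multiples of the same edges, so \<open>c\<close> does not fall along the images
  either.\<close>

lemma edge_map_mono:
  fixes P :: "'a::euclidean_space set"
  assumes P: "polytope P" and f: "edge_map P l f"
    and v: "v extreme_point_of P" and w: "w extreme_point_of P" "w \<in> maxface P c"
  shows "c \<bullet> f v \<le> c \<bullet> f w"
  using reach_vertex[OF P v w]
proof (induction rule: rtrancl_induct)
  case (step x y)
  then have e: "closed_segment x y edge_of P" and c: "c \<bullet> x \<le> c \<bullet> y" by auto
  have "c \<bullet> f x - c \<bullet> f y = l (closed_segment x y) * (c \<bullet> x - c \<bullet> y)"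
    using f e unfolding edge_map_def by (metis inner_diff_right inner_scaleR_right)
  also have "\<dots> \<le> 0" using f e c by (auto simp: edge_map_def mult_nonneg_nonpos)
  finally show ?case using step.IH by simp
qed simp

text \<open>This is the edge map of the complementary summand: the two maps add up to dilation by
  \<open>M\<close>, and the bound on \<open>l\<close> keeps the new factors nonnegative.\<close>

lemma edge_map_complement:
  assumes "edge_map P l f" "\<And>e. e edge_of P \<Longrightarrow> l e \<le> M"
  shows "edge_map P (\<lambda>e. M - l e) (\<lambda>p. M *\<^sub>R p - f p)"
  unfolding edge_map_def
proof (intro allI impI)
  fix x y assume e: "closed_segment x y edge_of P"
  have "f x - f y = l (closed_segment x y) *\<^sub>R (x - y)"
    using assms(1) e by (simp add: edge_map_def)
  moreover have "(M *\<^sub>R x - f x) - (M *\<^sub>R y - f y) = M *\<^sub>R (x - y) - (f x - f y)"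
    by (simp add: scaleR_diff_right)
  ultimately have "(M *\<^sub>R x - f x) - (M *\<^sub>R y - f y) = M *\<^sub>R (x - y) - l (closed_segment x y) *\<^sub>R (x - y)"
    by simp
  then show "0 \<le> M - l (closed_segment x y) \<and>
    (M *\<^sub>R x - f x) - (M *\<^sub>R y - f y) = (M - l (closed_segment x y)) *\<^sub>R (x - y)"
    using assms(2)[OF e] by (simp add: scaleR_diff_left)
qed

lemma edge_map_hull_bound:
  fixes P :: "'a::euclidean_space set"
  assumes P: "polytope P" and f: "edge_map P l f"
    and p: "p extreme_point_of P" "\<forall>x\<in>P. a \<bullet> x \<le> a \<bullet> p"
    and y: "y \<in> convex hull (f ` {v. v extreme_point_of P})"
  shows "a \<bullet> y \<le> a \<bullet> f p"
proof -
  have "p \<in> maxface P a" using p by (auto simp: maxface_def extreme_point_of_def)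
  then have "f ` {v. v extreme_point_of P} \<subseteq> {y. a \<bullet> y \<le> a \<bullet> f p}"
    using edge_map_mono[OF P f _ p(1)] by auto
  then have "convex hull (f ` {v. v extreme_point_of P}) \<subseteq> {y. a \<bullet> y \<le> a \<bullet> f p}"
    by (rule hull_minimal) (rule convex_halfspace_le)
  with y show ?thesis by auto
qed

text \<open>Shephard's criterion for weak Minkowski summands.\<close>

lemma edge_map_deformation:
  fixes P :: "'a::euclidean_space set"
  assumes P: "polytope P" and f: "edge_map P l f"
  defines "R \<equiv> convex hull (f ` {v. v extreme_point_of P})"
  shows "deformation_of P R" and "p extreme_point_of P \<Longrightarrow> associated_vertex P R p (f p)"
proof -
  let ?V = "{v. v extreme_point_of P}"
  have finE: "finite {e. e edge_of P}"
    by (rule finite_subset[OF _ finite_polytope_faces[OF P]]) (auto simp: edge_of_def)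
  \<comment> \<open>A common bound for all factors; the added 1 makes it positive even when all
    factors vanish.\<close>
  define M where "M = (\<Sum>e | e edge_of P. \<bar>l e\<bar>) + 1"
  have lM: "l e \<le> M" if "e edge_of P" for e
  proof -
    have "\<bar>l e\<bar> \<le> (\<Sum>e | e edge_of P. \<bar>l e\<bar>)"
      by (rule member_le_sum) (use finE that in auto)
    then show ?thesis by (simp add: M_def)
  qed
  have M0: "M > 0" by (simp add: M_def sum_nonneg add_nonneg_pos)
  define f' where "f' = (\<lambda>p. M *\<^sub>R p - f p)"
  have f': "edge_map P (\<lambda>e. M - l e) f'"
    unfolding f'_def using edge_map_complement[OF f lM] .
  define R' where "R' = convex hull (f' ` ?V)"
  have fin: "finite ?V" by (rule finite_vertices[OF P])
  have RR: "R + R' = convex hull (f ` ?V + f' ` ?V)"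
    unfolding R_def R'_def by (rule convex_hull_set_plus[symmetric])
  have MP: "(*\<^sub>R) M ` P = convex hull ((*\<^sub>R) M ` ?V)"
    by (subst polytope_hull_vertices[OF P]) (rule convex_hull_scaling[symmetric])
  have sumf: "f p + f' p = M *\<^sub>R p" for p by (simp add: f'_def)
  have eq: "(*\<^sub>R) M ` P = R + R'"
  proof
    show "(*\<^sub>R) M ` P \<subseteq> R + R'"
      unfolding MP RR
    proof (rule hull_mono, clarify)
      fix p assume "p extreme_point_of P"
      then show "M *\<^sub>R p \<in> f ` ?V + f' ` ?V"
        by (metis (mono_tags) imageI mem_Collect_eq set_plus_intro sumf)
    qed
    have cl: "closed ((*\<^sub>R) M ` P)" "convex ((*\<^sub>R) M ` P)"
      using P by (auto simp: closed_scaling polytope_imp_closed convex_scaling polytope_imp_convex)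
    show "R + R' \<subseteq> (*\<^sub>R) M ` P"
      unfolding RR
    proof (rule hull_minimal[where S = convex, OF subsetI cl(2)], rule ccontr)
      fix z assume z: "z \<in> f ` ?V + f' ` ?V" and nz: "z \<notin> (*\<^sub>R) M ` P"
      obtain p1 p2 where p: "p1 \<in> ?V" "p2 \<in> ?V" "z = f p1 + f' p2"
        using z by (auto simp: set_plus_def)
      obtain a b where ab: "a \<bullet> z < b" "\<forall>x\<in>(*\<^sub>R) M ` P. a \<bullet> x > b"
        using separating_hyperplane_closed_point[OF cl(2,1) nz] by blast
      have "P \<noteq> {}" using p by (auto simp: extreme_point_of_def)
      \<comment> \<open>The images of a vertex minimizing \<open>a\<close> on \<open>P\<close>
        minimize \<open>a\<close> under \<open>f\<close> and \<open>f'\<close> simultaneously, and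
        they add up to \<open>M\<close> times \<open>q\<close>, a point of the dilate.\<close>
      then obtain q where q: "q extreme_point_of P" "q \<in> maxface P (-a)"
        using maxface_has_vertex[OF P] by blast
      have "(-a) \<bullet> f p1 \<le> (-a) \<bullet> f q" "(-a) \<bullet> f' p2 \<le> (-a) \<bullet> f' q"
        using edge_map_mono[OF P f _ q] edge_map_mono[OF P f' _ q] p by auto
      then have "a \<bullet> z \<ge> a \<bullet> (f q + f' q)" by (simp add: p(3) inner_add_right)
      moreover have "a \<bullet> (f q + f' q) > b"
        unfolding sumf using ab(2) q(2) by (auto simp: maxface_def)
      ultimately show False using ab(1) by simp
    qed
  qed
  have pR: "polytope R" "polytope R'"
    using fin by (auto simp: R_def R'_def polytope_convex_hull)
  show "deformation_of P R"
    unfolding deformation_of_def using pR M0 eq by blast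
  assume p: "p extreme_point_of P"
  have bound: "\<forall>y\<in>R. a \<bullet> y \<le> a \<bullet> f p"
    if "\<forall>x\<in>P. a \<bullet> x \<le> a \<bullet> p" for a
    using edge_map_hull_bound[OF P f p that] by (simp add: R_def)
  have bound': "\<forall>y\<in>R'. a \<bullet> y \<le> a \<bullet> f' p"
    if "\<forall>x\<in>P. a \<bullet> x \<le> a \<bullet> p" for a
    using edge_map_hull_bound[OF P f' p that] by (simp add: R'_def)
  obtain k where k: "maxface P k = {p}" by (rule vertex_maxface[OF P p])
  have kp: "\<forall>x\<in>P. k \<bullet> x \<le> k \<bullet> p" "p \<in> P" using k
    by (auto simp: maxface_def)
  have fp: "f p \<in> R" "f' p \<in> R'" unfolding R_def R'_def using p by (auto intro: hull_inc)
  \<comment> \<open>If \<open>r\<close> maximizes \<open>k\<close> on \<open>R\<close>, then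
    \<open>r + f' p\<close> maximizes \<open>k\<close> on the dilate of \<open>P\<close>, where
    \<open>M\<close> times \<open>p\<close> is the only maximizer. Cancelling \<open>f' p\<close>
    gives \<open>r = f p\<close>.\<close>
  have "maxface R k = {f p}"
  proof -
    have "r = f p" if r: "r \<in> maxface R k" for r
    proof -
      have "f' p \<in> maxface R' k" using bound'[OF kp(1)] fp by (auto simp: maxface_def)
      then have "r + f' p \<in> maxface (R + R') k"
        unfolding maxface_plus using r by (rule set_plus_intro[rotated])
      then have rm: "r + f' p \<in> maxface ((*\<^sub>R) M ` P) k" using eq by simp
      then obtain x where x: "x \<in> P" "r + f' p = M *\<^sub>R x" by (auto simp: maxface_def)
      have "k \<bullet> (M *\<^sub>R y) \<le> k \<bullet> (M *\<^sub>R x)" if "y \<in> P" for y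
        using rm x that by (auto simp: maxface_def)
      then have "x \<in> maxface P k" using x M0 by (auto simp: maxface_def)
      then have "x = p" using k by auto
      then show ?thesis using x(2) sumf[of p] by (metis add_right_cancel)
    qed
    moreover have "f p \<in> maxface R k" using bound[OF kp(1)] fp by (auto simp: maxface_def)
    ultimately show ?thesis by blast
  qed
  then have "f p extreme_point_of R"
    using maxface_face_of[OF polytope_imp_convex[OF pR(1)], of k] by (simp add: face_of_singleton)
  then show "associated_vertex P R p (f p)"
    unfolding associated_vertex_def using bound by blast
qed

text \<open>Removes both polytopes from the definition of the cone: conversely to reading off
  \<open>f\<close>, the convex hull of the images of the vertices is a deformation realizing
  \<open>l\<close>.\<close>

lemma deformation_cone_iff:
  fixes P :: "'a::euclidean_space set"
  assumes P: "polytope P"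
  shows "l \<in> deformation_cone P \<longleftrightarrow> (\<forall>e. \<not> e edge_of P \<longrightarrow> l e = 0) \<and> (\<exists>f. edge_map P l f)"
proof
  assume "l \<in> deformation_cone P"
  then show "(\<forall>e. \<not> e edge_of P \<longrightarrow> l e = 0) \<and> (\<exists>f. edge_map P l f)"
    unfolding deformation_cone_def edge_deformation_vector_def edge_map_def by blast
next
  assume r: "(\<forall>e. \<not> e edge_of P \<longrightarrow> l e = 0) \<and> (\<exists>f. edge_map P l f)"
  then obtain f where f: "edge_map P l f" by blast
  have "0 \<le> l e" if "e edge_of P" for e
    using edge_is_segment[OF polytope_imp_compact[OF P] polytope_imp_convex[OF P] that] f that
    unfolding edge_map_def by metis
  moreover have "f x - f y = l (closed_segment x y) *\<^sub>R (x - y)" if "closed_segment x y edge_of P"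
    for x y
    using f that by (auto simp: edge_map_def)
  ultimately show "l \<in> deformation_cone P"
    using edge_map_deformation[OF P f] r
    unfolding deformation_cone_def edge_deformation_vector_def by blast
qed

text \<open>Indecomposability only gives an equality of sets, between the hull of the images and a
  homothetic copy of \<open>A\<close>. A functional exposing \<open>p\<close> turns it into the
  pointwise statement, because \<open>f p\<close> is optimal for it on the hull and the copy has a
  unique optimum when \<open>c\<close> is not 0.\<close>

lemma indecomposable_edge_map:
  fixes A :: "'a::euclidean_space set"
  assumes A: "indecomposable_polytope A" and f: "edge_map A l f"
  obtains c t where "c \<ge> 0" "\<And>p. p extreme_point_of A \<Longrightarrow> f p = c *\<^sub>R p + t"
proof -
  have P: "polytope A" using A by (simp add: indecomposable_polytope_def)
  let ?R = "convex hull (f ` {v. v extreme_point_of A})"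
  have "deformation_of A ?R" by (rule edge_map_deformation[OF P f])
  then obtain c t where c: "c \<ge> 0" and R: "?R = (\<lambda>x. c *\<^sub>R x + t) ` A"
    using A unfolding indecomposable_polytope_def by blast
  have "f p = c *\<^sub>R p + t" if p: "p extreme_point_of A" for p
  proof -
    have "f p \<in> ?R" using p by (auto intro: hull_inc)
    then obtain a where a: "a \<in> A" "f p = c *\<^sub>R a + t" using R by auto
    show ?thesis
    proof (cases "c = 0")
      case False
      obtain k where k: "maxface A k = {p}" by (rule vertex_maxface[OF P p])
      then have kp: "\<forall>x\<in>A. k \<bullet> x \<le> k \<bullet> p" "p \<in> A"
        by (auto simp: maxface_def)
      have "c *\<^sub>R p + t \<in> ?R" unfolding R using kp by blast
      then have "k \<bullet> (c *\<^sub>R p + t) \<le> k \<bullet> f p"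
        by (rule edge_map_hull_bound[OF P f p kp(1)])
      then have "k \<bullet> p \<le> k \<bullet> a" using False c by (simp add: a(2) inner_add_right)
      then have "a \<in> maxface A k" using kp a(1) by (auto simp: maxface_def intro: order_trans)
      then show ?thesis using k a by auto
    qed (use a in auto)
  qed
  with c that show thesis by blast
qed


subsection \<open>Minkowski sums of two polytopes\<close>

lemma polytope_set_plus:
  fixes A B :: "'a::euclidean_space set"
  assumes "polytope A" "polytope B"
  shows "polytope (A + B)"
proof -
  obtain S T where "finite S" "A = convex hull S" "finite T" "B = convex hull T"
    using assms by (auto simp: polytope_def)
  then show ?thesis
    by (metis convex_hull_set_plus finite_set_plus polytope_convex_hull)
qed

text \<open>If every vertex maximized the functional \<open>x - y\<close>, it would be constant on
  \<open>P\<close>, yet it separates \<open>x\<close> from \<open>y\<close>. A vertex that is not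
  optimal has an improving edge.\<close>

lemma exists_edge:
  fixes P :: "'a::euclidean_space set"
  assumes P: "polytope P" and xy: "x \<in> P" "y \<in> P" "x \<noteq> y"
  obtains v w where "closed_segment v w edge_of P"
proof -
  have P0: "P \<noteq> {}" using xy by auto
  have "\<exists>v. v extreme_point_of P \<and> v \<notin> maxface P (x - y)"
  proof (rule ccontr)
    assume a: "\<not> ?thesis"
    obtain m where m: "m \<in> maxface P (x - y)" using maxface_nonempty[of P] P P0 polytope_imp_compact
      by blast
    have f: "maxface P (x - y) face_of P" by (simp add: maxface_face_of P polytope_imp_convex)
    have "convex hull {v. v extreme_point_of P} \<subseteq> maxface P (x - y)"
      by (rule hull_minimal[where S = convex]) (use a f face_of_imp_convex in auto)
    then have "x \<in> maxface P (x - y)" "y \<in> maxface P (x - y)"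
      using xy polytope_hull_vertices[OF P] by auto
    then have "(x - y) \<bullet> x = (x - y) \<bullet> y" using xy
      by (force simp: maxface_def intro: antisym)
    then have "(x - y) \<bullet> (x - y) = 0" by (simp add: inner_diff_right)
    then show False using xy by simp
  qed
  then show thesis using exists_improving_edge[OF P] that by metis
qed

text \<open>Given two decompositions, \<open>a + b\<close> is the midpoint of the mixed sums
  \<open>a + b'\<close> and \<open>a' + b\<close>. These differ unless the decompositions agree,
  which would contradict extremality.\<close>

lemma unique_vertex_decomposition:
  fixes A B :: "'a::euclidean_space set"
  assumes v: "(a + b) extreme_point_of (A + B)" and ab: "a \<in> A" "b \<in> B" "a' \<in> A" "b' \<in> B"
    and eq: "a + b = a' + b'"
  shows "a' = a \<and> b' = b"
proof (rule ccontr)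
  assume n: "\<not> ?thesis"
  have "a + b' \<noteq> a' + b"
  proof
    assume "a + b' = a' + b"
    then have "(a + b') + (a + b) = (a' + b) + (a' + b')" using eq by simp
    then have "2 *\<^sub>R a = 2 *\<^sub>R a'" by (simp add: scaleR_2 algebra_simps)
    then show False using n eq by simp
  qed
  moreover have "a + b = (1 - 1/2) *\<^sub>R (a + b') + (1/2) *\<^sub>R (a' + b)"
  proof -
    have "2 *\<^sub>R (a + b) = (a + b) + (a' + b')" using eq by (simp add: scaleR_2)
    then have "2 *\<^sub>R (a + b) = 2 *\<^sub>R ((1 - 1/2) *\<^sub>R (a + b') + (1/2) *\<^sub>R (a' + b))"
      by (simp add: scaleR_add_right algebra_simps)
    then show ?thesis by simp
  qed
  ultimately have "a + b \<in> open_segment (a + b') (a' + b)"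
    unfolding in_segment by (intro conjI exI[of _ "1/2"]) auto
  moreover have "a + b' \<in> A + B" "a' + b \<in> A + B" using ab by (auto intro: set_plus_intro)
  ultimately show False using v by (auto simp: extreme_point_of_def)
qed

lemma extreme_point_sum_left:
  fixes A B :: "'a::euclidean_space set"
  assumes v: "(a + b) extreme_point_of (A + B)" and ab: "a \<in> A" "b \<in> B"
  shows "a extreme_point_of A"
  unfolding extreme_point_of_def
proof (intro conjI ballI notI)
  fix x y assume xy: "x \<in> A" "y \<in> A" "a \<in> open_segment x y"
  then obtain t where t: "0 < t" "t < 1" "a = (1 - t) *\<^sub>R x + t *\<^sub>R y" "x \<noteq> y"
    by (auto simp: in_segment)
  then have "a + b = (1 - t) *\<^sub>R (x + b) + t *\<^sub>R (y + b)" by (simp add: algebra_simps)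
  then have "a + b \<in> open_segment (x + b) (y + b)" using t unfolding in_segment by auto
  moreover have "x + b \<in> A + B" "y + b \<in> A + B" using xy ab by (auto intro: set_plus_intro)
  ultimately show False using v by (auto simp: extreme_point_of_def)
qed (rule ab)

section \<open>Edges of a sum and their directions\<close>

lemma closed_segment_plus_point:
  fixes a a' b :: "'a::real_vector"
  shows "closed_segment a a' + {b} = closed_segment (a + b) (a' + b)"
proof -
  have "closed_segment a a' + {b} = (+) b ` closed_segment a a'"
    by (auto simp: set_plus_def add.commute)
  also have "\<dots> = closed_segment (b + a) (b + a')" by (rule closed_segment_translation[symmetric])
  finally show ?thesis by (simp only: add.commute)
qed

definition parallel_to_edge :: "'a::euclidean_space set \<Rightarrow> 'a \<Rightarrow> bool"
  where "parallel_to_edge P u \<longleftrightarrow> (\<exists>v. edge_direction P v \<and> parallel_vectors u v)"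

lemma parallel_to_edgeI:
  assumes "closed_segment a a' edge_of P" "u = c *\<^sub>R (a' - a)" "c \<noteq> 0"
  shows "parallel_to_edge P u"
  using assms unfolding parallel_to_edge_def edge_direction_def parallel_vectors_def by blast

lemma parallel_to_edge_minus: "parallel_to_edge P (x - y) \<longleftrightarrow> parallel_to_edge P (y - x)"
proof -
  have "parallel_to_edge P (- u)" if "parallel_to_edge P u" for u
    using that unfolding parallel_to_edge_def parallel_vectors_def
    by (metis neg_equal_0_iff_equal scaleR_minus_left)
  from this[of "x - y"] this[of "y - x"] show ?thesis by auto
qed

text \<open>The last clause of \<open>parallelogramic_position\<close>. It governs the edges of the
  sum, whereas the genericity clauses govern its 2-faces.\<close>

definition no_parallel_edges :: "'a::euclidean_space set \<Rightarrow> 'a set \<Rightarrow> bool"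
  where "no_parallel_edges A B \<longleftrightarrow>
    \<not> (\<exists>v w. edge_direction A v \<and> edge_direction B w \<and> parallel_vectors v w)"

lemma no_parallel_edgesD:
  assumes "no_parallel_edges A B" "closed_segment b b' edge_of B"
  shows "\<not> parallel_to_edge A (b' - b)"
proof
  assume "parallel_to_edge A (b' - b)"
  then obtain v c where v: "edge_direction A v" "c \<noteq> 0" "b' - b = c *\<^sub>R v"
    by (auto simp: parallel_to_edge_def parallel_vectors_def)
  then have "v = (1/c) *\<^sub>R (b' - b)" by simp
  moreover have "1/c \<noteq> 0" using v by simp
  ultimately have "parallel_vectors v (b' - b)" unfolding parallel_vectors_def by blast
  moreover have "edge_direction B (b' - b)" using assms(2) by (auto simp: edge_direction_def)
  ultimately show False using assms(1) v(1) by (auto simp: no_parallel_edges_def)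
qed

lemma no_parallel_edges_sym:
  fixes A B :: "'a::euclidean_space set"
  shows "no_parallel_edges A B \<Longrightarrow> no_parallel_edges B A"
proof -
  have "parallel_vectors v w" if wv: "parallel_vectors w v" for v w :: 'a
  proof -
    obtain c where c: "c \<noteq> 0" "w = c *\<^sub>R v" using wv by (auto simp: parallel_vectors_def)
    then have "v = (1/c) *\<^sub>R w" by simp
    with c show ?thesis unfolding parallel_vectors_def by (metis divide_eq_0_iff zero_neq_one)
  qed
  then show "no_parallel_edges A B \<Longrightarrow> no_parallel_edges B A"
    unfolding no_parallel_edges_def by blast
qed

lemma segment_difference:
  fixes p p' :: "'a::real_vector"
  assumes "x \<in> closed_segment p p'" "y \<in> closed_segment p p'"
  obtains s where "y - x = s *\<^sub>R (p' - p)"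
proof -
  obtain t u where tu: "x = (1 - t) *\<^sub>R p + t *\<^sub>R p'" "y = (1 - u) *\<^sub>R p + u *\<^sub>R p'"
    using assms by (auto simp: in_segment)
  have "y - x = (u - t) *\<^sub>R (p' - p)" unfolding tu by (simp add: algebra_simps)
  then show thesis by (rule that)
qed

text \<open>A translate of \<open>F\<close> lies inside the segment, so \<open>F\<close> has
  dimension at most one; containing two points, it is an edge in the direction of the
  segment.\<close>

lemma summand_of_segment:
  fixes F G :: "'a::euclidean_space set"
  assumes F: "F face_of A" "polytope A" and FG: "F + G = closed_segment p p'"
    and b: "b \<in> G" and xy: "x \<in> F" "y \<in> F" "x \<noteq> y"
  obtains a a' where "F = closed_segment a a'" "F edge_of A" "parallel_to_edge A (p' - p)"
proof -
  have sub: "z + b \<in> closed_segment p p'" if "z \<in> F" for z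
    using that b FG by (metis set_plus_intro)
  have pF: "polytope F" using F face_of_polytope_polytope by blast
  have "(+) b ` F \<subseteq> closed_segment p p'" using sub by (auto simp: add.commute)
  then have "aff_dim ((+) b ` F) \<le> aff_dim (closed_segment p p')" by (rule aff_dim_subset)
  then have "aff_dim F \<le> 1" by (auto simp: aff_dim_translation_eq aff_dim_segment split: if_splits)
  then have "collinear F" by (simp add: collinear_aff_dim)
  then obtain a a' where aa: "F = closed_segment a a'"
    using compact_convex_collinear_segment[of F] xy pF polytope_imp_compact polytope_imp_convex by blast
  then have ne: "a \<noteq> a'" using xy by auto
  have e: "F edge_of A" using F(1) by (simp add: edge_of_def aa aff_dim_segment ne)
  obtain s where s: "(a' + b) - (a + b) = s *\<^sub>R (p' - p)"
    using segment_difference[OF sub[of a] sub[of a']] aa by auto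
  then have s': "a' - a = s *\<^sub>R (p' - p)" by simp
  then have "s \<noteq> 0" using ne by auto
  then have "p' - p = (1/s) *\<^sub>R (a' - a)" "1/s \<noteq> 0" using s' by simp_all
  then have "parallel_to_edge A (p' - p)" using parallel_to_edgeI e aa by blast
  with aa e that show thesis by blast
qed

text \<open>A functional exposing an edge of the sum exposes faces of \<open>A\<close> and
  \<open>B\<close> that add up to it. If neither were a point, both would be edges in its direction,
  so exactly one of the summands moves along the edge.\<close>

lemma edge_of_sum_cases:
  fixes A B :: "'a::euclidean_space set"
  assumes A: "polytope A" and B: "polytope B" and np: "no_parallel_edges A B"
    and e: "closed_segment p p' edge_of (A + B)"
  obtains
    (left) a a' b where "closed_segment a a' edge_of A" "b \<in> B" "p = a + b" "p' = a' + b"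
      "parallel_to_edge A (p' - p)"
  | (right) a b b' where "closed_segment b b' edge_of B" "a \<in> A" "p = a + b" "p' = a + b'"
      "\<not> parallel_to_edge A (p' - p)"
proof -
  have P: "polytope (A + B)" by (rule polytope_set_plus[OF A B])
  have "closed_segment p p' face_of (A + B)" using e by (simp add: edge_of_def)
  then obtain c where c: "closed_segment p p' = maxface (A + B) c"
    using face_of_polytope_maxface[OF P] by (metis ends_in_segment(1) empty_iff)
  let ?F = "maxface A c" and ?G = "maxface B c"
  have FG: "?F + ?G = closed_segment p p'" using c by (simp add: maxface_plus)
  have fF: "?F face_of A" and fG: "?G face_of B"
    using A B by (simp_all add: maxface_face_of polytope_imp_convex)
  have "p \<in> ?F + ?G" using FG by auto
  then obtain a0 b0 where ab: "a0 \<in> ?F" "b0 \<in> ?G" by (auto simp: set_plus_def)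
  have ne: "p \<noteq> p'" using edge_vertices[OF e] by simp
  show thesis
  proof (cases "?F = {a0}")
    case False
    then obtain x where x: "x \<in> ?F" "x \<noteq> a0" using ab by blast
    obtain a a' where a: "?F = closed_segment a a'" "?F edge_of A" "parallel_to_edge A (p' - p)"
      using summand_of_segment[OF fF A FG ab(2) x(1) ab(1) x(2)] by blast
    have "?G = {b0}"
    proof (rule ccontr)
      assume "?G \<noteq> {b0}"
      then obtain y where y: "y \<in> ?G" "y \<noteq> b0" using ab by blast
      have GF: "?G + ?F = closed_segment p p'" using FG by (simp add: add.commute)
      obtain b b' where b: "?G = closed_segment b b'" "?G edge_of B" "parallel_to_edge B (p' - p)"
        using summand_of_segment[OF fG B GF ab(1) y(1) ab(2) y(2)] by blast
      have "a \<in> ?F" "a' \<in> ?F" using a by auto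
      then have "a + b0 \<in> closed_segment p p'" "a' + b0 \<in> closed_segment p p'"
        using ab FG by (metis set_plus_intro)+
      then obtain s where "(a' + b0) - (a + b0) = s *\<^sub>R (p' - p)" by (rule segment_difference)
      then have s: "a' - a = s *\<^sub>R (p' - p)" by simp
      moreover have "a \<noteq> a'" using edge_vertices(3) a by metis
      ultimately have "s \<noteq> 0" by auto
      obtain v d where v: "edge_direction B v" "d \<noteq> 0" "p' - p = d *\<^sub>R v"
        using b(3) by (auto simp: parallel_to_edge_def parallel_vectors_def)
      then have "a' - a = (s * d) *\<^sub>R v" "s * d \<noteq> 0" using s \<open>s \<noteq> 0\<close>
        by simp_all
      then have "parallel_vectors (a' - a) v" unfolding parallel_vectors_def by blast
      moreover have "edge_direction A (a' - a)" using a by (auto simp: edge_direction_def)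
      ultimately show False using np v by (auto simp: no_parallel_edges_def)
    qed
    then have "closed_segment (a + b0) (a' + b0) = closed_segment p p'"
      using FG a(1) by (simp add: closed_segment_plus_point)
    then have "{a + b0, a' + b0} = {p, p'}" by (simp add: closed_segment_eq)
    then consider "p = a + b0" "p' = a' + b0" | "p = a' + b0" "p' = a + b0"
      by (auto simp: doubleton_eq_iff)
    moreover have "b0 \<in> B" using ab by (auto simp: maxface_def)
    moreover have "closed_segment a a' edge_of A" "closed_segment a' a edge_of A"
      using a closed_segment_commute by metis+
    ultimately show thesis using left a(3) by metis
  next
    case True
    have "?G \<noteq> {b0}"
    proof
      assume "?G = {b0}"
      then have "closed_segment p p' = {a0 + b0}" using True FG by (simp add: set_plus_def)
      then show False using ne by (metis ends_in_segment singletonD)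
    qed
    then obtain y where y: "y \<in> ?G" "y \<noteq> b0" using ab by blast
    have GF: "?G + ?F = closed_segment p p'" using FG by (simp add: add.commute)
    obtain b b' where b: "?G = closed_segment b b'" "?G edge_of B" "parallel_to_edge B (p' - p)"
      using summand_of_segment[OF fG B GF ab(1) y(1) ab(2) y(2)] by blast
    have "closed_segment (b + a0) (b' + a0) = closed_segment p p'"
      using GF b(1) True by (simp add: closed_segment_plus_point)
    then have "{b + a0, b' + a0} = {p, p'}" by (simp add: closed_segment_eq)
    then have cs: "p = a0 + b \<and> p' = a0 + b' \<or> p = a0 + b' \<and> p' = a0 + b"
      by (auto simp: doubleton_eq_iff add.commute)
    have eb: "closed_segment b b' edge_of B" "closed_segment b' b edge_of B"
      using b closed_segment_commute by metis+
    have "\<not> parallel_to_edge A (p' - p)"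
      using cs no_parallel_edgesD[OF np eb(1)] no_parallel_edgesD[OF np eb(2)] by auto
    moreover have "a0 \<in> A" using ab by (auto simp: maxface_def)
    ultimately show thesis using right[OF eb(1)] right[OF eb(2)] cs by blast
  qed
qed

lemma orthogonal_functional:
  fixes u v :: "'a::euclidean_space"
  assumes "\<And>s. v \<noteq> s *\<^sub>R u"
  obtains k where "k \<bullet> u = 0" "k \<bullet> v > 0"
proof -
  \<comment> \<open>Coefficient of the orthogonal projection of \<open>v\<close> to the line of
    \<open>u\<close>. For \<open>u = 0\<close> division yields 0 and \<open>k\<close> is
    \<open>v\<close> itself.\<close>
  define s where "s = (v \<bullet> u) / (u \<bullet> u)"
  define k where "k = v - s *\<^sub>R u"
  have ku: "k \<bullet> u = 0"
    by (cases "u = 0") (auto simp: k_def s_def inner_diff_left)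
  have "k \<noteq> 0" using assms[of s] by (auto simp: k_def)
  then have "0 < k \<bullet> k" by simp
  also have "\<dots> = k \<bullet> v" using ku by (simp add: k_def inner_diff_right)
  finally show thesis using that ku by blast
qed

text \<open>The second edge at \<open>x\<close> improves a functional that vanishes on the first, so
  the two edges span the plane of \<open>F\<close>. This provides the two edges that the definition
  of \<open>two_generic\<close> speaks of.\<close>

lemma two_dim_two_edges:
  fixes F :: "'a::euclidean_space set"
  assumes F: "polytope F" and d: "aff_dim F = 2"
  obtains x y z where "closed_segment x y edge_of F" "closed_segment x z edge_of F"
    "closed_segment x y \<noteq> closed_segment x z"
    "\<And>u. u \<in> affine hull F \<Longrightarrow> \<exists>\<alpha> \<beta>. u - x = \<alpha> *\<^sub>R (y - x) + \<beta> *\<^sub>R (z - x)"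
proof -
  have "\<not> collinear F" using d by (simp add: collinear_aff_dim)
  then have "\<exists>x\<in>F. \<exists>y\<in>F. x \<noteq> y"
    by (metis collinear_sing collinear_empty insertI1 is_singletonI' is_singleton_the_elem)
  then obtain x y where e: "closed_segment x y edge_of F" using exists_edge[OF F] by metis
  have xy: "x \<in> F" "y \<in> F" "x \<noteq> y" using edge_vertices[OF e] by auto
  have "\<exists>z\<in>F. \<forall>s. z - x \<noteq> s *\<^sub>R (y - x)"
  proof (rule ccontr)
    assume "\<not> ?thesis"
    then have "\<exists>s. z = x + s *\<^sub>R (y - x)" if "z \<in> F" for z
      using that by (metis add_diff_cancel_left' diff_add_cancel add.commute)
    then have "F \<subseteq> affine hull {x, y}"
      unfolding affine_hull_2_alt by blast
    then have "aff_dim F \<le> aff_dim {x, y}" by (metis aff_dim_affine_hull aff_dim_subset)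
    then show False using d by (simp add: aff_dim_2 split: if_splits)
  qed
  then obtain z0 where z0: "z0 \<in> F" "\<And>s. z0 - x \<noteq> s *\<^sub>R (y - x)" by blast
  obtain k where k: "k \<bullet> (y - x) = 0" "k \<bullet> (z0 - x) > 0"
    using orthogonal_functional[OF z0(2)] by blast
  have "x \<notin> maxface F k" using k z0(1) by (force simp: maxface_def inner_diff_right)
  then obtain z where z: "closed_segment x z edge_of F" "k \<bullet> z > k \<bullet> x"
    using exists_improving_edge[OF F] edge_vertices[OF e] by metis
  have kz: "k \<bullet> (z - x) > 0" using z by (simp add: inner_diff_right)
  have ne: "z - x \<noteq> s *\<^sub>R (y - x)" for s
    using kz k by (metis inner_scaleR_right less_irrefl mult_zero_right)
  have "closed_segment x y \<noteq> closed_segment x z"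
  proof
    assume "closed_segment x y = closed_segment x z"
    then have "y = z" using xy by (auto simp: closed_segment_eq doubleton_eq_iff)
    then show False using ne[of 1] by simp
  qed
  moreover have "\<exists>\<alpha> \<beta>. u - x = \<alpha> *\<^sub>R (y - x) + \<beta> *\<^sub>R (z - x)" if "u \<in> affine hull F" for u
  proof -
    have "z \<notin> affine hull {x, y}" unfolding affine_hull_2_alt using ne
      by (smt (verit, best) add_diff_cancel_left' image_iff)
    then have "aff_dim {z, x, y} = 2" using xy by (simp add: aff_dim_insert[of z "{x, y}"] aff_dim_2)
    moreover have "{z, x, y} \<subseteq> F" using xy edge_vertices[OF z(1)] by auto
    ultimately have "affine hull {z, x, y} = affine hull F"
      using affine_dim_equal[of "affine hull {z,x,y}" "affine hull F"] d by (simp add: hull_mono)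
    then have "u \<in> affine hull {x, y, z}" using that by (simp add: insert_commute)
    then obtain a b c where "u = a *\<^sub>R x + b *\<^sub>R y + c *\<^sub>R z" "a + b + c = 1"
      by (auto simp: affine_hull_3)
    then have "u - x = b *\<^sub>R (y - x) + c *\<^sub>R (z - x)"
      by (simp add: algebra_simps) (metis add.commute add.left_commute scaleR_left_distrib scaleR_one)
    then show ?thesis by blast
  qed
  ultimately show thesis using that[OF e z(1)] by blast
qed

text \<open>Parametric simplex method: moving the objective from \<open>c\<close> to \<open>c'\<close> yields an edge path whose
  edges are optimal for some intermediate objective.\<close>

lemma parametric_path:
  fixes P :: "'a::euclidean_space set"
  assumes P: "polytope P" and p: "maxface P c = {p}" and p': "maxface P c' = {p'}"
  shows "(p, p') \<in> {(x, y). closed_segment x y edge_of P \<and>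
           (\<exists>s\<ge>0. closed_segment x y \<subseteq> maxface P (c + s *\<^sub>R c'))}\<^sup>*" (is "_ \<in> ?R\<^sup>*")
proof -
  let ?V = "{v. v extreme_point_of P}"
  have fin: "finite ?V" by (rule finite_vertices[OF P])
  have ext: "q extreme_point_of P" if "maxface P k = {q}" for q k
    using maxface_face_of[OF polytope_imp_convex[OF P], of k] that by (simp add: face_of_singleton)
  have "(q, p') \<in> ?R\<^sup>*" if "q extreme_point_of P" "s \<ge> 0" "q \<in> maxface P (c + s *\<^sub>R c')" for q s
    using that
  proof (induction "card {x \<in> ?V. c' \<bullet> x > c' \<bullet> q}" arbitrary: q s rule: less_induct)
    case less
    show ?case
    proof (cases "q = p'")
      case False
      have qP: "q \<in> P" using less.prems by (auto simp: extreme_point_of_def)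
      have p'P: "p' \<in> P" "\<forall>x\<in>P. c' \<bullet> x \<le> c' \<bullet> p'" using p'
        by (auto simp: maxface_def)
      let ?Z = "{x \<in> ?V. c' \<bullet> x > c' \<bullet> q}"
      have "q \<notin> maxface P c'" using False p' by auto
      then have "p' \<in> ?Z" using ext[OF p'] p'P qP by (force simp: maxface_def)
      then have Z0: "?Z \<noteq> {}" by blast
      have fZ: "finite ?Z" using fin by auto
      \<comment> \<open>Ratio test: \<open>r z\<close> is the parameter at which \<open>z\<close>
        ties with \<open>q\<close> under the objective \<open>c + s *\<^sub>R c'\<close>. From the
        given \<open>s\<close> up to the smallest such value \<open>S\<close> the vertex
        \<open>q\<close> stays optimal.\<close>
      define r where "r z = (c \<bullet> q - c \<bullet> z) / (c' \<bullet> z - c' \<bullet> q)" for z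
      define S where "S = Min (r ` ?Z)"
      have "S \<in> r ` ?Z" unfolding S_def by (rule Min_in) (use fZ Z0 in auto)
      then obtain z where z: "z \<in> ?Z" "S = r z" by blast
      have Sle: "S \<le> r x" if "x \<in> ?Z" for x unfolding S_def
        by (rule Min_le) (use fZ that in auto)
      have opt: "c \<bullet> x + s * (c' \<bullet> x) \<le> c \<bullet> q + s * (c' \<bullet> q)"
        if "x \<in> P" for x
        using less.prems(3) that by (auto simp: maxface_def inner_add_left)
      have sS: "s \<le> S"
      proof -
        have "s * (c' \<bullet> z - c' \<bullet> q) \<le> c \<bullet> q - c \<bullet> z"
          using opt[of z] z(1) by (auto simp: extreme_point_of_def algebra_simps)
        then show ?thesis using z by (auto simp: r_def pos_le_divide_eq)
      qed
      let ?k = "c + S *\<^sub>R c'"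
      have vopt: "?k \<bullet> x \<le> ?k \<bullet> q" if x: "x \<in> ?V" for x
      proof (cases "x \<in> ?Z")
        case True
        then have "S * (c' \<bullet> x - c' \<bullet> q) \<le> c \<bullet> q - c \<bullet> x"
          using Sle[OF True] by (auto simp: r_def pos_le_divide_eq)
        then show ?thesis by (simp add: inner_add_left algebra_simps)
      next
        case False
        then have "c' \<bullet> x - c' \<bullet> q \<le> 0" using x by auto
        then have "(S - s) * (c' \<bullet> x - c' \<bullet> q) \<le> 0" using sS
          by (simp add: mult_nonneg_nonpos)
        moreover have "x \<in> P" using x by (auto simp: extreme_point_of_def)
        ultimately show ?thesis using opt[of x] by (simp add: inner_add_left algebra_simps)
      qed
      let ?F = "maxface P ?k"
      have "convex hull ?V \<subseteq> {x. ?k \<bullet> x \<le> ?k \<bullet> q}"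
        by (rule hull_minimal) (use vopt convex_halfspace_le in auto)
      then have qF: "q \<in> ?F" using qP polytope_hull_vertices[OF P] by (auto simp: maxface_def)
      have fF: "?F face_of P" by (simp add: maxface_face_of P polytope_imp_convex)
      have pF: "polytope ?F" using face_of_polytope_polytope[OF P fF] .
      have zF: "z \<in> ?F"
      proof -
        have "S * (c' \<bullet> z - c' \<bullet> q) = c \<bullet> q - c \<bullet> z" using z
          by (auto simp: r_def)
        then have "?k \<bullet> z = ?k \<bullet> q" by (simp add: inner_add_left algebra_simps)
        then show ?thesis using qF z(1) by (auto simp: maxface_def extreme_point_of_def)
      qed
      \<comment> \<open>At parameter \<open>S\<close> both \<open>q\<close> and \<open>z\<close> are
        optimal, and \<open>z\<close> is better for \<open>c'\<close>. So some edge at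
        \<open>q\<close> inside the optimal face improves \<open>c'\<close>.\<close>
      have "q \<notin> maxface ?F c'" using zF z(1) by (auto simp: maxface_def)
      moreover have "q extreme_point_of ?F" using extreme_point_of_face[OF fF] qF less.prems by blast
      ultimately obtain w where w: "closed_segment q w edge_of ?F" "c' \<bullet> w > c' \<bullet> q"
        using exists_improving_edge[OF pF] by blast
      have eP: "closed_segment q w edge_of P" "closed_segment q w \<subseteq> ?F"
        using w edge_of_face_eq[OF fF] by auto
      have S0: "S \<ge> 0" using sS less.prems by simp
      have wV: "w extreme_point_of P" using edge_vertices[OF eP(1)] by simp
      have "card {x \<in> ?V. c' \<bullet> x > c' \<bullet> w} < card ?Z"
        by (rule psubset_card_mono) (use fZ w wV in auto)
      moreover have "w \<in> ?F" using eP by auto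
      ultimately have "(w, p') \<in> ?R\<^sup>*" using less.hyps wV S0 by blast
      moreover have "(q, w) \<in> ?R" using eP S0 by blast
      ultimately show ?thesis by (rule converse_rtrancl_into_rtrancl[rotated])
    qed simp
  qed
  from this[of p 0] show ?thesis using p ext[OF p] by simp
qed

section \<open>Fibres over the vertices and edges of a summand\<close>

lemma maxface_sum_vertex:
  fixes A B :: "'a::euclidean_space set"
  assumes v: "maxface (A + B) c = {a + b}" and ab: "a \<in> A" "b \<in> B"
  shows "maxface A c = {a}"
proof -
  have "a + b \<in> maxface A c + maxface B c" using v maxface_plus by (metis singletonI)
  then obtain a1 b1 where 1: "a1 \<in> maxface A c" "b1 \<in> maxface B c" "a + b = a1 + b1"
    by (auto simp: set_plus_def)
  have cab: "c \<bullet> a \<le> c \<bullet> a1" "c \<bullet> b \<le> c \<bullet> b1" using 1 ab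
    by (auto simp: maxface_def)
  have "c \<bullet> a + c \<bullet> b = c \<bullet> a1 + c \<bullet> b1" using 1(3)
    by (metis inner_add_right)
  then have "c \<bullet> a = c \<bullet> a1" "c \<bullet> b = c \<bullet> b1" using cab by linarith+
  then have m: "a \<in> maxface A c" "b \<in> maxface B c" using 1 ab by (auto simp: maxface_def)
  have "x = a" if "x \<in> maxface A c" for x
  proof -
    have "x + b \<in> maxface (A + B) c" unfolding maxface_plus using that m
      by (auto intro: set_plus_intro)
    then show ?thesis using v by simp
  qed
  with m show ?thesis by blast
qed

text \<open>Both vertices are exposed by functionals \<open>c\<close> and \<open>c'\<close> whose
  only maximizer on \<open>A\<close> is \<open>a\<close>, and then the same holds for every
  \<open>c + s *\<^sub>R c'\<close> with nonnegative \<open>s\<close>. A parametric path between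
  them therefore stays in the fibre over \<open>a\<close>, where each edge moves in \<open>B\<close>
  only and leaves \<open>g\<close> unchanged.\<close>

lemma fiber_constant:
  fixes A B :: "'a::euclidean_space set"
  assumes A: "polytope A" and B: "polytope B" and np: "no_parallel_edges A B"
    and g: "\<And>x y. closed_segment x y edge_of (A + B) \<Longrightarrow> \<not> parallel_to_edge A (y - x) \<Longrightarrow> g x = g y"
    and v: "(a + b) extreme_point_of (A + B)" "(a + b') extreme_point_of (A + B)"
    and ab: "a \<in> A" "b \<in> B" "b' \<in> B"
  shows "g (a + b) = g (a + b')"
proof -
  have P: "polytope (A + B)" by (rule polytope_set_plus[OF A B])
  obtain c where c: "maxface (A + B) c = {a + b}" by (rule vertex_maxface[OF P v(1)])
  obtain c' where c': "maxface (A + B) c' = {a + b'}" by (rule vertex_maxface[OF P v(2)])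
  have mA: "maxface A c = {a}" "maxface A c' = {a}"
    using maxface_sum_vertex[OF c ab(1,2)] maxface_sum_vertex[OF c' ab(1,3)] by auto
  have ms: "maxface A (c + s *\<^sub>R c') \<subseteq> {a}" if "s \<ge> 0" for s
  proof
    fix x assume x: "x \<in> maxface A (c + s *\<^sub>R c')"
    then have xA: "x \<in> A" by (auto simp: maxface_def)
    have 1: "c \<bullet> a + s * (c' \<bullet> a) \<le> c \<bullet> x + s * (c' \<bullet> x)"
      using x ab by (auto simp: maxface_def inner_add_left)
    have "c' \<bullet> x \<le> c' \<bullet> a" using mA(2) xA by (auto simp: maxface_def)
    then have "s * (c' \<bullet> x) \<le> s * (c' \<bullet> a)" using that by (rule mult_left_mono)
    then have ca: "c \<bullet> a \<le> c \<bullet> x" using 1 by simp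
    have "c \<bullet> y \<le> c \<bullet> a" if "y \<in> A" for y using mA(1) that
      by (auto simp: maxface_def)
    then have "x \<in> maxface A c" using ca xA by (force simp: maxface_def)
    then show "x \<in> {a}" using mA(1) by simp
  qed
  show ?thesis
    using parametric_path[OF P c c']
  proof (induction rule: rtrancl_induct)
    case (step x y)
    then obtain s where e: "closed_segment x y edge_of (A + B)" and s: "s \<ge> 0"
      and sub: "closed_segment x y \<subseteq> maxface (A + B) (c + s *\<^sub>R c')" by auto
    have *: "\<exists>\<beta>\<in>B. z = a + \<beta>" if "z \<in> closed_segment x y" for z
    proof -
      have "z \<in> maxface A (c + s *\<^sub>R c') + maxface B (c + s *\<^sub>R c')"
        using sub that maxface_plus by blast
      then show ?thesis using ms[OF s] by (auto simp: set_plus_def maxface_def)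
    qed
    obtain \<beta> \<beta>' where \<beta>: "\<beta> \<in> B" "x = a + \<beta>" "\<beta>' \<in> B" "y = a + \<beta>'" using *[of x] *[of y] by auto
    have ex: "x extreme_point_of (A + B)" "y extreme_point_of (A + B)" using edge_vertices[OF e] by auto
    have "\<not> parallel_to_edge A (y - x)"
      using A B np e
    proof (cases rule: edge_of_sum_cases)
      case (left a1 a2 b1)
      have "a1 \<in> A" "a2 \<in> A" "a1 \<noteq> a2" using edge_vertices[OF left(1)] by auto
      moreover have "a1 = a"
        using unique_vertex_decomposition[OF ex(1)[unfolded \<beta>(2)] ab(1) \<beta>(1) \<open>a1 \<in> A\<close> left(2)] \<beta>(2) left(3) by simp
      moreover have "a2 = a"
        using unique_vertex_decomposition[OF ex(2)[unfolded \<beta>(4)] ab(1) \<beta>(3) \<open>a2 \<in> A\<close> left(2)] \<beta>(4) left(4) by simp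
      ultimately show ?thesis by simp
    qed
    then show ?case using g[OF e] step.IH by simp
  qed simp
qed

text \<open>The face is the fibre of a vertex of the image of \<open>maxface B c\<close> under projection along \<open>a' - a\<close>.\<close>

lemma lift_parallel_face:
  fixes A B :: "'a::euclidean_space set"
  assumes A: "polytope A" and B: "polytope B" "B \<noteq> {}" and e: "closed_segment a a' edge_of A"
  obtains S where "S face_of B" "S \<noteq> {}" "(closed_segment a a' + S) face_of (A + B)"
    "\<forall>x\<in>S. \<forall>y\<in>S. \<exists>s. y - x = s *\<^sub>R (a' - a)"
proof -
  have ne: "a \<noteq> a'" using edge_vertices[OF e] by simp
  have P: "polytope (A + B)" by (rule polytope_set_plus[OF A B(1)])
  have "closed_segment a a' face_of A" using e by (simp add: edge_of_def)
  then obtain c where c: "closed_segment a a' = maxface A c"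
    using face_of_polytope_maxface[OF A] by (metis ends_in_segment(1) empty_iff)
  define C where "C = maxface B c"
  have fC: "C face_of B" unfolding C_def by (simp add: maxface_face_of B polytope_imp_convex)
  have pC: "polytope C" using face_of_polytope_polytope[OF B(1) fC] .
  have C0: "C \<noteq> {}" unfolding C_def using maxface_nonempty[of B] B polytope_imp_compact by blast
  define u where "u = a' - a"
  have u0: "u \<bullet> u \<noteq> 0" using ne by (simp add: u_def)
  \<comment> \<open>Orthogonal projection along the direction \<open>u\<close> of the edge.\<close>
  define \<pi> where "\<pi> x = x - ((x \<bullet> u) / (u \<bullet> u)) *\<^sub>R u" for x
  have lin: "linear \<pi>"
    by (rule linearI) (auto simp: \<pi>_def inner_add_left add_divide_distrib scaleR_add_left scaleR_diff_right)
  have "polytope (\<pi> ` C)" by (rule polytope_linear_image[OF lin pC])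
  then obtain y where y: "y extreme_point_of \<pi> ` C" using polytope_has_vertex C0
    by (metis image_is_empty)
  obtain k0 where k0: "maxface (\<pi> ` C) k0 = {y}"
    by (rule vertex_maxface[OF \<open>polytope (\<pi> ` C)\<close> y])
  \<comment> \<open>Projecting the functional makes it constant along the edge, while on
    \<open>C\<close> it still acts as \<open>k0\<close> composed with the projection. So refining by
    \<open>k\<close> keeps the whole edge and cuts \<open>C\<close> down to one fibre.\<close>
  define k where "k = \<pi> k0"
  have ku: "k \<bullet> u = 0" using u0 by (simp add: k_def \<pi>_def inner_diff_left)
  have kx: "k \<bullet> x = k0 \<bullet> \<pi> x" for x
    by (simp add: k_def \<pi>_def inner_diff_left inner_diff_right inner_commute)
  let ?S = "maxface C k"
  have S: "\<pi> x = y" if "x \<in> ?S" for x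
  proof -
    have "\<pi> x \<in> maxface (\<pi> ` C) k0" using that by (auto simp: maxface_def kx)
    then show ?thesis using k0 by simp
  qed
  have fS: "?S face_of C" by (simp add: maxface_face_of pC polytope_imp_convex)
  have S0: "?S \<noteq> {}" using maxface_nonempty[of C] C0 pC polytope_imp_compact by blast
  have seg: "maxface (closed_segment a a') k = closed_segment a a'"
  proof -
    have ka: "k \<bullet> z = k \<bullet> a" if z: "z \<in> closed_segment a a'" for z
    proof -
      obtain s where "z - a = s *\<^sub>R (a' - a)" using segment_difference[OF ends_in_segment(1) z]
        by blast
      then have "k \<bullet> (z - a) = 0" using ku by (simp add: u_def)
      then show ?thesis by (simp add: inner_diff_right)
    qed
    have "k \<bullet> y \<le> k \<bullet> z" if "y \<in> closed_segment a a'" "z \<in> closed_segment a a'" for y z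
      unfolding ka[OF that(1)] ka[OF that(2)] ..
    then show ?thesis unfolding maxface_def by blast
  qed
  have eq: "maxface (maxface (A + B) c) k = closed_segment a a' + ?S"
    unfolding maxface_plus c[symmetric] seg C_def ..
  have f1: "maxface (A + B) c face_of A + B" by (simp add: maxface_face_of P polytope_imp_convex)
  have "maxface (maxface (A + B) c) k face_of maxface (A + B) c"
    by (rule maxface_face_of[OF face_of_imp_convex[OF f1]])
  then have f2: "(closed_segment a a' + ?S) face_of A + B" using f1 eq face_of_trans by metis
  have par: "\<exists>s. y - x = s *\<^sub>R (a' - a)" if "x \<in> ?S" "y \<in> ?S" for x y
  proof
    have eq': "\<pi> y = \<pi> x" using S that by simp
    show "y - x = ((y \<bullet> u) / (u \<bullet> u) - (x \<bullet> u) / (u \<bullet> u)) *\<^sub>R (a' - a)"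
      using eq' unfolding \<pi>_def u_def[symmetric] scaleR_left_diff_distrib
      by (simp only: diff_eq_eq add_diff_eq diff_diff_eq add.commute diff_add_eq)
  qed
  show thesis by (rule that[OF _ S0 f2]) (use fS fC face_of_trans par in blast)+
qed

text \<open>The fibre \<open>S\<close> is a single point here, since an edge of \<open>S\<close>
  would be an edge of \<open>B\<close> parallel to the given one.\<close>

lemma lift_edge:
  fixes A B :: "'a::euclidean_space set"
  assumes A: "polytope A" and B: "polytope B" "B \<noteq> {}" and np: "no_parallel_edges A B"
    and e: "closed_segment a a' edge_of A"
  obtains b where "b \<in> B" "closed_segment (a + b) (a' + b) edge_of (A + B)"
proof -
  obtain S where S: "S face_of B" "S \<noteq> {}" "(closed_segment a a' + S) face_of (A + B)"
    "\<forall>x\<in>S. \<forall>y\<in>S. \<exists>s. y - x = s *\<^sub>R (a' - a)"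
    using lift_parallel_face[OF A B e] by blast
  have pS: "polytope S" using face_of_polytope_polytope[OF B(1) S(1)] .
  obtain b where b: "b \<in> S" using S by blast
  have "S = {b}"
  proof (rule ccontr)
    assume "S \<noteq> {b}"
    then obtain b1 where "b1 \<in> S" "b1 \<noteq> b" using b by blast
    then obtain x x' where xx: "closed_segment x x' edge_of S" using exists_edge[OF pS] b by metis
    then have eB: "closed_segment x x' edge_of B" using edge_of_face_eq[OF S(1)] by blast
    have xS: "x \<in> S" "x' \<in> S" "x \<noteq> x'" using edge_vertices[OF xx] by auto
    obtain s where s: "x' - x = s *\<^sub>R (a' - a)" using S(4) xS(1,2) by blast
    then have "s \<noteq> 0" using xS by auto
    then have "parallel_to_edge A (x' - x)" using parallel_to_edgeI[OF e s] by simp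
    then show False using no_parallel_edgesD[OF np eB] by simp
  qed
  then have "closed_segment (a + b) (a' + b) face_of A + B" using S(3)
    by (simp add: closed_segment_plus_point)
  moreover have "aff_dim (closed_segment (a + b) (a' + b)) = 1"
    using edge_vertices(3)[OF e] by (simp add: aff_dim_segment)
  moreover have "b \<in> B" using b S(1) face_of_imp_subset by blast
  ultimately show thesis using that[of b] by (simp add: edge_of_def)
qed

text \<open>Here \<open>B\<close> may have edges parallel to \<open>u\<close>, so the edge of
  \<open>A\<close> need not lift to a mere translate of itself. The face over it still extends in
  its direction only, and any edge of that face will do.\<close>

lemma parallel_to_edge_sum:
  fixes A B :: "'a::euclidean_space set"
  assumes A: "polytope A" and B: "polytope B" "B \<noteq> {}" and u: "parallel_to_edge A u"
  shows "parallel_to_edge (A + B) u"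
proof -
  have P: "polytope (A + B)" by (rule polytope_set_plus[OF A B(1)])
  obtain a a' d where e: "closed_segment a a' edge_of A" and d: "d \<noteq> 0" "u = d *\<^sub>R (a' - a)"
    using u unfolding parallel_to_edge_def edge_direction_def parallel_vectors_def by blast
  obtain S where S: "S face_of B" "S \<noteq> {}" "(closed_segment a a' + S) face_of (A + B)"
    "\<forall>x\<in>S. \<forall>y\<in>S. \<exists>s. y - x = s *\<^sub>R (a' - a)"
    using lift_parallel_face[OF A B e] by blast
  obtain b where b: "b \<in> S" using S by blast
  let ?T = "closed_segment a a' + S"
  have pT: "polytope ?T" using face_of_polytope_polytope[OF P S(3)] .
  have "a + b \<in> ?T" "a' + b \<in> ?T" using b by (auto intro: set_plus_intro)
  moreover have "a + b \<noteq> a' + b" using edge_vertices(3)[OF e] by simp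
  ultimately obtain p p' where p: "closed_segment p p' edge_of ?T" using exists_edge[OF pT] by metis
  then have eP: "closed_segment p p' edge_of A + B" using edge_of_face_eq[OF S(3)] by blast
  have "p \<in> ?T" "p' \<in> ?T" using edge_vertices[OF p] by auto
  then obtain x y x' y' where xy: "p = x + y" "p' = x' + y'" "x \<in> closed_segment a a'" "x' \<in> closed_segment a a'"
    "y \<in> S" "y' \<in> S" by (auto simp: set_plus_def)
  obtain s where s: "x' - x = s *\<^sub>R (a' - a)" using segment_difference[OF xy(3,4)] by blast
  obtain t where t: "y' - y = t *\<^sub>R (a' - a)" using S(4) xy(5,6) by blast
  have "p' - p = (x' - x) + (y' - y)" using xy by simp
  then have st: "p' - p = (s + t) *\<^sub>R (a' - a)" using s t by (simp add: scaleR_left_distrib)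
  moreover have "p \<noteq> p'" using edge_vertices[OF p] by simp
  ultimately have "s + t \<noteq> 0" by auto
  then have "u = (d / (s + t)) *\<^sub>R (p' - p)" "d / (s + t) \<noteq> 0" using st d by simp_all
  then show ?thesis using parallel_to_edgeI[OF eP] by blast
qed

lemma lift_vertex:
  fixes A B :: "'a::euclidean_space set"
  assumes A: "polytope A" and B: "polytope B" "B \<noteq> {}" and a: "a extreme_point_of A"
  obtains b where "b \<in> B" "(a + b) extreme_point_of (A + B)"
proof -
  have P: "polytope (A + B)" by (rule polytope_set_plus[OF A B(1)])
  obtain k where k: "maxface A k = {a}" by (rule vertex_maxface[OF A a])
  have "A + B \<noteq> {}" using k B by (force simp: maxface_def set_plus_def)
  then obtain v where v: "v extreme_point_of (A + B)" "v \<in> maxface (A + B) k"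
    using maxface_has_vertex[OF P] by blast
  then obtain b where "b \<in> B" "v = a + b" unfolding maxface_plus k
    by (auto simp: set_plus_def maxface_def)
  with v that show thesis by blast
qed

section \<open>Two-dimensional faces of a sum\<close>

lemma aff_dim_summand_le:
  fixes F G :: "'a::euclidean_space set"
  assumes "b \<in> G"
  shows "aff_dim F \<le> aff_dim (F + G)"
proof -
  have "(+) b ` F \<subseteq> F + G" using assms by (auto simp: set_plus_def add.commute)
  then show ?thesis using aff_dim_subset by (metis aff_dim_translation_eq)
qed

text \<open>An edge of \<open>G\<close> would have its direction in the plane of \<open>F\<close>,
  hence be a combination of two edges of the 2-face \<open>F\<close>, which genericity
  forbids.\<close>

lemma two_dim_summand:
  fixes A B F G :: "'a::euclidean_space set"
  assumes A: "polytope A" and B: "polytope B"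
    and gen: "\<And>w. edge_direction B w \<Longrightarrow> two_generic A w"
    and F: "F face_of A" and G: "G face_of B" and d: "aff_dim (F + G) = 2" "aff_dim F = 2"
    and b: "b1 \<in> G" "b2 \<in> G"
  shows "b1 = b2"
proof (rule ccontr)
  assume ne: "b1 \<noteq> b2"
  have pF: "polytope F" using face_of_polytope_polytope[OF A F] .
  have pG: "polytope G" using face_of_polytope_polytope[OF B G] .
  obtain b b' where e: "closed_segment b b' edge_of G" using exists_edge[OF pG b ne] by blast
  then have "edge_direction B (b' - b)"
    using edge_of_face_eq[OF G] by (auto simp: edge_direction_def)
  then have tg: "two_generic A (b' - b)" by (rule gen)
  have bG: "b \<in> G" "b' \<in> G" using edge_vertices[OF e] by auto
  obtain x y z where xyz: "closed_segment x y edge_of F" "closed_segment x z edge_of F"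
    "closed_segment x y \<noteq> closed_segment x z"
    "\<And>u. u \<in> affine hull F \<Longrightarrow> \<exists>\<alpha> \<beta>. u - x = \<alpha> *\<^sub>R (y - x) + \<beta> *\<^sub>R (z - x)"
    using two_dim_two_edges[OF pF d(2)] by metis
  have xF: "x \<in> F" using edge_vertices[OF xyz(1)] by simp
  have sub: "(+) b ` F \<subseteq> F + G" using bG by (auto simp: set_plus_def add.commute)
  have "affine hull ((+) b ` F) = affine hull (F + G)"
    by (rule affine_dim_equal) (use sub xF d in \<open>auto simp: hull_mono aff_dim_translation_eq\<close>)
  moreover have "x + b' \<in> affine hull (F + G)" using xF bG by (auto intro!: hull_inc set_plus_intro)
  ultimately have "x + b' \<in> (+) b ` (affine hull F)" by (simp add: affine_hull_translation)
  then have "x + b' - b \<in> affine hull F" by auto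
  from xyz(4)[OF this] obtain \<alpha> \<beta> where "b' - b = \<alpha> *\<^sub>R (y - x) + \<beta> *\<^sub>R (z - x)" by (auto simp: algebra_simps)
  moreover have "closed_segment x y edge_of A" "closed_segment x z edge_of A"
    "closed_segment x y \<subseteq> F" "closed_segment x z \<subseteq> F"
    using xyz edge_of_face_eq[OF F] by auto
  ultimately show False
    using tg F d(2) xyz(3) unfolding two_generic_def by metis
qed

lemma not_scaled_edges:
  fixes A B :: "'a::euclidean_space set"
  assumes np: "no_parallel_edges A B" and a: "closed_segment a a' edge_of A"
    and b: "closed_segment b b' edge_of B"
  shows "b' - b \<noteq> s *\<^sub>R (a' - a)"
proof
  assume eq: "b' - b = s *\<^sub>R (a' - a)"
  then have "s \<noteq> 0" using edge_vertices(3)[OF b] by auto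
  from parallel_to_edgeI[OF a eq this] show False using no_parallel_edgesD[OF np b] by simp
qed

text \<open>The side over \<open>b'\<close> is the set of maximizers of a functional that is
  constant along \<open>a' - a\<close> and increases along \<open>b' - b\<close>.\<close>

lemma parallelogram_edge:
  fixes A B :: "'a::euclidean_space set"
  assumes A: "polytope A" and B: "polytope B"
    and np: "no_parallel_edges A B" and a: "closed_segment a a' edge_of A"
    and b: "closed_segment b b' edge_of B"
    and G: "closed_segment a a' + closed_segment b b' face_of A + B"
  shows "closed_segment (a + b') (a' + b') edge_of A + B"
proof -
  obtain k where k: "k \<bullet> (a' - a) = 0" "k \<bullet> (b' - b) > 0"
    using orthogonal_functional[OF not_scaled_edges[OF np a b]] by blast
  have ka: "k \<bullet> z = k \<bullet> a" if z: "z \<in> closed_segment a a'" for z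
  proof -
    obtain s where "z - a = s *\<^sub>R (a' - a)" using segment_difference[OF ends_in_segment(1) z]
      by blast
    then have "k \<bullet> (z - a) = 0" using k(1) by simp
    then show ?thesis by (simp add: inner_diff_right)
  qed
  have "k \<bullet> y \<le> k \<bullet> z" if "y \<in> closed_segment a a'" "z \<in> closed_segment a a'"
    for y z
    unfolding ka[OF that(1)] ka[OF that(2)] ..
  then have 1: "maxface (closed_segment a a') k = closed_segment a a'"
    unfolding maxface_def by blast
  have kb: "k \<bullet> z < k \<bullet> b'" if z: "z \<in> closed_segment b b'" "z \<noteq> b'" for z
  proof -
    obtain t where t: "0 \<le> t" "t \<le> 1" "z = (1 - t) *\<^sub>R b + t *\<^sub>R b'" using z(1)
      by (auto simp: in_segment)
    then have "t \<noteq> 1" using z(2) by auto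
    then have "(1 - t) * (k \<bullet> (b' - b)) > 0" using t k by simp
    moreover have "b' - z = (1 - t) *\<^sub>R (b' - b)" unfolding t(3) by (simp add: algebra_simps)
    then have "k \<bullet> (b' - z) = (1 - t) * (k \<bullet> (b' - b))" by simp
    ultimately show ?thesis by (simp add: inner_diff_right)
  qed
  have 2: "maxface (closed_segment b b') k = {b'}"
  proof (intro equalityI subsetI)
    fix z assume z: "z \<in> maxface (closed_segment b b') k"
    then have "k \<bullet> b' \<le> k \<bullet> z" "z \<in> closed_segment b b'"
      by (auto simp: maxface_def)
    then show "z \<in> {b'}" using kb[of z] by fastforce
  next
    fix z assume "z \<in> {b'}"
    moreover have "k \<bullet> y \<le> k \<bullet> b'" if "y \<in> closed_segment b b'" for y
      using kb[of y] that by (cases "y = b'") auto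
    ultimately show "z \<in> maxface (closed_segment b b') k" by (auto simp: maxface_def)
  qed
  have "maxface (closed_segment a a' + closed_segment b b') k = closed_segment (a + b') (a' + b')"
    unfolding maxface_plus 1 2 by (rule closed_segment_plus_point)
  then have "closed_segment (a + b') (a' + b') face_of A + B"
    using maxface_face_of[OF face_of_imp_convex[OF G]] face_of_trans G by metis
  then show ?thesis using edge_vertices(3)[OF a] by (simp add: edge_of_def aff_dim_segment)
qed

text \<open>The potential depends on the shape of \<open>G\<close>: it is \<open>f\<close> when
  \<open>G\<close> moves in \<open>A\<close> only, 0 when it moves in \<open>B\<close> only, and for
  a parallelogram a function of the end of the edge of \<open>A\<close>, consistent because opposite
  sides are scaled by the same factor.\<close>

lemma sum_two_face_potential:
  fixes A B :: "'a::euclidean_space set"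
  assumes A: "polytope A" and B: "polytope B"
    and pp: "parallelogramic_position A B" and f: "edge_map (A + B) l f"
    and G: "G face_of A + B" "aff_dim G = 2"
  shows "\<exists>\<gamma>. \<forall>x y. closed_segment x y edge_of G \<longrightarrow>
    \<gamma> x - \<gamma> y = (if parallel_to_edge A (y - x) then f x - f y else 0)"
proof -
  have P: "polytope (A + B)" by (rule polytope_set_plus[OF A B])
  have np: "no_parallel_edges A B"
    using pp by (simp add: parallelogramic_position_def no_parallel_edges_def)
  have "G \<noteq> {}" using G(2) by auto
  then obtain c where c: "G = maxface (A + B) c" using face_of_polytope_maxface[OF P G(1)] by blast
  let ?F = "maxface A c" and ?H = "maxface B c"
  have FH: "G = ?F + ?H" using c by (simp add: maxface_plus)
  have fF: "?F face_of A" and fH: "?H face_of B"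
    using A B by (simp_all add: maxface_face_of polytope_imp_convex)
  have pF: "polytope ?F" and pH: "polytope ?H"
    using face_of_polytope_polytope[OF A fF] face_of_polytope_polytope[OF B fH] by auto
  have eP: "closed_segment x y edge_of A + B" "closed_segment x y \<subseteq> G"
    if "closed_segment x y edge_of G" for x y
    using that edge_of_face_eq[OF G(1)] by auto
  \<comment> \<open>By uniqueness of decompositions, the components of a vertex of the sum lying in
    \<open>G\<close> lie in the faces that add up to \<open>G\<close>.\<close>
  have dec: "a \<in> ?F \<and> b \<in> ?H"
    if "(a + b) extreme_point_of (A + B)" "a \<in> A" "b \<in> B" "a + b \<in> G" for a b
  proof -
    obtain a1 b1 where 1: "a1 \<in> ?F" "b1 \<in> ?H" "a + b = a1 + b1"
      using \<open>a + b \<in> G\<close> FH by (auto simp: set_plus_def)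
    then have "a1 \<in> A" "b1 \<in> B" by (auto simp: maxface_def)
    from unique_vertex_decomposition[OF that(1-3) this 1(3)] show ?thesis using 1 by simp
  qed
  obtain a b where a: "a \<in> ?F" and b: "b \<in> ?H" using \<open>G \<noteq> {}\<close> FH
    by (auto simp: set_plus_def)
  consider "?H = {b}" | "?F = {a}" | a1 b1 where "a1 \<in> ?F" "a1 \<noteq> a" "b1 \<in> ?H" "b1 \<noteq> b"
    using a b by blast
  then show ?thesis
  proof cases
    case 1
    have "parallel_to_edge A (y - x)" if e: "closed_segment x y edge_of G" for x y
      using A B np eP(1)[OF e]
    proof (cases rule: edge_of_sum_cases)
      case (right a1 b1 b2)
      have v: "x extreme_point_of (A + B)" "y extreme_point_of (A + B)"
        using edge_vertices[OF eP(1)[OF e]] by auto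
      have xyG: "x \<in> G" "y \<in> G" using eP(2)[OF e] by auto
      have bB: "b1 \<in> B" "b2 \<in> B" "b1 \<noteq> b2" using edge_vertices[OF right(1)] by auto
      have "b1 \<in> ?H" "b2 \<in> ?H"
        using dec[of a1 b1] dec[of a1 b2] v xyG bB right(2-4) by auto
      then show ?thesis using 1 bB by auto
    qed
    then show ?thesis by (intro exI[of _ f]) simp
  next
    case 2
    have "\<not> parallel_to_edge A (y - x)" if e: "closed_segment x y edge_of G" for x y
      using A B np eP(1)[OF e]
    proof (cases rule: edge_of_sum_cases)
      case (left a1 a2 b1)
      have v: "x extreme_point_of (A + B)" "y extreme_point_of (A + B)"
        using edge_vertices[OF eP(1)[OF e]] by auto
      have xyG: "x \<in> G" "y \<in> G" using eP(2)[OF e] by auto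
      have aA: "a1 \<in> A" "a2 \<in> A" "a1 \<noteq> a2" using edge_vertices[OF left(1)] by auto
      have "a1 \<in> ?F" "a2 \<in> ?F"
        using dec[of a1 b1] dec[of a2 b1] v xyG aA left(2-4) by auto
      then show ?thesis using 2 aA by auto
    qed
    then show ?thesis by (intro exI[of _ "\<lambda>_. 0"]) simp
  next
    case 3
    have d: "aff_dim (?F + ?H) = 2" "aff_dim (?H + ?F) = 2" using G(2) FH by (simp_all add: add.commute)
    have gen: "\<And>w. edge_direction B w \<Longrightarrow> two_generic A w" "\<And>w. edge_direction A w \<Longrightarrow> two_generic B w"
      using pp by (auto simp: parallelogramic_position_def)
    \<comment> \<open>Neither summand is a point, so genericity rules out dimension 2 for both, and
      both are edges.\<close>
    have "aff_dim ?F \<noteq> 2" using two_dim_summand[OF A B gen(1) fF fH d(1) _ 3(3) b] 3 by blast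
    moreover have "aff_dim ?F \<le> 2" using aff_dim_summand_le[OF b, of ?F] d by simp
    moreover have "aff_dim {a, a1} \<le> aff_dim ?F" by (rule aff_dim_subset) (use a 3 in auto)
    ultimately have "aff_dim ?F = 1" using 3 by (simp add: aff_dim_2)
    then have eF: "?F edge_of A" using fF by (simp add: edge_of_def)
    have "aff_dim ?H \<noteq> 2" using two_dim_summand[OF B A gen(2) fH fF d(2) _ 3(1) a] 3 by blast
    moreover have "aff_dim ?H \<le> 2" using aff_dim_summand_le[OF a, of ?H] d by simp
    moreover have "aff_dim {b, b1} \<le> aff_dim ?H" by (rule aff_dim_subset) (use b 3 in auto)
    ultimately have "aff_dim ?H = 1" using 3 by (simp add: aff_dim_2)
    then have eH: "?H edge_of B" using fH by (simp add: edge_of_def)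
    obtain p p' where p: "?F = closed_segment p p'"
      using edge_is_segment[OF polytope_imp_compact[OF A] polytope_imp_convex[OF A] eF] by metis
    obtain q q' where q: "?H = closed_segment q q'"
      using edge_is_segment[OF polytope_imp_compact[OF B] polytope_imp_convex[OF B] eH] by metis
    have ep: "closed_segment p p' edge_of A" "closed_segment p' p edge_of A"
      using eF p by (auto simp: closed_segment_commute)
    have eq: "closed_segment q q' edge_of B" "closed_segment q' q edge_of B"
      using eH q by (auto simp: closed_segment_commute)
    have GA: "closed_segment p p' + closed_segment q q' face_of A + B" using G(1) FH p q by simp
    have GB: "closed_segment q q' + closed_segment p p' face_of B + A" using GA
      by (simp add: add.commute)
    have np': "no_parallel_edges B A" by (rule no_parallel_edges_sym[OF np])
    have e1: "closed_segment (p + q') (p' + q') edge_of A + B"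
      by (rule parallelogram_edge[OF A B np ep(1) eq(1) GA])
    have e2: "closed_segment (p + q) (p' + q) edge_of A + B"
      using parallelogram_edge[OF A B np ep(1) eq(2)] GA by (simp add: closed_segment_commute)
    have e3: "closed_segment (p' + q) (p' + q') edge_of A + B"
      using parallelogram_edge[OF B A np' eq(1) ep(1) GB] by (simp add: add.commute)
    have e4: "closed_segment (p + q) (p + q') edge_of A + B"
      using parallelogram_edge[OF B A np' eq(1) ep(2)] GB
        by (simp add: add.commute closed_segment_commute)
    have fe: "\<exists>m. f u - f v = m *\<^sub>R (u - v)" if "closed_segment u v edge_of A + B" for u v
      using f that unfolding edge_map_def by blast
    obtain x1 where x1: "f (p + q') - f (p' + q') = x1 *\<^sub>R (p - p')" using fe[OF e1] by auto
    obtain x2 where x2: "f (p + q) - f (p' + q) = x2 *\<^sub>R (p - p')" using fe[OF e2] by auto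
    obtain x3 where x3: "f (p' + q) - f (p' + q') = x3 *\<^sub>R (q - q')" using fe[OF e3] by auto
    obtain x4 where x4: "f (p + q) - f (p + q') = x4 *\<^sub>R (q - q')" using fe[OF e4] by auto
    note x = x1 x2 x3 x4
    \<comment> \<open>The two ways around the parallelogram give a linear relation between its side
      vectors. A functional vanishing on \<open>q - q'\<close> isolates the coefficient of
      \<open>p - p'\<close>.\<close>
    have "(f (p + q) - f (p + q')) + (f (p + q') - f (p' + q')) = (f (p + q) - f (p' + q)) + (f (p' + q) - f (p' + q'))"
      by simp
    then have "(x4 - x3) *\<^sub>R (q - q') = (x2 - x1) *\<^sub>R (p - p')"
      unfolding x scaleR_left_diff_distrib by (metis add.commute add_diff_cancel_right diff_diff_eq2 diff_eq_eq add_diff_eq)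
    moreover obtain k where k: "k \<bullet> (q - q') = 0" "k \<bullet> (p - p') > 0"
      using orthogonal_functional[OF not_scaled_edges[OF np' eq(2) ep(2)]] by blast
    ultimately have "(x2 - x1) * (k \<bullet> (p - p')) = 0"
      by (metis inner_scaleR_right mult_zero_right)
    then have x12: "x1 = x2" using k by simp
    \<comment> \<open>It only matters whether the \<open>A\<close>-component is \<open>p\<close>;
      the two values differ by the increment of \<open>f\<close> common to the two sides in
      direction \<open>p - p'\<close>.\<close>
    define \<gamma> where "\<gamma> z = (if \<exists>\<beta>\<in>B. z = p + \<beta> then x1 *\<^sub>R (p - p') else 0)" for z
    have g: "\<gamma> (p + \<beta>) = x1 *\<^sub>R (p - p')" if "\<beta> \<in> B" for \<beta> using that
      by (auto simp: \<gamma>_def)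
    have pA: "p \<in> A" "p' \<in> A" "p \<noteq> p'" using edge_vertices[OF ep(1)] by auto
    have g': "\<gamma> (p' + \<beta>) = 0" if "\<beta> \<in> B" "(p' + \<beta>) extreme_point_of (A + B)"
      for \<beta>
    proof -
      have "p' + \<beta> \<noteq> p + \<beta>'" if "\<beta>' \<in> B" for \<beta>'
        using unique_vertex_decomposition[OF \<open>(p' + \<beta>) extreme_point_of (A + B)\<close> pA(2) \<open>\<beta> \<in> B\<close> pA(1) that] pA by auto
      then show ?thesis by (auto simp: \<gamma>_def)
    qed
    have end_cases: "s = p \<or> s = p'" if "s \<in> ?F" "s extreme_point_of A" for s
      using that extreme_point_of_face[OF fF] p by (auto simp: extreme_point_of_segment)
    have end_cases': "s = q \<or> s = q'" if "s \<in> ?H" "s extreme_point_of B" for s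
      using that extreme_point_of_face[OF fH] q by (auto simp: extreme_point_of_segment)
    have "\<gamma> x - \<gamma> y = (if parallel_to_edge A (y - x) then f x - f y else 0)"
      if e: "closed_segment x y edge_of G" for x y
    proof -
      have v: "x extreme_point_of (A + B)" "y extreme_point_of (A + B)"
        using edge_vertices[OF eP(1)[OF e]] by auto
      have xyG: "x \<in> G" "y \<in> G" using eP(2)[OF e] by auto
      show ?thesis
        using A B np eP(1)[OF e]
      proof (cases rule: edge_of_sum_cases)
        case (left a1 a2 b1)
        have aA: "a1 \<in> A" "a2 \<in> A" "a1 \<noteq> a2" "a1 extreme_point_of A" "a2 extreme_point_of A"
          using edge_vertices[OF left(1)] by auto
        have m: "a1 \<in> ?F" "a2 \<in> ?F" "b1 \<in> ?H"
          using dec[of a1 b1] dec[of a2 b1] v xyG aA left(2-4) by auto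
        have "b1 extreme_point_of B"
          using extreme_point_sum_left[of b1 a1 B A] v(1) left aA(1) by (simp add: add.commute)
        then have b1: "b1 = q \<or> b1 = q'" using end_cases' m by blast
        have fd: "f (p + b1) - f (p' + b1) = x1 *\<^sub>R (p - p')" using b1 x x12 by auto
        from aA m end_cases consider "a1 = p" "a2 = p'" | "a1 = p'" "a2 = p" by metis
        then show ?thesis
        proof cases
          case 1
          then show ?thesis using left g[OF left(2)] g'[OF left(2)] v fd by simp
        next
          case 2
          have "f (p' + b1) - f (p + b1) = - (x1 *\<^sub>R (p - p'))" using fd by (metis minus_diff_eq)
          then show ?thesis using 2 left g[OF left(2)] g'[OF left(2)] v by simp
        qed
      next
        case (right a1 b1 b2)
        have bB: "b1 \<in> B" "b2 \<in> B" using edge_vertices[OF right(1)] by auto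
        have "a1 extreme_point_of A" using extreme_point_sum_left[of a1 b1 A B] v right bB by simp
        moreover have "a1 \<in> ?F" using dec[of a1 b1] v xyG bB right by auto
        ultimately have "a1 = p \<or> a1 = p'" using end_cases by blast
        then have "\<gamma> x = \<gamma> y" using right g g' bB v by auto
        then show ?thesis using right by simp
      qed
    qed
    then show ?thesis by blast
  qed
qed

text \<open>\<open>g\<close> integrates the increments of \<open>f\<close> along edges parallel to
  edges of \<open>A\<close>, and \<open>gA\<close> is its descent to the vertices of
  \<open>A\<close>. The constant \<open>c\<close> is the ratio of the homothety that
  \<open>gA\<close> must be.\<close>

lemma sum_edge_map_constant:
  fixes A B :: "'a::euclidean_space set"
  assumes A: "indecomposable_polytope A" and B: "polytope B" "B \<noteq> {}"
    and pp: "parallelogramic_position A B" and f: "edge_map (A + B) l f"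
  obtains c where "\<And>x y. closed_segment x y edge_of A + B \<Longrightarrow> parallel_to_edge A (y - x) \<Longrightarrow>
    l (closed_segment x y) = c"
proof -
  have pA: "polytope A" using A by (simp add: indecomposable_polytope_def)
  have P: "polytope (A + B)" by (rule polytope_set_plus[OF pA B(1)])
  have np: "no_parallel_edges A B"
    using pp by (simp add: parallelogramic_position_def no_parallel_edges_def)
  have anti: "(if parallel_to_edge A (x - y) then f y - f x else 0) = - (if parallel_to_edge A (y - x) then f x - f y else 0)" for x y
    using parallel_to_edge_minus[of A x y] by simp
  obtain g where g: "\<And>x y. closed_segment x y edge_of A + B \<Longrightarrow>
      g x - g y = (if parallel_to_edge A (y - x) then f x - f y else 0)"
    using edge_weights_potential[OF P anti sum_two_face_potential[OF pA B(1) pp f]] by metis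
  have fiber: "g (a + b) = g (a + b')"
    if "(a + b) extreme_point_of (A + B)" "(a + b') extreme_point_of (A + B)" "a \<in> A" "b \<in> B" "b' \<in> B" for a b b'
    by (rule fiber_constant[OF pA B(1) np _ that]) (use g in \<open>metis eq_iff_diff_eq_0\<close>)
  \<comment> \<open>\<open>\<beta>\<close> selects some vertex of the sum over each vertex of
    \<open>A\<close>; by \<open>fiber\<close> the value of \<open>g\<close> does not depend on the
    selection.\<close>
  have "\<exists>\<beta>. \<forall>a. a extreme_point_of A \<longrightarrow> \<beta> a \<in> B \<and> (a + \<beta> a) extreme_point_of (A + B)"
    by (intro choice) (use lift_vertex[OF pA B] in metis)
  then obtain \<beta> where \<beta>: "\<And>a. a extreme_point_of A \<Longrightarrow> \<beta> a \<in> B \<and> (a + \<beta> a) extreme_point_of (A + B)" by blast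
  define gA where "gA a = g (a + \<beta> a)" for a
  have gA: "g (a + b) = gA a" if "(a + b) extreme_point_of (A + B)" "a \<in> A" "b \<in> B" for a b
  proof -
    have "a extreme_point_of A" by (rule extreme_point_sum_left[OF that])
    then show ?thesis unfolding gA_def using \<beta> by (intro fiber) (use that in auto)
  qed
  have lift: "\<exists>m\<ge>0. gA a - gA a' = m *\<^sub>R (a - a')"
    if e: "closed_segment a a' edge_of A" for a a'
  proof -
    obtain b where b: "b \<in> B" "closed_segment (a + b) (a' + b) edge_of A + B"
      using lift_edge[OF pA B np e] by blast
    have "parallel_to_edge A ((a' + b) - (a + b))" using parallel_to_edgeI[OF e, of _ 1] by simp
    moreover have "g (a + b) = gA a" "g (a' + b) = gA a'"
      using gA edge_vertices[OF b(2)] edge_vertices[OF e] b by auto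
    ultimately have "gA a - gA a' = f (a + b) - f (a' + b)" using g[OF b(2)] by simp
    then show ?thesis using f b(2) unfolding edge_map_def by (metis add_diff_cancel_right)
  qed
  \<comment> \<open>A factor belongs to the edge as a set, so it has to serve both orders of its
    ends.\<close>
  define lA where "lA e = (SOME m. m \<ge> 0 \<and> (\<forall>a a'. e = closed_segment a a' \<longrightarrow> gA a - gA a' = m *\<^sub>R (a - a')))" for e
  have "edge_map A lA gA"
    unfolding edge_map_def
  proof (intro allI impI)
    fix a a' assume e: "closed_segment a a' edge_of A"
    obtain m where m: "m \<ge> 0" "gA a - gA a' = m *\<^sub>R (a - a')" using lift[OF e] by blast
    have "gA x - gA x' = m *\<^sub>R (x - x')" if "closed_segment a a' = closed_segment x x'" for x x'
    proof -
      have "gA a' - gA a = m *\<^sub>R (a' - a)" using m(2) by (metis minus_diff_eq scaleR_minus_right)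
      then show ?thesis using that m(2) by (auto simp: closed_segment_eq doubleton_eq_iff)
    qed
    then have "\<exists>m. m \<ge> 0 \<and> (\<forall>x x'. closed_segment a a' = closed_segment x x' \<longrightarrow> gA x - gA x' = m *\<^sub>R (x - x'))"
      using m by blast
    then have "lA (closed_segment a a') \<ge> 0 \<and> (\<forall>x x'. closed_segment a a' = closed_segment x x' \<longrightarrow>
        gA x - gA x' = lA (closed_segment a a') *\<^sub>R (x - x'))"
      unfolding lA_def by (rule someI_ex)
    then show "0 \<le> lA (closed_segment a a') \<and> gA a - gA a' = lA (closed_segment a a') *\<^sub>R (a - a')" by blast
  qed
  from indecomposable_edge_map[OF A this] obtain c t where
    c: "\<And>p. p extreme_point_of A \<Longrightarrow> gA p = c *\<^sub>R p + t" by metis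
  have "l (closed_segment x y) = c"
    if e: "closed_segment x y edge_of A + B" and par: "parallel_to_edge A (y - x)" for x y
    using pA B(1) np e
  proof (cases rule: edge_of_sum_cases)
    case (left a a' b)
    have "g x = gA a" "g y = gA a'"
      using gA edge_vertices[OF e] edge_vertices[OF left(1)] left by auto
    then have "f x - f y = c *\<^sub>R (a - a')"
      using g[OF e] par c edge_vertices[OF left(1)] by (simp add: scaleR_diff_right)
    moreover have "f x - f y = l (closed_segment x y) *\<^sub>R (a - a')"
      using f e left(3,4) unfolding edge_map_def by (metis add_diff_cancel_right)
    moreover have "a \<noteq> a'" using edge_vertices[OF left(1)] by simp
    ultimately show ?thesis by simp
  qed (use par in blast)
  then show thesis by (rule that)
qed


subsection \<open>Families in parallelogramic position\<close>

text \<open>The colour of an edge is the summand it is parallel to. Going through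
  \<open>edge_direction e\<close> lets the same notion apply to facets, where it is literally the
  condition used in \<open>stacking_arcs\<close>.\<close>

definition has_color :: "'a::euclidean_space set \<Rightarrow> 'a set \<Rightarrow> bool"
  where "has_color A e \<longleftrightarrow> (\<exists>u. edge_direction e u \<and> parallel_to_edge A u)"

lemma edge_of_self:
  assumes "closed_segment x y edge_of P"
  shows "closed_segment x y edge_of closed_segment x y"
  using assms by (simp add: edge_of_def face_of_refl)

lemma has_color_segment:
  fixes x y :: "'a::euclidean_space"
  assumes e: "closed_segment x y edge_of P"
  shows "has_color A (closed_segment x y) \<longleftrightarrow> parallel_to_edge A (y - x)"
proof
  assume "has_color A (closed_segment x y)"
  then obtain v w where vw: "closed_segment v w edge_of closed_segment x y" "parallel_to_edge A (w - v)"
    by (auto simp: has_color_def edge_direction_def)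
  have "v extreme_point_of closed_segment x y" "w extreme_point_of closed_segment x y" "v \<noteq> w"
    using edge_vertices[OF vw(1)] by auto
  then have "v = x \<and> w = y \<or> v = y \<and> w = x" by (auto simp: extreme_point_of_segment)
  then show "parallel_to_edge A (y - x)" using vw(2) parallel_to_edge_minus by blast
next
  assume "parallel_to_edge A (y - x)"
  then show "has_color A (closed_segment x y)"
    using edge_of_self[OF e] unfolding has_color_def edge_direction_def by blast
qed

lemma has_color_face_iff:
  fixes F :: "'a::euclidean_space set"
  assumes "polytope F"
  shows "has_color A F \<longleftrightarrow> (\<exists>e. e edge_of F \<and> has_color A e)"
proof
  assume "has_color A F"
  then obtain x y where e: "closed_segment x y edge_of F" and "parallel_to_edge A (y - x)"
    by (auto simp: has_color_def edge_direction_def)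
  then show "\<exists>e. e edge_of F \<and> has_color A e" using has_color_segment[OF e] by blast
next
  assume "\<exists>e. e edge_of F \<and> has_color A e"
  then obtain e where e: "e edge_of F" "has_color A e" by blast
  obtain x y where xy: "e = closed_segment x y"
    using edge_is_segment[OF polytope_imp_compact[OF assms] polytope_imp_convex[OF assms] e(1)] by metis
  then have "parallel_to_edge A (y - x)" using e has_color_segment by blast
  then show "has_color A F" using e xy unfolding has_color_def edge_direction_def by blast
qed

section \<open>Colours of the edges of a finite sum\<close>

lemma maxface_sum:
  "finite I \<Longrightarrow> maxface (\<Sum>i\<in>I. P i) c = (\<Sum>i\<in>I. maxface (P i) c)"
proof (induction I rule: finite_induct)
  case empty
  show ?case by (auto simp: maxface_def set_zero)
qed (simp add: maxface_plus)

lemma polytope_sum: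
  fixes P :: "'i \<Rightarrow> 'a::euclidean_space set"
  shows "finite I \<Longrightarrow> (\<And>i. i \<in> I \<Longrightarrow> polytope (P i)) \<Longrightarrow> polytope (\<Sum>i\<in>I. P i)"
proof (induction I rule: finite_induct)
  case empty
  show ?case by (simp add: set_zero polytope_sing)
qed (simp add: polytope_set_plus)

lemma sum_nonempty:
  fixes P :: "'i \<Rightarrow> 'a::comm_monoid_add set"
  shows "finite I \<Longrightarrow> (\<And>i. i \<in> I \<Longrightarrow> P i \<noteq> {}) \<Longrightarrow> (\<Sum>i\<in>I. P i) \<noteq> {}"
proof (induction I rule: finite_induct)
  case (insert i I)
  then obtain x y where "x \<in> P i" "y \<in> (\<Sum>i\<in>I. P i)" by blast
  then have "x + y \<in> P i + (\<Sum>i\<in>I. P i)" by (rule set_plus_intro)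
  then show ?case using insert by auto
qed (simp add: set_zero)

lemma sum_singletons:
  fixes P :: "'i \<Rightarrow> 'a::comm_monoid_add set"
  shows "finite I \<Longrightarrow> (\<And>i. i \<in> I \<Longrightarrow> P i = {d i}) \<Longrightarrow> (\<Sum>i\<in>I. P i) = {\<Sum>i\<in>I. d i}"
proof (induction I rule: finite_induct)
  case empty
  show ?case by (auto simp: set_zero)
qed (simp add: set_plus_def)

locale parallelogramic_polytopes =
  fixes I :: "'i set" and P :: "'i \<Rightarrow> 'a::euclidean_space set"
  assumes fin: "finite I"
    and indec: "\<And>i. i \<in> I \<Longrightarrow> indecomposable_polytope (P i)"
    and nonempty: "\<And>i. i \<in> I \<Longrightarrow> P i \<noteq> {}"
    and not_point: "\<And>i x. i \<in> I \<Longrightarrow> P i \<noteq> {x}"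
    and par: "parallelogramic_family I P"
begin

abbreviation total :: "'a set" where "total \<equiv> (\<Sum>i\<in>I. P i)"
abbreviation rest :: "'i \<Rightarrow> 'a set" where "rest i \<equiv> (\<Sum>j\<in>I - {i}. P j)"

lemma poly: "i \<in> I \<Longrightarrow> polytope (P i)"
  using indec by (auto simp: indecomposable_polytope_def)

lemma poly_total: "polytope total" and poly_rest: "polytope (rest i)"
  using fin poly by (auto intro!: polytope_sum)

lemma rest_nonempty: "rest i \<noteq> {}"
  using fin nonempty by (intro sum_nonempty) auto

lemma split: "i \<in> I \<Longrightarrow> total = P i + rest i"
  using fin by (rule sum.remove)

lemma parallelogramic_rest: "i \<in> I \<Longrightarrow> parallelogramic_position (P i) (rest i)"
  using par by (simp add: parallelogramic_family_def)

lemma no_parallel_rest: "i \<in> I \<Longrightarrow> no_parallel_edges (P i) (rest i)"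
  using parallelogramic_rest by (simp add: parallelogramic_position_def no_parallel_edges_def)

text \<open>If \<open>i\<close> and \<open>j\<close> differ, then \<open>P j\<close> is a summand of
  \<open>rest i\<close>, so its edge directions occur among those of \<open>rest i\<close>, none of
  which is parallel to an edge of \<open>P i\<close>.\<close>

lemma color_unique:
  assumes "i \<in> I" "j \<in> I" "parallel_to_edge (P i) u" "parallel_to_edge (P j) u"
  shows "i = j"
proof (rule ccontr)
  assume "i \<noteq> j"
  have "rest i = P j + (\<Sum>k\<in>I - {i} - {j}. P k)"
    by (rule sum.remove) (use fin assms \<open>i \<noteq> j\<close> in auto)
  moreover have "polytope (\<Sum>k\<in>I - {i} - {j}. P k)" "(\<Sum>k\<in>I - {i} - {j}. P k) \<noteq> {}"
    by (rule polytope_sum sum_nonempty; use fin poly nonempty in auto)+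
  ultimately have "parallel_to_edge (rest i) u"
    using parallel_to_edge_sum[OF poly[OF assms(2)] _ _ assms(4)] by simp
  then obtain b b' d where e: "closed_segment b b' edge_of rest i" "d \<noteq> 0" "u = d *\<^sub>R (b' - b)"
    unfolding parallel_to_edge_def edge_direction_def parallel_vectors_def by blast
  obtain v s where v: "edge_direction (P i) v" "s \<noteq> 0" "u = s *\<^sub>R v"
    using assms(3) unfolding parallel_to_edge_def parallel_vectors_def by blast
  have "b' - b = (1 / d) *\<^sub>R u" using e by simp
  then have "b' - b = (s / d) *\<^sub>R v" "s / d \<noteq> 0" using v e by simp_all
  then have "parallel_to_edge (P i) (b' - b)"
    using v(1) unfolding parallel_to_edge_def parallel_vectors_def by blast
  then show False using no_parallel_edgesD[OF no_parallel_rest[OF assms(1)] e(1)] by simp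
qed

text \<open>If a functional exposing the edge exposed a single point in every summand, the edge
  would be a point too. A summand with a larger face has an edge in the direction in
  question.\<close>

lemma color_exists:
  assumes e: "closed_segment p p' edge_of total"
  obtains i where "i \<in> I" "parallel_to_edge (P i) (p' - p)"
proof -
  have "closed_segment p p' face_of total" using e by (simp add: edge_of_def)
  then obtain c where c: "closed_segment p p' = maxface total c"
    using face_of_polytope_maxface[OF poly_total] by (metis ends_in_segment(1) empty_iff)
  have ne: "maxface (P i) c \<noteq> {}" if "i \<in> I" for i
    by (rule maxface_nonempty[OF polytope_imp_compact[OF poly[OF that]] nonempty[OF that]])
  have "\<exists>i\<in>I. \<exists>x\<in>maxface (P i) c. \<exists>y\<in>maxface (P i) c. x \<noteq> y"
  proof (rule ccontr)
    assume n: "\<not> ?thesis"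
    have "maxface (P i) c = {SOME x. x \<in> maxface (P i) c}" if "i \<in> I" for i
      using n that ne[OF that] some_in_eq[of "maxface (P i) c"] by blast
    then have "(\<Sum>i\<in>I. maxface (P i) c) = {\<Sum>i\<in>I. SOME x. x \<in> maxface (P i) c}"
      by (rule sum_singletons[OF fin])
    then have "closed_segment p p' = {\<Sum>i\<in>I. SOME x. x \<in> maxface (P i) c}"
      using trans[OF c maxface_sum[OF fin]] by simp
    then show False using edge_vertices(3)[OF e] by (metis ends_in_segment singletonD)
  qed
  then obtain i x y where i: "i \<in> I" "x \<in> maxface (P i) c" "y \<in> maxface (P i) c" "x \<noteq> y" by blast
  have eq: "maxface (P i) c + maxface (rest i) c = closed_segment p p'"
    using c split[OF i(1)] by (simp add: maxface_plus)
  obtain b where b: "b \<in> maxface (rest i) c"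
    using maxface_nonempty[OF polytope_imp_compact[OF poly_rest] rest_nonempty] by blast
  have f: "maxface (P i) c face_of P i" by (simp add: maxface_face_of poly i polytope_imp_convex)
  show thesis
    using summand_of_segment[OF f poly[OF i(1)] eq b i(2-4)] that[OF i(1)] by blast
qed

text \<open>Since no summand is a point, every coordinate of the orthant is visible on some edge of
  the sum.\<close>

lemma colored_edge_exists:
  assumes "i \<in> I"
  obtains e where "e edge_of total" "has_color (P i) e"
proof -
  obtain x y where "x \<in> P i" "y \<in> P i" "x \<noteq> y"
    using not_point[OF assms] nonempty[OF assms] by blast
  then obtain v w where e: "closed_segment v w edge_of P i" using exists_edge[OF poly[OF assms]] by metis
  obtain b where "closed_segment (v + b) (w + b) edge_of total"
    using lift_edge[OF poly[OF assms] poly_rest rest_nonempty no_parallel_rest[OF assms] e] split[OF assms] by metis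
  moreover from this have "has_color (P i) (closed_segment (v + b) (w + b))"
    using has_color_segment parallel_to_edgeI[OF e, of _ 1] by fastforce
  ultimately show thesis by (rule that)
qed

lemma total_edge_segment:
  assumes "e edge_of total"
  obtains x y where "e = closed_segment x y" "x \<noteq> y"
  by (rule edge_is_segment[OF polytope_imp_compact[OF poly_total] polytope_imp_convex[OF poly_total] assms])

lemma edge_color_unique:
  assumes "e edge_of total" "i \<in> I" "j \<in> I" "has_color (P i) e" "has_color (P j) e"
  shows "i = j"
  using total_edge_segment[OF assms(1)] has_color_segment assms color_unique by metis

lemma edge_color_exists:
  assumes "e edge_of total"
  obtains i where "i \<in> I" "has_color (P i) e"
proof -
  obtain x y where xy: "e = closed_segment x y" using total_edge_segment[OF assms] by blast
  obtain i where "i \<in> I" "parallel_to_edge (P i) (y - x)" using color_exists assms xy by blast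
  then show thesis using that has_color_segment assms xy by blast
qed

lemma edge_map_constant_on_colors:
  assumes f: "edge_map total l f"
  obtains c where "\<And>i. i \<in> I \<Longrightarrow> 0 \<le> c i"
    "\<And>i e. i \<in> I \<Longrightarrow> e edge_of total \<Longrightarrow> has_color (P i) e \<Longrightarrow> l e = c i"
proof -
  have "\<exists>c. \<forall>e. e edge_of total \<longrightarrow> has_color (P i) e \<longrightarrow> l e = c" if i: "i \<in> I" for i
  proof -
    obtain c where c: "\<And>x y. closed_segment x y edge_of P i + rest i \<Longrightarrow> parallel_to_edge (P i) (y - x) \<Longrightarrow>
        l (closed_segment x y) = c"
      using sum_edge_map_constant[OF indec[OF i] poly_rest rest_nonempty parallelogramic_rest[OF i]] f split[OF i] by metis
    have "l e = c" if e: "e edge_of total" "has_color (P i) e" for e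
    proof -
      obtain x y where xy: "e = closed_segment x y" using total_edge_segment[OF e(1)] by blast
      then show ?thesis using c[of x y] e has_color_segment split[OF i] by metis
    qed
    then show ?thesis by blast
  qed
  then obtain c where c: "\<And>i e. i \<in> I \<Longrightarrow> e edge_of total \<Longrightarrow> has_color (P i) e \<Longrightarrow> l e = c i" by metis
  have "0 \<le> c i" if i: "i \<in> I" for i
  proof -
    obtain e where e: "e edge_of total" "has_color (P i) e" by (rule colored_edge_exists[OF i])
    obtain x y where "e = closed_segment x y" using total_edge_segment[OF e(1)] by blast
    then have "0 \<le> l e" using f e by (simp add: edge_map_def)
    then show ?thesis using c[OF i e] by simp
  qed
  with c that show thesis by blast
qed

text \<open>The deformation sought is the sum of the dilates of the \<open>P i\<close> by
  \<open>c i\<close>: each component of a vertex is scaled by its own factor, and along an edge only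
  the component of its colour moves.\<close>

lemma color_edge_map:
  assumes c: "\<And>i. i \<in> I \<Longrightarrow> 0 \<le> c i"
    and l: "\<And>i e. i \<in> I \<Longrightarrow> e edge_of total \<Longrightarrow> has_color (P i) e \<Longrightarrow> l e = c i"
  obtains f where "edge_map total l f"
proof -
  have "\<exists>d. p = (\<Sum>i\<in>I. d i) \<and> (\<forall>i\<in>I. d i \<in> P i)" if "p \<in> total"
    for p
    using that by (auto simp: set_sum_alt[OF fin])
  then obtain d where d: "\<And>p. p \<in> total \<Longrightarrow> p = (\<Sum>i\<in>I. d p i)" "\<And>p i. p \<in> total \<Longrightarrow> i \<in> I \<Longrightarrow> d p i \<in> P i"
    by metis
  \<comment> \<open>\<open>d\<close> is an arbitrary choice of components, but decompositions of
    vertices are unique, so it agrees with every splitting along \<open>P i\<close> and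
    \<open>rest i\<close>.\<close>
  have unique: "d p i = a" if p: "p extreme_point_of total" and i: "i \<in> I" and ab: "a \<in> P i" "b \<in> rest i" "p = a + b" for p i a b
  proof -
    have pT: "p \<in> total" using p by (auto simp: extreme_point_of_def)
    have eq: "p = d p i + (\<Sum>j\<in>I - {i}. d p j)"
      using d(1)[OF pT] sum.remove[OF fin i, of "d p"] by simp
    have "(\<Sum>j\<in>I - {i}. d p j) \<in> rest i"
      using d(2)[OF pT] fin by (auto simp: set_sum_alt)
    then show ?thesis
      using unique_vertex_decomposition[of a b "P i" "rest i" "d p i"] p ab eq d(2)[OF pT i] split[OF i]
        by metis
  qed
  define f where "f p = (\<Sum>i\<in>I. c i *\<^sub>R d p i)" for p
  have "edge_map total l f"
    unfolding edge_map_def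
  proof (intro allI impI)
    fix x y assume e: "closed_segment x y edge_of total"
    obtain i where i: "i \<in> I" "parallel_to_edge (P i) (y - x)" using color_exists[OF e] by blast
    have lc: "l (closed_segment x y) = c i"
      by (rule l[OF i(1) e]) (use i has_color_segment[OF e] in blast)
    have v: "x extreme_point_of total" "y extreme_point_of total" "x \<in> total" "y \<in> total"
      using edge_vertices[OF e] by auto
    have other: "d x j = d y j" if j: "j \<in> I" "j \<noteq> i" for j
    proof -
      have nj: "\<not> parallel_to_edge (P j) (y - x)" using color_unique j i by blast
      have ej: "closed_segment x y edge_of P j + rest j" using e split[OF j(1)] by simp
      show ?thesis
        using poly[OF j(1)] poly_rest no_parallel_rest[OF j(1)] ej
      proof (cases rule: edge_of_sum_cases)
        case (right a b b')
        have "b \<in> rest j" "b' \<in> rest j" using edge_vertices[OF right(1)] by auto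
        then show ?thesis using unique[OF v(1) j(1) right(2)] unique[OF v(2) j(1) right(2)] right(3,4)
          by simp
      qed (use nj in blast)
    qed
    have "x - y = (\<Sum>j\<in>I. d x j - d y j)"
      using d(1)[OF v(3)] d(1)[OF v(4)] by (simp add: sum_subtractf)
    also have "\<dots> = d x i - d y i"
      using other by (subst sum.remove[OF fin i(1)]) (simp add: sum.neutral)
    finally have xy: "x - y = d x i - d y i" .
    have "f x - f y = (\<Sum>j\<in>I. c j *\<^sub>R (d x j - d y j))"
      by (simp add: f_def sum_subtractf scaleR_diff_right)
    also have "\<dots> = c i *\<^sub>R (d x i - d y i)"
      using other by (subst sum.remove[OF fin i(1)]) (simp add: sum.neutral)
    finally show "0 \<le> l (closed_segment x y) \<and> f x - f y = l (closed_segment x y) *\<^sub>R (x - y)"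
      using xy lc c[OF i(1)] by simp
  qed
  then show thesis by (rule that)
qed

end


subsection \<open>Stacking\<close>

lemma face_inequality_exists:
  fixes Q :: "'a::euclidean_space set"
  assumes "polytope Q" "F face_of Q"
  obtains a b where "facet_inequality Q F a b"
proof -
  have "F exposed_face_of Q"
    using exposed_face_of_polyhedron[OF polytope_imp_polyhedron[OF assms(1)]] assms(2) by blast
  then show thesis using that by (auto simp: exposed_face_of_def facet_inequality_def)
qed

lemma facet_inequality_proper:
  assumes "F facet_of Q" "facet_inequality Q F a b"
  obtains x where "x \<in> Q" "a \<bullet> x < b"
proof -
  have "F \<noteq> Q" using assms(1) by auto
  then obtain x where "x \<in> Q" "a \<bullet> x \<noteq> b" using assms(2)
    by (auto simp: facet_inequality_def)
  moreover from this have "a \<bullet> x \<le> b" using assms(2) by (auto simp: facet_inequality_def)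
  ultimately show thesis using that by force
qed

text \<open>The region is open in the affine hull, so \<open>q\<close> can be moved a little both
  towards \<open>x\<close> and away from it. This is how strict inequalities at \<open>q\<close> are
  obtained.\<close>

lemma stacking_region_neighbourhood:
  fixes Q :: "'a::euclidean_space set"
  assumes q: "q \<in> stacking_region Q F" and x: "x \<in> Q"
  obtains \<delta> where "\<delta> > 0" "\<And>s. \<bar>s\<bar> \<le> \<delta> \<Longrightarrow> q + s *\<^sub>R (q - x) \<in> outer_halfspace Q F"
    "\<And>s G. \<bar>s\<bar> \<le> \<delta> \<Longrightarrow> G facet_of Q \<Longrightarrow> G \<noteq> F \<Longrightarrow> q + s *\<^sub>R (q - x) \<in> inner_halfspace Q G"
proof -
  let ?U = "affine hull Q"
  let ?R = "outer_halfspace Q F \<inter> (\<Inter>G\<in>{G. G facet_of Q \<and> G \<noteq> F}. inner_halfspace Q G)"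
  obtain T where T: "openin (top_of_set ?U) T" "q \<in> T" "T \<subseteq> ?R"
    using q by (auto simp: stacking_region_def interior_of_def)
  obtain e where e: "e > 0" "ball q e \<inter> ?U \<subseteq> T" and qU: "q \<in> ?U"
    using T openin_contains_ball by (metis subsetD)
  \<comment> \<open>Half the radius keeps the moved point strictly inside the ball, and the added 1
    keeps the denominator positive.\<close>
  define \<delta> where "\<delta> = (e / 2) / (norm (q - x) + 1)"
  have "norm (q - x) + 1 > 0" by (simp add: add_nonneg_pos)
  moreover from this have "norm (q - x) + 1 \<noteq> 0" by linarith
  moreover have "(e / 2) / n * n = e / 2" if "n \<noteq> 0" for n :: real using that by simp
  ultimately have \<delta>: "\<delta> > 0" "\<delta> * (norm (q - x) + 1) = e / 2"
    using e(1) unfolding \<delta>_def by (simp, blast)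
  have mem: "q + s *\<^sub>R (q - x) \<in> ?R" if "\<bar>s\<bar> \<le> \<delta>" for s
  proof -
    have "\<bar>s\<bar> * norm (q - x) \<le> \<delta> * (norm (q - x) + 1)" using that \<delta>
      by (intro mult_mono) auto
    then have "q + s *\<^sub>R (q - x) \<in> ball q e" using \<delta> e by (simp add: dist_norm)
    moreover have "(1 + s) *\<^sub>R q + (- s) *\<^sub>R x \<in> ?U"
      by (rule mem_affine[OF affine_affine_hull qU hull_inc[OF x]]) simp
    then have "q + s *\<^sub>R (q - x) \<in> ?U" by (simp add: algebra_simps)
    ultimately show ?thesis using e T by blast
  qed
  show thesis by (rule that[OF \<delta>(1)]) (use mem in blast)+
qed

text \<open>With equality at \<open>q\<close>, a small move towards a point of \<open>Q\<close> off
  \<open>F\<close> would leave the outer half-space.\<close>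

lemma stacking_region_outside:
  fixes Q :: "'a::euclidean_space set"
  assumes q: "q \<in> stacking_region Q F" and F: "F facet_of Q" and ab: "facet_inequality Q F a b"
  shows "a \<bullet> q > b"
proof -
  obtain x where x: "x \<in> Q" "a \<bullet> x < b" using facet_inequality_proper[OF F ab] by blast
  obtain \<delta> where \<delta>: "\<delta> > 0" "\<And>s. \<bar>s\<bar> \<le> \<delta> \<Longrightarrow> q + s *\<^sub>R (q - x) \<in> outer_halfspace Q F"
    using stacking_region_neighbourhood[OF q x(1)] by metis
  have "b \<le> a \<bullet> (q + 0 *\<^sub>R (q - x))" "b \<le> a \<bullet> (q + (-\<delta>) *\<^sub>R (q - x))"
    using \<delta>(2)[of 0] \<delta>(2)[of "-\<delta>"] \<delta>(1) ab
      by (auto simp: outer_halfspace_def)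
  then have "b \<le> a \<bullet> q" "b \<le> a \<bullet> q - \<delta> * (a \<bullet> q - a \<bullet> x)"
    by (simp_all add: inner_diff_right inner_add_right)
  moreover from this(1) have "\<delta> * (a \<bullet> q - a \<bullet> x) > 0" using \<delta>(1) x(2)
    by simp
  ultimately show ?thesis by simp
qed

text \<open>With equality at \<open>q\<close>, a small move away from a point of \<open>Q\<close>
  off \<open>G\<close> would leave the inner half-space.\<close>

lemma stacking_region_inside:
  fixes Q :: "'a::euclidean_space set"
  assumes q: "q \<in> stacking_region Q F" and G: "G facet_of Q" "G \<noteq> F" and ab: "facet_inequality Q G a b"
  shows "a \<bullet> q < b"
proof -
  obtain x where x: "x \<in> Q" "a \<bullet> x < b" using facet_inequality_proper[OF G(1) ab] by blast
  obtain \<delta> where \<delta>: "\<delta> > 0"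
    "\<And>s G. \<bar>s\<bar> \<le> \<delta> \<Longrightarrow> G facet_of Q \<Longrightarrow> G \<noteq> F \<Longrightarrow> q + s *\<^sub>R (q - x) \<in> inner_halfspace Q G"
    using stacking_region_neighbourhood[OF q x(1)] by metis
  have "a \<bullet> (q + \<delta> *\<^sub>R (q - x)) \<le> b"
    using \<delta>(2)[of \<delta> G] \<delta>(1) ab G by (auto simp: inner_halfspace_def)
  then have *: "a \<bullet> q + \<delta> * (a \<bullet> q - a \<bullet> x) \<le> b"
    by (simp add: inner_diff_right inner_add_right)
  show ?thesis
  proof (rule ccontr)
    assume n: "\<not> a \<bullet> q < b"
    then have "\<delta> * (a \<bullet> q - a \<bullet> x) > 0" using \<delta>(1) x(2) by simp
    then show False using * n by simp
  qed
qed

text \<open>A nonempty proper face is the intersection of the facets containing it; if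
  \<open>F\<close> were the only one, the face would be \<open>F\<close>.\<close>

lemma face_in_other_facet:
  fixes Q :: "'a::euclidean_space set"
  assumes Q: "polytope Q" and e: "e face_of Q" "e \<noteq> {}" "e \<noteq> Q" "e \<noteq> F"
  obtains G where "G facet_of Q" "G \<noteq> F" "e \<subseteq> G"
proof -
  have eq: "e = \<Inter>{G. G facet_of Q \<and> e \<subseteq> G}"
    by (rule face_of_polyhedron[OF polytope_imp_polyhedron[OF Q] e(1-3)])
  have "\<exists>G. G facet_of Q \<and> G \<noteq> F \<and> e \<subseteq> G"
  proof (rule ccontr)
    assume n: "\<not> ?thesis"
    then consider "{G. G facet_of Q \<and> e \<subseteq> G} = {}" | "{G. G facet_of Q \<and> e \<subseteq> G} = {F}" by blast
    then show False
    proof cases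
      case 1
      then have "e = UNIV" using eq by (metis Inter_empty)
      then show False using e(1,3) face_of_imp_subset by blast
    next
      case 2
      then have "e = \<Inter>{F}" using eq by metis
      then show False using e(4) by simp
    qed
  qed
  then show thesis using that by blast
qed

text \<open>Adding a multiple of the inequality of a facet other than \<open>F\<close> tilts a supporting hyperplane
  of a face below the stacking point.\<close>

lemma stacking_tilt:
  fixes Q :: "'a::euclidean_space set"
  assumes Q: "polytope Q" and q: "q \<in> stacking_region Q F"
    and e: "e face_of Q" "e \<noteq> {}" "e \<noteq> Q" "e \<noteq> F"
  obtains c \<beta> where "facet_inequality Q e c \<beta>" "c \<bullet> q < \<beta>"
proof -
  obtain G where G: "G facet_of Q" "G \<noteq> F" "e \<subseteq> G" by (rule face_in_other_facet[OF Q e])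
  obtain a b where ab: "facet_inequality Q G a b" using face_inequality_exists[OF Q] G facet_of_imp_face_of by blast
  have lt: "a \<bullet> q < b" by (rule stacking_region_inside[OF q G(1,2) ab])
  obtain c0 b0 where c0: "facet_inequality Q e c0 b0" using face_inequality_exists[OF Q e(1)] by blast
  \<comment> \<open>Large enough that the slack of \<open>q\<close> at \<open>G\<close>, multiplied
    by \<open>M\<close>, exceeds any violation of the first inequality at \<open>q\<close>.\<close>
  define M where "M = (\<bar>c0 \<bullet> q - b0\<bar> + 1) / (b - a \<bullet> q)"
  have M0: "M > 0" using lt by (auto simp: M_def intro!: divide_pos_pos)
  have "M * (b - a \<bullet> q) = \<bar>c0 \<bullet> q - b0\<bar> + 1" using lt by (simp add: M_def)
  then have "(c0 + M *\<^sub>R a) \<bullet> q < b0 + M * b" by (simp add: inner_add_left algebra_simps)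
  moreover have "facet_inequality Q e (c0 + M *\<^sub>R a) (b0 + M * b)"
  proof -
    have le: "c0 \<bullet> x \<le> b0" "M * (a \<bullet> x) \<le> M * b" if "x \<in> Q" for x
      using that c0 ab M0 by (auto simp: facet_inequality_def)
    have "x \<in> e \<longleftrightarrow> c0 \<bullet> x + M * (a \<bullet> x) = b0 + M * b"
      if x: "x \<in> Q" for x
    proof
      assume "x \<in> e"
      then show "c0 \<bullet> x + M * (a \<bullet> x) = b0 + M * b"
        using c0 ab G(3) by (auto simp: facet_inequality_def)
    next
      assume "c0 \<bullet> x + M * (a \<bullet> x) = b0 + M * b"
      then have "c0 \<bullet> x = b0" using le[OF x] by linarith
      then show "x \<in> e" using c0 x by (auto simp: facet_inequality_def)
    qed
    moreover have "e \<subseteq> Q" using e(1) face_of_imp_subset by blast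
    ultimately show ?thesis
      using le by (auto simp: facet_inequality_def inner_add_left intro: add_mono)
  qed
  ultimately show thesis using that by blast
qed

section \<open>Faces and edges of the stacked polytope\<close>

lemma polytope_hull_insert:
  fixes Q :: "'a::euclidean_space set"
  assumes "polytope Q"
  shows "polytope (convex hull (insert q Q))"
proof -
  obtain S where "finite S" "Q = convex hull S" using assms by (auto simp: polytope_def)
  then have "convex hull (insert q Q) = convex hull (insert q S)" by (metis hull_insert)
  then show ?thesis using \<open>finite S\<close> by (simp add: polytope_convex_hull)
qed

text \<open>Extreme points of the section are extreme in the whole hull, hence generators, so the
  generators on the supporting hyperplane span the face.\<close>

lemma hull_insert_face:
  fixes Q :: "'a::euclidean_space set"
  assumes Q: "polytope Q" and le: "\<And>x. x \<in> insert q Q \<Longrightarrow> c \<bullet> x \<le> \<beta>"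
  shows "convex hull {x \<in> insert q Q. c \<bullet> x = \<beta>} face_of convex hull (insert q Q)"
proof -
  let ?Q = "convex hull (insert q Q)"
  let ?T = "?Q \<inter> {x. c \<bullet> x = \<beta>}"
  have pQ: "polytope ?Q" by (rule polytope_hull_insert[OF Q])
  have sub: "?Q \<subseteq> {x. c \<bullet> x \<le> \<beta>}"
    by (rule hull_minimal) (use le convex_halfspace_le in auto)
  have f: "?T face_of ?Q"
    by (rule face_of_Int_supporting_hyperplane_le) (use sub in \<open>auto intro: convex_convex_hull\<close>)
  have pT: "polytope ?T" by (rule face_of_polytope_polytope[OF pQ f])
  have "?T \<subseteq> convex hull {x \<in> insert q Q. c \<bullet> x = \<beta>}"
  proof -
    have "{v. v extreme_point_of ?T} \<subseteq> {x \<in> insert q Q. c \<bullet> x = \<beta>}"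
    proof
      fix v assume "v \<in> {v. v extreme_point_of ?T}"
      then have "v extreme_point_of ?Q" "v \<in> ?T" using extreme_point_of_face[OF f] by auto
      then show "v \<in> {x \<in> insert q Q. c \<bullet> x = \<beta>}"
        using extreme_point_of_convex_hull by blast
    qed
    from hull_mono[OF this, of convex] show ?thesis
      unfolding polytope_hull_vertices[OF pT, symmetric] .
  qed
  moreover have "convex hull {x \<in> insert q Q. c \<bullet> x = \<beta>} \<subseteq> ?T"
    by (rule hull_minimal) (auto intro: hull_inc convex_Int convex_hyperplane)
  ultimately have "?T = convex hull {x \<in> insert q Q. c \<bullet> x = \<beta>}" by (rule equalityI)
  with f show ?thesis by metis
qed

lemma face_of_stacked_polytope:
  fixes Q :: "'a::euclidean_space set"
  assumes Q: "polytope Q" and q: "q \<in> stacking_region Q F"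
    and e: "e face_of Q" "e \<noteq> {}" "e \<noteq> Q" "e \<noteq> F"
  shows "e face_of convex hull (insert q Q)"
proof -
  obtain c \<beta> where c: "facet_inequality Q e c \<beta>" "c \<bullet> q < \<beta>"
    by (rule stacking_tilt[OF assms])
  have "{x \<in> insert q Q. c \<bullet> x = \<beta>} = e" using c by (auto simp: facet_inequality_def)
  moreover have "convex hull e = e" using face_of_imp_convex[OF e(1)] by (rule hull_same)
  moreover have le: "c \<bullet> x \<le> \<beta>" if "x \<in> insert q Q" for x
    using c that by (auto simp: facet_inequality_def)
  ultimately show ?thesis
    using hull_insert_face[OF Q, of q c \<beta>] le by simp
qed

text \<open>A hyperplane touching \<open>Q\<close> only in \<open>p\<close> and having
  \<open>q\<close> below is combined with the hyperplane of \<open>F\<close>, which has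
  \<open>q\<close> above, so as to pass through \<open>q\<close>. The result touches the generators
  exactly in \<open>p\<close> and \<open>q\<close>.\<close>

lemma edge_to_stacking_point:
  fixes Q :: "'a::euclidean_space set"
  assumes Q: "polytope Q" and q: "q \<in> stacking_region Q F" and F: "F facet_of Q" "F \<noteq> {p}"
    and p: "p extreme_point_of F"
  shows "closed_segment q p edge_of convex hull (insert q Q)"
proof -
  have fF: "F face_of Q" using F facet_of_imp_face_of by blast
  have pQ: "{p} face_of Q" "p \<in> F" using p extreme_point_of_face[OF fF]
    by (auto simp: face_of_singleton)
  have "{p} \<noteq> Q"
  proof
    assume "{p} = Q"
    then show False using F pQ facet_of_imp_subset by fastforce
  qed
  then obtain c \<beta> where c: "facet_inequality Q {p} c \<beta>" "c \<bullet> q < \<beta>"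
    using stacking_tilt[OF Q q pQ(1)] F by blast
  obtain a b where ab: "facet_inequality Q F a b" using face_inequality_exists[OF Q fF] by blast
  have aq: "a \<bullet> q > b" by (rule stacking_region_outside[OF q F(1) ab])
  have ap: "a \<bullet> p = b" "p \<in> Q" using ab pQ(2) by (auto simp: facet_inequality_def)
  then have "p \<noteq> q" using aq by auto
  \<comment> \<open>Ratio of the slack of \<open>q\<close> in the first inequality to its violation
    of the inequality of \<open>F\<close>.\<close>
  define \<mu> where "\<mu> = (\<beta> - c \<bullet> q) / (a \<bullet> q - b)"
  have \<mu>: "\<mu> > 0" "\<mu> * (a \<bullet> q - b) = \<beta> - c \<bullet> q" using c(2) aq
    by (simp_all add: \<mu>_def)
  let ?c = "c + \<mu> *\<^sub>R a" and ?b = "\<beta> + \<mu> * b"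
  have cq: "?c \<bullet> q = ?b" using \<mu>(2) by (simp add: inner_add_left algebra_simps)
  have le: "c \<bullet> x \<le> \<beta>" "\<mu> * (a \<bullet> x) \<le> \<mu> * b" if "x \<in> Q" for x
    using that c(1) ab \<mu>(1) by (auto simp: facet_inequality_def)
  have "?c \<bullet> x \<le> ?b" if "x \<in> insert q Q" for x
    using that cq le[of x] by (auto simp: inner_add_left)
  then have f: "convex hull {x \<in> insert q Q. ?c \<bullet> x = ?b} face_of convex hull (insert q Q)"
    by (rule hull_insert_face[OF Q])
  have "{x \<in> insert q Q. ?c \<bullet> x = ?b} = {q, p}"
  proof (intro equalityI subsetI)
    fix x assume x: "x \<in> {x \<in> insert q Q. ?c \<bullet> x = ?b}"
    show "x \<in> {q, p}"
    proof (cases "x = q")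
      case False
      then have xQ: "x \<in> Q" and "c \<bullet> x + \<mu> * (a \<bullet> x) = \<beta> + \<mu> * b"
        using x by (auto simp: inner_add_left)
      then have "c \<bullet> x = \<beta>" using le[OF xQ] by linarith
      then show ?thesis using xQ c(1) by (auto simp: facet_inequality_def)
    qed simp
  next
    fix x assume "x \<in> {q, p}"
    moreover have "c \<bullet> p = \<beta>" using c(1) by (auto simp: facet_inequality_def)
    then have "?c \<bullet> p = ?b" using ap by (simp add: inner_add_left)
    ultimately show "x \<in> {x \<in> insert q Q. ?c \<bullet> x = ?b}" using cq ap by auto
  qed
  then have "closed_segment q p face_of convex hull (insert q Q)" using f
    by (simp add: segment_convex_hull)
  then show ?thesis using \<open>p \<noteq> q\<close> by (simp add: edge_of_def aff_dim_segment)
qed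

text \<open>A segment from the stacking point to a vertex off \<open>F\<close> passes through the relative interior of
  \<open>F\<close>.\<close>

lemma stacking_point_edge_ends:
  fixes Q :: "'a::euclidean_space set"
  assumes Q: "polytope Q" and q: "q \<in> stacking_region Q F" and F: "F facet_of Q" "aff_dim F \<ge> 2"
    and e: "closed_segment q y face_of convex hull (insert q Q)" and y: "y \<in> Q"
  shows "y \<in> F"
proof (rule ccontr)
  assume yF: "y \<notin> F"
  obtain H where H: "finite H" and seq: "Q = affine hull Q \<inter> \<Inter>H"
    and hs: "\<And>h. h \<in> H \<Longrightarrow> \<exists>a b. a \<noteq> 0 \<and> h = {x. a \<bullet> x \<le> b}"
    and min: "\<And>F'. F' \<subset> H \<Longrightarrow> Q \<subset> affine hull Q \<inter> \<Inter>F'"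
    using polytope_imp_polyhedron[OF Q] unfolding polyhedron_Int_affine_minimal by metis
  then obtain a b where ab: "\<And>h. h \<in> H \<Longrightarrow> a h \<noteq> 0 \<and> h = {x. a h \<bullet> x \<le> b h}" by metis
  have facets: "C facet_of Q \<longleftrightarrow> (\<exists>h. h \<in> H \<and> C = Q \<inter> {x. a h \<bullet> x = b h})" for C
    by (rule facet_of_polyhedron_explicit[OF H seq ab min])
  have memQ: "x \<in> Q \<longleftrightarrow> x \<in> affine hull Q \<and> (\<forall>h\<in>H. a h \<bullet> x \<le> b h)" for x
    using seq ab by blast
  define G where "G h = Q \<inter> {x. a h \<bullet> x = b h}" for h
  have ineq: "facet_inequality Q (G h) (a h) (b h)" if "h \<in> H" for h
    using memQ that by (auto simp: facet_inequality_def G_def)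
  have fac: "G h facet_of Q" if "h \<in> H" for h using facets that by (auto simp: G_def)
  \<comment> \<open>The half-spaces are grouped by their facets: \<open>q\<close> is strictly
    outside those belonging to \<open>F\<close> and strictly inside all others.\<close>
  define HF where "HF = {h \<in> H. G h = F}"
  have out: "a h \<bullet> q > b h" "a h \<bullet> y < b h" if "h \<in> HF" for h
  proof -
    have h: "h \<in> H" "G h = F" using that by (auto simp: HF_def)
    then show "a h \<bullet> q > b h" using stacking_region_outside[OF q F(1)] ineq[OF h(1)] by metis
    have "a h \<bullet> y \<le> b h" using y memQ h by blast
    moreover have "a h \<bullet> y \<noteq> b h" using yF y h(2) by (auto simp: G_def)
    ultimately show "a h \<bullet> y < b h" by simp
  qed
  have ins: "a h \<bullet> q < b h" if "h \<in> H" "h \<notin> HF" for h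
    using stacking_region_inside[OF q fac[OF that(1)] _ ineq[OF that(1)]] that by (auto simp: HF_def)
  have HF: "finite HF" "HF \<noteq> {}" using H facets[of F] F by (auto simp: HF_def G_def)
  \<comment> \<open>Parameter at which the segment from \<open>y\<close> to \<open>q\<close> crosses
    the boundary of \<open>h\<close>. The smallest one gives the point \<open>z\<close> where the
    segment leaves \<open>Q\<close>.\<close>
  define t where "t h = (b h - a h \<bullet> y) / (a h \<bullet> q - a h \<bullet> y)" for h
  have t: "0 < t h" "t h < 1" if "h \<in> HF" for h
    using out[OF that] by (auto simp: t_def field_simps)
  define t0 where "t0 = Min (t ` HF)"
  have "t0 \<in> t ` HF" unfolding t0_def by (rule Min_in) (use HF in auto)
  then obtain h0 where h0: "h0 \<in> HF" "t0 = t h0" by blast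
  have t0: "0 < t0" "t0 < 1" using t h0 by auto
  have t0_le: "t0 \<le> t h" if "h \<in> HF" for h unfolding t0_def
    by (rule Min_le) (use HF that in auto)
  define z where "z = (1 - t0) *\<^sub>R y + t0 *\<^sub>R q"
  have az: "a h \<bullet> z = a h \<bullet> y + t0 * (a h \<bullet> q - a h \<bullet> y)" for h
    by (simp add: z_def inner_add_right algebra_simps)
  have azF: "a h \<bullet> z \<le> b h" if "h \<in> HF" for h
  proof -
    have "a h \<bullet> q - a h \<bullet> y > 0" using out[OF that] by simp
    then have "t0 * (a h \<bullet> q - a h \<bullet> y) \<le> b h - a h \<bullet> y"
      using t0_le[OF that] by (simp add: t_def pos_le_divide_eq)
    then show ?thesis by (simp add: az)
  qed
  have az_strict: "a h \<bullet> z < b h" if "h \<in> H" "h \<notin> HF" for h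
  proof -
    have "(1 - t0) * (a h \<bullet> y) \<le> (1 - t0) * b h" using y memQ that t0
      by (intro mult_left_mono) auto
    moreover have "t0 * (a h \<bullet> q) < t0 * b h" using ins[OF that] t0 by simp
    ultimately have "(1 - t0) * (a h \<bullet> y) + t0 * (a h \<bullet> q) < (1 - t0) * b h + t0 * b h"
      by linarith
    then show ?thesis by (simp add: z_def inner_add_right algebra_simps)
  qed
  have qU: "q \<in> affine hull Q"
  proof -
    obtain \<delta> where "\<delta> > 0" "\<And>s. \<bar>s\<bar> \<le> \<delta> \<Longrightarrow> q + s *\<^sub>R (q - y) \<in> outer_halfspace Q F"
      using stacking_region_neighbourhood[OF q y] by metis
    from this(2)[of 0] this(1) show ?thesis by (simp add: outer_halfspace_def)
  qed
  have yU: "y \<in> affine hull Q" using y hull_inc by fast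
  have zU: "z \<in> affine hull Q"
    unfolding z_def by (rule mem_affine[OF affine_affine_hull yU qU]) simp
  have zQ: "z \<in> Q" unfolding memQ using zU azF az_strict less_imp_le by blast
  have h0': "a h0 \<bullet> z = b h0"
  proof -
    have "a h0 \<bullet> q - a h0 \<bullet> y \<noteq> 0" using out[OF h0(1)] by simp
    then show ?thesis by (simp add: az h0(2) t_def)
  qed
  then have zF: "z \<in> F" using zQ h0 by (auto simp: HF_def G_def)
  have "y \<noteq> q" using out[OF h0(1)] by auto
  then have zopen: "z \<in> open_segment y q" unfolding in_segment z_def using t0 by blast
  have zT: "z \<in> closed_segment q y" using open_closed_segment[OF zopen]
    by (simp add: closed_segment_commute)
  \<comment> \<open>At \<open>z\<close> all inequalities not belonging to \<open>F\<close> are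
    strict, so a segment from any other \<open>w\<close> in \<open>F\<close> can be prolonged beyond
    \<open>z\<close> inside \<open>Q\<close>. Since \<open>z\<close> lies on the face
    \<open>closed_segment q y\<close>, so does \<open>w\<close>; but a segment cannot contain a set
    of dimension 2 or more.\<close>
  have "F \<subseteq> closed_segment q y"
  proof
    fix w assume w: "w \<in> F"
    show "w \<in> closed_segment q y"
    proof (cases "w = z")
      case False
      have wQ: "w \<in> Q" using w F facet_of_imp_subset by blast
      have "\<forall>\<^sub>F \<delta> in at_right (0::real). \<forall>h\<in>H - HF. a h \<bullet> (z + \<delta> *\<^sub>R (z - w)) < b h"
      proof (rule eventually_ball_finite, use H in simp, rule ballI)
        fix h assume h: "h \<in> H - HF"
        have "((\<lambda>\<delta>. a h \<bullet> (z + \<delta> *\<^sub>R (z - w))) \<longlongrightarrow> a h \<bullet> (z + 0 *\<^sub>R (z - w))) (at_right 0)"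
          by (intro tendsto_intros)
        then show "\<forall>\<^sub>F \<delta> in at_right 0. a h \<bullet> (z + \<delta> *\<^sub>R (z - w)) < b h"
          using az_strict[of h] h by (intro order_tendstoD(2)) auto
      qed
      then obtain \<delta> where \<delta>: "\<delta> > 0" "\<And>h. h \<in> H \<Longrightarrow> h \<notin> HF \<Longrightarrow> a h \<bullet> (z + \<delta> *\<^sub>R (z - w)) < b h"
        unfolding eventually_at_right_field by (metis DiffI dense)
      let ?z = "z + \<delta> *\<^sub>R (z - w)"
      have "a h \<bullet> ?z = b h" if "h \<in> HF" for h
        using zF w that by (auto simp: HF_def G_def inner_add_right inner_diff_right)
      moreover have "?z \<in> affine hull Q"
      proof -
        have "(1 + \<delta>) *\<^sub>R z + (-\<delta>) *\<^sub>R w \<in> affine hull Q"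
          by (rule mem_affine[OF affine_affine_hull zU hull_inc[OF wQ]]) simp
        then show ?thesis by (simp add: algebra_simps)
      qed
      ultimately have "?z \<in> Q" unfolding memQ using \<delta>(2) by (metis less_eq_real_def)
      moreover have "z \<in> open_segment w ?z"
      proof -
        have "?z - w = (1 + \<delta>) *\<^sub>R (z - w)" by (simp add: algebra_simps)
        then have ne: "w \<noteq> ?z" using \<delta>(1) False by auto
        have "(1 - k) *\<^sub>R w + k *\<^sub>R (w + (1 + \<delta>) *\<^sub>R (z - w)) = w + (k * (1 + \<delta>)) *\<^sub>R (z - w)" for k
          by (simp add: algebra_simps)
        from this[of "1/(1+\<delta>)"]
        have "z = (1 - 1/(1+\<delta>)) *\<^sub>R w + (1/(1+\<delta>)) *\<^sub>R (w + (1 + \<delta>) *\<^sub>R (z - w))"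
          using \<delta>(1) by simp
        moreover have "w + (1 + \<delta>) *\<^sub>R (z - w) = ?z" by (simp add: algebra_simps)
        ultimately show ?thesis
          unfolding in_segment using ne \<delta>(1) by (intro conjI exI[of _ "1/(1+\<delta>)"]) auto
      qed
      moreover have "Q \<subseteq> convex hull (insert q Q)" by (meson hull_subset insert_subset)
      ultimately show ?thesis using face_ofD[OF e _ _ _ zT] wQ by blast
    qed (use zT in simp)
  qed
  then have "aff_dim F \<le> aff_dim (closed_segment q y)" by (rule aff_dim_subset)
  then show False using F(2) by (simp add: aff_dim_segment split: if_splits)
qed

lemma stacking_point_notin:
  fixes Q :: "'a::euclidean_space set"
  assumes Q: "polytope Q" and q: "q \<in> stacking_region Q F" and F: "F facet_of Q"
  shows "q \<notin> Q"
proof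
  assume "q \<in> Q"
  obtain a b where ab: "facet_inequality Q F a b"
    using face_inequality_exists[OF Q] F facet_of_imp_face_of by blast
  have "a \<bullet> q > b" by (rule stacking_region_outside[OF q F ab])
  then show False using ab \<open>q \<in> Q\<close> by (auto simp: facet_inequality_def)
qed

text \<open>An old edge survives because \<open>F\<close> has dimension at least 2 and so is not
  that edge. An edge avoiding \<open>q\<close> has its ends in \<open>Q\<close>, and one ending in
  \<open>q\<close> has its other end in \<open>F\<close>.\<close>

lemma stacked_edges:
  fixes Q :: "'a::euclidean_space set"
  assumes Q: "polytope Q" and q: "q \<in> stacking_region Q F" and F: "F facet_of Q" "aff_dim F \<ge> 2"
  shows "e edge_of convex hull (insert q Q) \<longleftrightarrow>
    e edge_of Q \<or> (\<exists>p. p extreme_point_of F \<and> e = closed_segment q p)"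
proof
  let ?Q = "convex hull (insert q Q)"
  have pQ: "polytope ?Q" by (rule polytope_hull_insert[OF Q])
  have QQ: "Q \<subseteq> ?Q" by (meson hull_subset insert_subset)
  assume e: "e edge_of ?Q"
  obtain x y where xy: "e = closed_segment x y"
    using edge_is_segment[OF polytope_imp_compact[OF pQ] polytope_imp_convex[OF pQ] e] by metis
  have v: "x extreme_point_of ?Q" "y extreme_point_of ?Q" "x \<noteq> y"
    using edge_vertices[of x y ?Q] e xy by auto
  then have mem: "x \<in> insert q Q" "y \<in> insert q Q" using extreme_point_of_convex_hull by blast+
  have new: "\<exists>p. p extreme_point_of F \<and> e = closed_segment q p"
    if "e = closed_segment q y" "y \<in> Q" "y extreme_point_of ?Q" for y
  proof -
    have "y \<in> F"
      by (rule stacking_point_edge_ends[OF Q q F _ that(2)]) (use e that in \<open>simp add: edge_of_def\<close>)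
    moreover have "{y} face_of ?Q" using that by (simp add: face_of_singleton)
    moreover have "F \<subseteq> ?Q" using QQ F facet_of_imp_subset by blast
    ultimately have "{y} face_of F" using face_of_subset by blast
    then show ?thesis using that by (auto simp: face_of_singleton)
  qed
  show "e edge_of Q \<or> (\<exists>p. p extreme_point_of F \<and> e = closed_segment q p)"
  proof (cases "x = q \<or> y = q")
    case True
    then show ?thesis
    proof
      assume "x = q"
      then show ?thesis using new[of y] xy v mem by auto
    next
      assume "y = q"
      then show ?thesis using new[of x] xy v mem by (auto simp: closed_segment_commute)
    qed
  next
    case False
    then have "e \<subseteq> Q" using mem xy closed_segment_subset[OF _ _ polytope_imp_convex[OF Q]]
      by auto
    then have "e face_of Q" using e QQ face_of_subset by (auto simp: edge_of_def)
    then show ?thesis using e by (simp add: edge_of_def)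
  qed
next
  have dQ: "aff_dim Q \<ge> 3" using F by (simp add: facet_of_def)
  assume "e edge_of Q \<or> (\<exists>p. p extreme_point_of F \<and> e = closed_segment q p)"
  then show "e edge_of convex hull (insert q Q)"
  proof (elim disjE exE conjE)
    assume e: "e edge_of Q"
    then have "e \<noteq> {}" "e \<noteq> Q" "e \<noteq> F" using F(2) dQ by (auto simp: edge_of_def)
    then have "e face_of convex hull (insert q Q)"
      using face_of_stacked_polytope[OF Q q] e by (simp add: edge_of_def)
    then show ?thesis using e by (simp add: edge_of_def)
  next
    fix p assume p: "p extreme_point_of F" "e = closed_segment q p"
    have "F \<noteq> {p}" using F(2) by auto
    then show ?thesis using edge_to_stacking_point[OF Q q F(1) _ p(1)] p(2) by simp
  qed
qed

text \<open>Describes the effect of one stacking on edge factors. For the converse, equal factors on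
  the edges of \<open>F\<close> make \<open>f\<close> a homothety on its vertices, and this
  homothety also prescribes the value at \<open>q\<close>.\<close>

lemma stacked_edge_map:
  fixes Q :: "'a::euclidean_space set"
  assumes Q: "polytope Q" and q: "q \<in> stacking_region Q F" and F: "F facet_of Q" "aff_dim F \<ge> 2"
  shows "(\<exists>f. edge_map (convex hull (insert q Q)) l f) \<longleftrightarrow>
    (\<exists>f. edge_map Q l f) \<and>
    (\<exists>c. (\<forall>e. e edge_of F \<longrightarrow> l e = c) \<and> (\<forall>p. p extreme_point_of F \<longrightarrow> l (closed_segment q p) = c))"
    (is "?L \<longleftrightarrow> ?R1 \<and> ?R2")
proof -
  let ?Q = "convex hull (insert q Q)"
  note edges = stacked_edges[OF Q q F]
  have fF: "F face_of Q" using F facet_of_imp_face_of by blast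
  have pF: "polytope F" using face_of_polytope_polytope[OF Q fF] .
  have "F \<noteq> {}" using F by auto
  then obtain p0 where p0: "p0 extreme_point_of F" using polytope_has_vertex[OF pF] by blast
  obtain a b where ab: "facet_inequality Q F a b" using face_inequality_exists[OF Q fF] by blast
  have aq: "a \<bullet> q > b" by (rule stacking_region_outside[OF q F(1) ab])
  have aF: "a \<bullet> x = b" "x \<in> Q" if "x \<in> F" for x using ab that
    by (auto simp: facet_inequality_def)
  have qQ: "q \<notin> Q" by (rule stacking_point_notin[OF Q q F(1)])
  have ext: "p \<in> F" if "p extreme_point_of F" for p using that by (simp add: extreme_point_of_def)
  have edgeF: "e edge_of Q" if "e edge_of F" for e using that edge_of_face_eq[OF fF] by blast
  show ?thesis
  proof
    assume ?L
    then obtain f where f: "edge_map ?Q l f" by blast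
    have "edge_map Q l f" using f edges unfolding edge_map_def by blast
    then have ?R1 by blast
    have fe: "f x - f y = l (closed_segment x y) *\<^sub>R (x - y)" if "closed_segment x y edge_of ?Q"
      for x y
      using f that by (simp add: edge_map_def)
    have triangle: "l (closed_segment q y) = l (closed_segment q x) \<and> l (closed_segment x y) = l (closed_segment q x)"
      if e: "closed_segment x y edge_of F" for x y
    proof -
      have v: "x extreme_point_of F" "y extreme_point_of F" "x \<noteq> y" "x \<in> F" "y \<in> F"
        using edge_vertices[OF e] by auto
      define m1 m2 m3 where "m1 = l (closed_segment q x)" and "m2 = l (closed_segment q y)"
        and "m3 = l (closed_segment x y)"
      have 1: "f q - f x = m1 *\<^sub>R (q - x)" "f q - f y = m2 *\<^sub>R (q - y)" "f x - f y = m3 *\<^sub>R (x - y)"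
        unfolding m1_def m2_def m3_def using fe edges v edgeF[OF e] by blast+
      have "m2 *\<^sub>R (q - y) = m1 *\<^sub>R (q - x) + m3 *\<^sub>R (x - y)"
        using 1 by (metis add.commute diff_add_cancel add_diff_eq)
      \<comment> \<open>The facet functional \<open>a\<close> is constant on \<open>F\<close>, so it
        kills \<open>x - y\<close> and compares \<open>m1\<close> with \<open>m2\<close> alone;
        \<open>m3\<close> then follows from the remaining relation.\<close>
      moreover from this have "a \<bullet> (m2 *\<^sub>R (q - y)) = a \<bullet> (m1 *\<^sub>R (q - x) + m3 *\<^sub>R (x - y))" by simp
      then have "m2 * (a \<bullet> q - b) = m1 * (a \<bullet> q - b)"
        using aF v by (simp add: inner_add_right inner_diff_right)
      then have "m2 = m1" using aq by simp
      ultimately have "m1 *\<^sub>R (q - y) = m1 *\<^sub>R (q - x) + m3 *\<^sub>R (x - y)" by metis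
      then have "m1 *\<^sub>R (q - y) - m1 *\<^sub>R (q - x) = m3 *\<^sub>R (x - y)"
        by (simp only: add_diff_cancel_left')
      then have "m1 *\<^sub>R ((q - y) - (q - x)) = m3 *\<^sub>R (x - y)"
        by (simp only: scaleR_diff_right[of m1 "q - y"])
      then have "m1 *\<^sub>R (x - y) = m3 *\<^sub>R (x - y)" by simp
      then have "m1 = m3" using v by simp
      with \<open>m2 = m1\<close> show ?thesis by (simp add: m1_def m2_def m3_def)
    qed
    have pc: "l (closed_segment q p) = l (closed_segment q p0)" if p: "p extreme_point_of F" for p
      using vertices_connected[OF pF p0 p]
    proof (induction rule: rtrancl_induct)
      case (step x y)
      then show ?case using triangle[of x y] by auto
    qed simp
    have "l e = l (closed_segment q p0)" if e: "e edge_of F" for e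
    proof -
      obtain x y where xy: "e = closed_segment x y"
        using edge_is_segment[OF polytope_imp_compact[OF pF] polytope_imp_convex[OF pF] e] by metis
      then show ?thesis using triangle[of x y] pc[of x] edge_vertices[of x y F] e by simp
    qed
    with pc \<open>?R1\<close> show "?R1 \<and> ?R2" by blast
  next
    assume R: "?R1 \<and> ?R2"
    then obtain f where f: "edge_map Q l f" by blast
    obtain c where c: "\<And>e. e edge_of F \<Longrightarrow> l e = c" "\<And>p. p extreme_point_of F \<Longrightarrow> l (closed_segment q p) = c"
      using R by blast
    have fe: "f x - f y = l (closed_segment x y) *\<^sub>R (x - y)" "0 \<le> l (closed_segment x y)"
      if "closed_segment x y edge_of Q" for x y
      using f that by (auto simp: edge_map_def)
    have pc: "f p - c *\<^sub>R p = f p0 - c *\<^sub>R p0" if p: "p extreme_point_of F" for p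
      using vertices_connected[OF pF p0 p]
    proof (induction rule: rtrancl_induct)
      case (step x y)
      then have e: "closed_segment x y edge_of F" by simp
      then have "f x - f y = c *\<^sub>R x - c *\<^sub>R y" using fe(1)[OF edgeF[OF e]] c(1)[OF e]
        by (simp add: scaleR_diff_right)
      then have "f y - c *\<^sub>R y = f x - c *\<^sub>R x" by (simp add: algebra_simps)
      then show ?case using step.IH by simp
    qed simp
    \<comment> \<open>The new edges require a nonnegative factor, which is read off from an edge of
      \<open>F\<close>.\<close>
    have c0: "c \<ge> 0"
    proof -
      have "F \<noteq> {p0}" using F(2) by auto
      then obtain y where "y \<in> F" "y \<noteq> p0" using \<open>F \<noteq> {}\<close> by blast
      then obtain u v where e: "closed_segment u v edge_of F" using exists_edge[OF pF _ ext[OF p0]]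
        by metis
      then show ?thesis using c(1)[OF e] fe(2)[OF edgeF[OF e]] by simp
    qed
    define g where "g = f(q := f p0 + c *\<^sub>R (q - p0))"
    have gq: "g q - g p = c *\<^sub>R (q - p)" if "p extreme_point_of F" for p
    proof -
      have "p \<noteq> q" using ext[OF that] aF qQ by blast
      then have "g q - g p = (f p0 - c *\<^sub>R p0) + c *\<^sub>R q - f p"
        by (simp add: g_def scaleR_diff_right)
      then show ?thesis using pc[OF that, symmetric] by (simp add: scaleR_diff_right)
    qed
    have "edge_map ?Q l g"
      unfolding edge_map_def
    proof (intro allI impI)
      fix x y assume "closed_segment x y edge_of ?Q"
      then consider "closed_segment x y edge_of Q"
        | p where "p extreme_point_of F" "closed_segment x y = closed_segment q p" using edges by blast
      then show "0 \<le> l (closed_segment x y) \<and> g x - g y = l (closed_segment x y) *\<^sub>R (x - y)"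
      proof cases
        case 1
        then have "x \<noteq> q" "y \<noteq> q" using edge_vertices[OF 1] qQ by auto
        then show ?thesis using fe[OF 1] by (simp add: g_def)
      next
        case 2
        have l: "l (closed_segment x y) = c" unfolding 2(2) by (rule c(2)[OF 2(1)])
        from 2(2) have "x = q \<and> y = p \<or> x = p \<and> y = q"
          by (auto simp: closed_segment_eq doubleton_eq_iff)
        moreover have "g p - g q = c *\<^sub>R (p - q)"
          using gq[OF 2(1)] by (metis minus_diff_eq scaleR_minus_right)
        ultimately show ?thesis using gq[OF 2(1)] l c0 by auto
      qed
    qed
    then show ?L by blast
  qed
qed

text \<open>\<open>\<rho>\<close> sends an edge created by a stacking to an original edge that must
  carry the same factor. So the factors on the edges of \<open>S\<close> determine all others, and
  each stacking contributes a condition on the edges of one facet of \<open>S\<close>.\<close>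

lemma stacked_edge_retraction:
  fixes S :: "'a::euclidean_space set"
  assumes "stacked S Fs Q" and S: "polytope S" "aff_dim S \<ge> 3"
  shows "polytope Q \<and> (\<forall>e. e edge_of S \<longrightarrow> e edge_of Q) \<and>
    (\<exists>\<rho>. (\<forall>e. e edge_of Q \<longrightarrow> \<rho> e edge_of S) \<and> (\<forall>e. e edge_of S \<longrightarrow> \<rho> e = e) \<and>
      (\<forall>l. (\<exists>f. edge_map Q l f) \<longleftrightarrow> (\<exists>f. edge_map S l f) \<and> (\<forall>e. e edge_of Q \<longrightarrow> l e = l (\<rho> e)) \<and>
        (\<forall>F\<in>Fs. \<forall>e e'. e edge_of F \<longrightarrow> e' edge_of F \<longrightarrow> l e = l e')))"
  using assms(1)
proof (induction rule: stacked.induct)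
  case none
  show ?case using S by (intro conjI exI[of _ "\<lambda>e. e"]) auto
next
  case (stack Fs Q F q)
  have Q: "polytope Q" "\<And>e. e edge_of S \<Longrightarrow> e edge_of Q"
    using conjunct1[OF stack.IH] conjunct1[OF conjunct2[OF stack.IH]] by auto
  obtain \<rho> where r: "(\<forall>e. e edge_of Q \<longrightarrow> \<rho> e edge_of S) \<and> (\<forall>e. e edge_of S \<longrightarrow> \<rho> e = e) \<and>
      (\<forall>l. (\<exists>f. edge_map Q l f) \<longleftrightarrow> (\<exists>f. edge_map S l f) \<and> (\<forall>e. e edge_of Q \<longrightarrow> l e = l (\<rho> e)) \<and>
        (\<forall>F\<in>Fs. \<forall>e e'. e edge_of F \<longrightarrow> e' edge_of F \<longrightarrow> l e = l e'))"
    using conjunct2[OF conjunct2[OF stack.IH]] by (rule exE)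
  have \<rho>: "\<And>e. e edge_of Q \<Longrightarrow> \<rho> e edge_of S" "\<And>e. e edge_of S \<Longrightarrow> \<rho> e = e"
    using conjunct1[OF r] conjunct1[OF conjunct2[OF r]] by auto
  note em = spec[OF conjunct2[OF conjunct2[OF r]]]
  have dF: "aff_dim F \<ge> 2" using S(2) stack.hyps by (simp add: facet_of_def)
  have fF: "F face_of S" using stack.hyps facet_of_imp_face_of by blast
  have fFQ: "F face_of Q" using stack.hyps facet_of_imp_face_of by blast
  have pF: "polytope F" using face_of_polytope_polytope[OF S(1) fF] .
  have "F \<noteq> {}" using dF by auto
  then obtain x where x: "x \<in> F" by blast
  have "F \<noteq> {x}" using dF by auto
  then obtain y where "y \<in> F" "y \<noteq> x" using x by blast
  then obtain u v where eF: "closed_segment u v edge_of F" using exists_edge[OF pF] x by metis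
  \<comment> \<open>Any edge of \<open>F\<close> can represent the new edges, since all of them
    share one factor with it.\<close>
  let ?e = "closed_segment u v"
  have eS: "e edge_of S" if "e edge_of F" for e using that edge_of_face_eq[OF fF] by blast
  let ?Q = "convex hull (insert q Q)"
  have eq: "Q \<union> {q} = insert q Q" by auto
  note edges = stacked_edges[OF Q(1) stack.hyps(5) stack.hyps(4) dF]
  have qQ: "q \<notin> Q" by (rule stacking_point_notin[OF Q(1) stack.hyps(5,4)])
  have new: "\<not> closed_segment q p edge_of Q" for p using edge_vertices(4) qQ by blast
  define \<rho>' where "\<rho>' e = (if e edge_of Q then \<rho> e else ?e)" for e
  have 1: "\<rho>' e edge_of S" for e using \<rho>(1) eS[OF eF] by (simp add: \<rho>'_def)
  have 2: "\<rho>' e = e" if "e edge_of S" for e using \<rho>(2) that Q(2) by (simp add: \<rho>'_def)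
  have 3: "(\<exists>f. edge_map ?Q l f) \<longleftrightarrow> (\<exists>f. edge_map S l f) \<and> (\<forall>e. e edge_of ?Q \<longrightarrow> l e = l (\<rho>' e)) \<and>
        (\<forall>F\<in>insert F Fs. \<forall>e e'. e edge_of F \<longrightarrow> e' edge_of F \<longrightarrow> l e = l e')" (is "?L \<longleftrightarrow> ?R") for l
  proof
    assume ?L
    then obtain c where E: "\<exists>f. edge_map Q l f" and c: "\<And>e. e edge_of F \<Longrightarrow> l e = c"
      "\<And>p. p extreme_point_of F \<Longrightarrow> l (closed_segment q p) = c"
      unfolding stacked_edge_map[OF Q(1) stack.hyps(5) stack.hyps(4) dF] by blast
    have "l e = l (\<rho>' e)" if e: "e edge_of ?Q" for e
    proof (cases "e edge_of Q")
      case True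
      then show ?thesis using E em by (simp add: \<rho>'_def)
    next
      case False
      then show ?thesis using e edges c(1)[OF eF] c(2) by (auto simp: \<rho>'_def)
    qed
    moreover have "l e = l e'" if "e edge_of F" "e' edge_of F" for e e'
      using c(1)[OF that(1)] c(1)[OF that(2)] by simp
    moreover note iffD1[OF em E]
    ultimately show ?R by blast
  next
    assume R: ?R
    have l: "l e = l ?e" if "e edge_of F" for e using R that eF by blast
    have "l e = l (\<rho> e)" if "e edge_of Q" for e
      using R that edges[of e] by (metis \<rho>'_def)
    moreover have "\<forall>F\<in>Fs. \<forall>e e'. e edge_of F \<longrightarrow> e' edge_of F \<longrightarrow> l e = l e'" using R by blast
    ultimately have "\<exists>f. edge_map Q l f" using R by (intro iffD2[OF em]) blast
    moreover have "l (closed_segment q p) = l ?e" if "p extreme_point_of F" for p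
      using R edges that new by (metis \<rho>'_def)
    ultimately show ?L
      unfolding stacked_edge_map[OF Q(1) stack.hyps(5) stack.hyps(4) dF] using l by blast
  qed
  show ?case
    unfolding eq
  proof (intro conjI exI[of _ \<rho>'])
    show "polytope ?Q" by (rule polytope_hull_insert[OF Q(1)])
    show "\<forall>e. e edge_of S \<longrightarrow> e edge_of ?Q" using Q(2) edges by blast
  qed (use 1 2 3 in blast)+
qed


subsection \<open>The deformation cone\<close>

text \<open>\<open>zero\<close> is linear independence of the family \<open>v\<close>, stated
  through coefficients so that distinctness of the vectors is a consequence. The rays of the cone
  are spanned by the \<open>v i\<close>, which yields simpliciality.\<close>

lemma independent_generators_cone:
  fixes v :: "'c \<Rightarrow> 'v::real_vector"
  assumes fin: "finite D"
    and zero: "\<And>y. (\<Sum>i\<in>D. y i *\<^sub>R v i) = 0 \<Longrightarrow> \<forall>i\<in>D. y i = 0"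
  defines "K \<equiv> {w. \<exists>y. (\<forall>i\<in>D. 0 \<le> y i) \<and> w = (\<Sum>i\<in>D. y i *\<^sub>R v i)}"
  shows "simplicial_cone K" and "dim K = card D"
proof -
  have single: "v i = (\<Sum>j\<in>D. (if j = i then 1 else 0) *\<^sub>R v j)" if "i \<in> D" for i
    using that fin by (simp add: if_distrib[of "\<lambda>c. c *\<^sub>R _"] cong: if_cong)
  have inj: "inj_on v D"
  proof (rule inj_onI, rule ccontr)
    fix i j assume ij: "i \<in> D" "j \<in> D" "v i = v j" "i \<noteq> j"
    let ?y = "\<lambda>k. (if k = i then 1 else 0) - (if k = j then 1 else 0) :: real"
    have "(\<Sum>k\<in>D. ?y k *\<^sub>R v k) = v i - v j"
      using single[OF ij(1)] single[OF ij(2)] by (simp add: scaleR_diff_left sum_subtractf)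
    then have "(\<Sum>k\<in>D. ?y k *\<^sub>R v k) = 0" using ij(3) by simp
    from bspec[OF zero[OF this] ij(1)] have "?y i = 0" .
    then show False using ij by simp
  qed
  have vK: "v i \<in> K" if "i \<in> D" for i
    using single[OF that] unfolding K_def by (intro CollectI exI[of _ "\<lambda>j. if j = i then 1 else 0"]) simp
  have cone: "convex_cone K"
    unfolding convex_cone_iff
  proof (intro conjI ballI allI impI)
    show "0 \<in> K" unfolding K_def by (intro CollectI exI[of _ "\<lambda>_. 0"]) simp
  next
    fix x y assume "x \<in> K" "y \<in> K"
    then obtain a b where "\<forall>i\<in>D. 0 \<le> a i" "x = (\<Sum>i\<in>D. a i *\<^sub>R v i)"
      "\<forall>i\<in>D. 0 \<le> b i" "y = (\<Sum>i\<in>D. b i *\<^sub>R v i)" unfolding K_def by blast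
    then show "x + y \<in> K" unfolding K_def
      by (intro CollectI exI[of _ "\<lambda>i. a i + b i"]) (simp add: scaleR_add_left sum.distrib)
  next
    fix x and c :: real assume "x \<in> K" "0 \<le> c"
    then obtain a where "\<forall>i\<in>D. 0 \<le> a i" "x = (\<Sum>i\<in>D. a i *\<^sub>R v i)"
      unfolding K_def by blast
    then show "c *\<^sub>R x \<in> K" unfolding K_def using \<open>0 \<le> c\<close>
      by (intro CollectI exI[of _ "\<lambda>i. c * a i"]) (simp add: scaleR_sum_right)
  qed
  have sum_in: "(\<Sum>i\<in>D. y i *\<^sub>R v i) \<in> T"
    if T: "convex_cone T" and y: "\<forall>i\<in>D. 0 \<le> y i" and v: "v ` D \<subseteq> T" for y T
  proof -
    have "(\<Sum>i\<in>E. y i *\<^sub>R v i) \<in> T" if "finite E" "E \<subseteq> D" for E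
      using that
    proof (induction E rule: finite_induct)
      case empty
      then show ?case using T by (simp add: convex_cone_iff)
    next
      case (insert i E)
      then have "y i *\<^sub>R v i \<in> T" using T y v by (intro convex_cone_scaleR) auto
      then show ?case using insert T by (auto intro: convex_cone_add)
    qed
    then show ?thesis using fin by blast
  qed
  have hull: "K = convex_cone hull (v ` D)"
    by (rule hull_unique[symmetric]) (use vK cone sum_in in \<open>auto simp: K_def\<close>)
  have pointed: "K \<inter> uminus ` K = {0}"
  proof
    show "K \<inter> uminus ` K \<subseteq> {0}"
    proof
      fix x assume "x \<in> K \<inter> uminus ` K"
      then have "x \<in> K" "- x \<in> K" by auto
      then obtain a b where a: "\<forall>i\<in>D. 0 \<le> a i" "x = (\<Sum>i\<in>D. a i *\<^sub>R v i)"
        and b: "\<forall>i\<in>D. 0 \<le> b i" "- x = (\<Sum>i\<in>D. b i *\<^sub>R v i)" unfolding K_def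
          by blast
      have "(\<Sum>i\<in>D. (a i + b i) *\<^sub>R v i) = x + (- x)"
        unfolding a(2) b(2) by (simp add: scaleR_add_left sum.distrib flip: a(2) b(2))
      then have "\<forall>i\<in>D. a i + b i = 0" by (intro zero) simp
      then have "\<forall>i\<in>D. a i = 0" using a(1) b(1) by (metis add_nonneg_eq_0_iff)
      then show "x \<in> {0}" using a(2) by simp
    qed
    have "0 \<in> K" using cone by (simp add: convex_cone_iff)
    then show "{0} \<subseteq> K \<inter> uminus ` K" by force
  qed
  have ray: "\<exists>i\<in>D. \<exists>s. s \<noteq> 0 \<and> w = s *\<^sub>R v i \<and> s > 0"
    if w: "ray_generator K w" for w
  proof -
    have w0: "w \<noteq> 0" and f: "conic hull {w} face_of K" using w by (auto simp: ray_generator_def)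
    have wT: "w \<in> conic hull {w}" by (simp add: hull_inc)
    have hullE: "\<exists>s\<ge>0. x = s *\<^sub>R w" if "x \<in> conic hull {w}" for x
      using that unfolding conic_hull_explicit by auto
    have "w \<in> K" using f wT face_of_imp_subset by blast
    then obtain y where y: "\<forall>i\<in>D. 0 \<le> y i" "w = (\<Sum>i\<in>D. y i *\<^sub>R v i)"
      unfolding K_def by blast
    have "\<exists>i\<in>D. y i \<noteq> 0"
    proof (rule ccontr)
      assume "\<not> ?thesis"
      then have "w = 0" using y(2) by simp
      then show False using w0 by simp
    qed
    then obtain i where i: "i \<in> D" "y i > 0" using y(1) by force
    \<comment> \<open>One term is split off. Then \<open>w\<close> is the midpoint of twice this
      term and twice the rest, both in the cone, so the face property puts the doubled term on the
      ray of \<open>w\<close>.\<close>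
    let ?p = "y i *\<^sub>R v i" and ?r = "\<Sum>j\<in>D - {i}. y j *\<^sub>R v j"
    have wpr: "w = ?p + ?r" using y(2) sum.remove[OF fin i(1), of "\<lambda>j. y j *\<^sub>R v j"]
      by simp
    have pK: "2 *\<^sub>R ?p \<in> K" using cone vK[OF i(1)] i(2) by (intro convex_cone_scaleR) auto
    have "?r = (\<Sum>j\<in>D. (if j = i then 0 else y j) *\<^sub>R v j)"
      using sum.remove[OF fin i(1), of "\<lambda>j. (if j = i then 0 else y j) *\<^sub>R v j"] by simp
    then have "?r \<in> K" unfolding K_def using y(1)
      by (intro CollectI exI[of _ "\<lambda>j. if j = i then 0 else y j"]) simp
    then have rK: "2 *\<^sub>R ?r \<in> K" using cone by (intro convex_cone_scaleR) auto
    show ?thesis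
    \<comment> \<open>Equal parts give no open segment, but then \<open>w\<close> is itself twice
      the first part.\<close>
    proof (cases "?p = ?r")
      case True
      then have "w = (2 * y i) *\<^sub>R v i" using wpr by (metis scaleR_2 scaleR_scaleR)
      then show ?thesis using i by (intro bexI[of _ i] exI[of _ "2 * y i"]) auto
    next
      case False
      have ne2: "2 *\<^sub>R ?p \<noteq> 2 *\<^sub>R ?r" using False
        by (simp only: scaleR_cancel_left) simp
      have "w = (1 - 1/2) *\<^sub>R (2 *\<^sub>R ?p) + (1/2) *\<^sub>R (2 *\<^sub>R ?r)" unfolding wpr
        by simp
      then have "w \<in> open_segment (2 *\<^sub>R ?p) (2 *\<^sub>R ?r)"
        unfolding in_segment by (intro conjI exI[of _ "1/2"] ne2) simp_all
      then have "2 *\<^sub>R ?p \<in> conic hull {w}" using face_ofD[OF f _ pK rK wT] by blast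
      then obtain s where s: "s \<ge> 0" "2 *\<^sub>R ?p = s *\<^sub>R w" using hullE by blast
      have "v i \<noteq> 0"
      proof
        assume "v i = 0"
        then have "(\<Sum>j\<in>D. (if j = i then 1 else 0) *\<^sub>R v j) = 0" using single[OF i(1)]
          by simp
        from zero[OF this] i(1) show False by auto
      qed
      then have "2 *\<^sub>R ?p \<noteq> 0" using i(2) by simp
      then have "s \<noteq> 0" using s(2) by auto
      then have sp: "s > 0" using s(1) by simp
      have "w = (1/s) *\<^sub>R (2 *\<^sub>R ?p)" unfolding s(2) using sp by simp
      then have "w = (2 * y i / s) *\<^sub>R v i" by simp
      then show ?thesis using i sp by (intro bexI[of _ i] exI[of _ "2 * y i / s"]) auto
    qed
  qed
  have rays: "independent V" if V: "\<forall>w\<in>V. ray_generator K w" "inj_on (\<lambda>w. conic hull {w}) V" for V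
  proof -
    have "\<forall>w\<in>V. \<exists>i s. i \<in> D \<and> s > 0 \<and> w = s *\<^sub>R v i"
      using ray V(1) by blast
    \<comment> \<open>\<open>d w\<close> is the index of the generator spanning the ray of
      \<open>w\<close>; as the elements of \<open>V\<close> lie on different rays, \<open>d\<close>
      is injective.\<close>
    then obtain d s where ds: "\<And>w. w \<in> V \<Longrightarrow> d w \<in> D \<and> s w > 0 \<and> w = s w *\<^sub>R v (d w)" by metis
    have cv: "conic hull {w} = conic hull {v (d w)}" if w: "w \<in> V" for w
    proof -
      have *: "s w > 0" "w = s w *\<^sub>R v (d w)" using ds[OF w] by auto
      have "x \<in> conic hull {w} \<longleftrightarrow> x \<in> conic hull {v (d w)}" for x
      proof
        assume "x \<in> conic hull {w}"
        then obtain c where "c \<ge> 0" "x = c *\<^sub>R w" unfolding conic_hull_explicit by auto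
        then have "x = (c * s w) *\<^sub>R v (d w)" "c * s w \<ge> 0" using *
          by (metis scaleR_scaleR, simp)
        then show "x \<in> conic hull {v (d w)}" unfolding conic_hull_explicit by blast
      next
        assume "x \<in> conic hull {v (d w)}"
        then obtain c where c: "c \<ge> 0" "x = c *\<^sub>R v (d w)" unfolding conic_hull_explicit
          by auto
        have "(c / s w) *\<^sub>R w = (c / s w) *\<^sub>R (s w *\<^sub>R v (d w))" using *(2) by simp
        then have "x = (c / s w) *\<^sub>R w" "c / s w \<ge> 0" using c *(1) by simp_all
        then show "x \<in> conic hull {w}" unfolding conic_hull_explicit by blast
      qed
      then show ?thesis by blast
    qed
    have injd: "inj_on d V"
    proof (rule inj_onI)
      fix x y assume "x \<in> V" "y \<in> V" "d x = d y"
      then show "x = y" using cv inj_onD[OF V(2)] by metis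
    qed
    have dV: "d ` V \<subseteq> D" using ds by auto
    then have finV: "finite V" using fin injd finite_imageD finite_subset by metis
    show ?thesis
    proof (rule real_vector.independent_if_scalars_zero[OF finV])
      fix f x assume f: "(\<Sum>w\<in>V. f w *\<^sub>R w) = 0" and x: "x \<in> V"
      define g where "g = the_inv_into V d"
      have g: "g (d w) = w" if "w \<in> V" for w unfolding g_def by (rule the_inv_into_f_f[OF injd that])
      \<comment> \<open>Transports a linear relation among the elements of \<open>V\<close> to one
        among the \<open>v i\<close>, with coefficient 0 at indices outside the image of
        \<open>d\<close>.\<close>
      define y where "y i = (if i \<in> d ` V then f (g i) * s (g i) else 0)" for i
      have "(\<Sum>i\<in>D. y i *\<^sub>R v i) = (\<Sum>i\<in>d ` V. y i *\<^sub>R v i)"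
        by (rule sum.mono_neutral_right) (use fin dV in \<open>auto simp: y_def\<close>)
      also have "\<dots> = (\<Sum>w\<in>V. y (d w) *\<^sub>R v (d w))"
        using sum.reindex[OF injd, of "\<lambda>i. y i *\<^sub>R v i"] by (simp add: o_def)
      also have "\<dots> = (\<Sum>w\<in>V. f w *\<^sub>R w)"
      proof (rule sum.cong[OF refl])
        fix w assume w: "w \<in> V"
        then have "y (d w) *\<^sub>R v (d w) = f w *\<^sub>R (s w *\<^sub>R v (d w))"
          by (simp add: y_def g)
        then show "y (d w) *\<^sub>R v (d w) = f w *\<^sub>R w" using ds[OF w] by simp
      qed
      finally have "\<forall>i\<in>D. y i = 0" using f by (intro zero) simp
      then have "y (d x) = 0" using ds[OF x] by blast
      then have "f x * s x = 0" using x by (simp add: y_def g)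
      then show "f x = 0" using ds[OF x] by simp
    qed
  qed
  show "simplicial_cone K"
    unfolding simplicial_cone_def
  proof (intro conjI exI[of _ "v ` D"] allI impI)
    show "finite (v ` D)" using fin by simp
    show "independent V" if "(\<forall>w\<in>V. ray_generator K w) \<and> inj_on (\<lambda>w. conic hull {w}) V" for V
      using rays that by blast
  qed (rule hull, rule pointed)
  have indep: "independent (v ` D)"
  proof (rule real_vector.independent_if_scalars_zero)
    fix f x assume f: "(\<Sum>x\<in>v ` D. f x *\<^sub>R x) = 0" and x: "x \<in> v ` D"
    have "(\<Sum>i\<in>D. f (v i) *\<^sub>R v i) = 0"
      using f sum.reindex[OF inj, of "\<lambda>x. f x *\<^sub>R x"] by (simp add: o_def)
    from zero[OF this] x show "f x = 0" by auto
  qed (use fin in simp)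
  have "span (v ` D) = span K"
  proof
    show "span (v ` D) \<subseteq> span K" by (rule real_vector.span_mono) (use vK in auto)
    have "K \<subseteq> span (v ` D)"
      unfolding K_def
      by (clarify, intro real_vector.span_sum real_vector.span_scale, rule real_vector.span_base) simp
    then show "span K \<subseteq> span (v ` D)"
      by (rule real_vector.span_minimal) (rule real_vector.subspace_span)
  qed
  then have "dim K = card (v ` D)" using indep by (rule real_vector.dim_eq_card)
  then show "dim K = card D" using inj by (simp add: card_image)
qed

section \<open>The cone of the stacked sum\<close>

lemma sum_scaleR_fun_apply:
  fixes v :: "'c \<Rightarrow> 'x \<Rightarrow> real"
  shows "finite D \<Longrightarrow> (\<Sum>i\<in>D. y i *\<^sub>R v i) e = (\<Sum>i\<in>D. y i * v i e)"
  by (induction D rule: finite_induct) (simp_all add: scaleR_fun_def)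

theorem theorem5p2p4:
  fixes P :: "nat \<Rightarrow> 'a::euclidean_space set"
    and r :: nat
    and Fs :: "'a set set"
    and Q :: "'a set"
  assumes "\<forall>i\<in>{1..r}. polytope (P i) \<and> P i \<noteq> {}"
    and "\<forall>i\<in>{1..r}. indecomposable_polytope (P i)"
    and "\<forall>i\<in>{1..r}. \<forall>x. P i \<noteq> {x}"
    and "parallelogramic_family {1..r} P"
    and "aff_dim (\<Sum>i\<in>{1..r}. P i) \<ge> 3"
    and "Fs \<subseteq> {F. F facet_of (\<Sum>i\<in>{1..r}. P i)}"
    and "stacked (\<Sum>i\<in>{1..r}. P i) Fs Q"
  shows "simplicial_cone (deformation_cone Q) \<and>
    dim (deformation_cone Q) = card (graph_components {1..r} (stacking_arcs {1..r} P Fs))"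
proof -
  define I where "I = {1..r}"
  interpret parallelogramic_polytopes I P
    by unfold_locales (use assms in \<open>auto simp: I_def\<close>)
  have st: "stacked total Fs Q" and d3: "aff_dim total \<ge> 3" and Fs: "\<And>F. F \<in> Fs \<Longrightarrow> F facet_of total"
    using assms by (auto simp: I_def)
  note retr = stacked_edge_retraction[OF st poly_total d3]
  have pQ: "polytope Q" and SQ: "\<And>e. e edge_of total \<Longrightarrow> e edge_of Q"
    using conjunct1[OF retr] conjunct1[OF conjunct2[OF retr]] by auto
  obtain \<rho> where \<rho>: "(\<forall>e. e edge_of Q \<longrightarrow> \<rho> e edge_of total) \<and> (\<forall>e. e edge_of total \<longrightarrow> \<rho> e = e) \<and>
      (\<forall>l. (\<exists>f. edge_map Q l f) \<longleftrightarrow> (\<exists>f. edge_map total l f) \<and> (\<forall>e. e edge_of Q \<longrightarrow> l e = l (\<rho> e)) \<and>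
        (\<forall>F\<in>Fs. \<forall>e e'. e edge_of F \<longrightarrow> e' edge_of F \<longrightarrow> l e = l e'))"
    using conjunct2[OF conjunct2[OF retr]] by (rule exE)
  have \<rho>1: "\<And>e. e edge_of Q \<Longrightarrow> \<rho> e edge_of total" and \<rho>2: "\<And>e. e edge_of total \<Longrightarrow> \<rho> e = e"
    using conjunct1[OF \<rho>] conjunct1[OF conjunct2[OF \<rho>]] by auto
  note em = spec[OF conjunct2[OF conjunct2[OF \<rho>]]]
  define A where "A = stacking_arcs I P Fs"
  have A_iff: "(i, j) \<in> A \<longleftrightarrow> i \<in> I \<and> j \<in> I \<and> (\<exists>F\<in>Fs. has_color (P i) F \<and> has_color (P j) F)" for i j
    unfolding A_def stacking_arcs_def has_color_def parallel_to_edge_def by simp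
  have pF: "polytope F" and fF: "F face_of total" if "F \<in> Fs" for F
    using Fs[OF that] facet_of_imp_face_of face_of_polytope_polytope[OF poly_total] by blast+
  have eF: "e edge_of total" if "F \<in> Fs" "e edge_of F" for F e
    using edge_of_face_eq[OF fF[OF that(1)]] that(2) by blast
  define Rel where "Rel = {(i, j). i \<in> I \<and> j \<in> I \<and> (i, j) \<in> (A \<union> A\<inverse>)\<^sup>*}"
  have eqv: "equiv I Rel"
  proof (rule equivI)
    show "Rel \<subseteq> I \<times> I" by (auto simp: Rel_def)
    show "refl_on I Rel" by (auto simp: Rel_def refl_on_def)
    have "sym (A \<union> A\<inverse>)" by (auto simp: sym_def)
    then have "sym ((A \<union> A\<inverse>)\<^sup>*)" by (rule sym_rtrancl)
    then show "sym Rel" by (auto simp: Rel_def sym_def)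
    show "trans Rel" by (auto simp: Rel_def trans_def)
  qed
  define D where "D = I // Rel"
  have D: "D = graph_components {1..r} (stacking_arcs {1..r} P Fs)"
    by (simp add: D_def Rel_def A_def I_def graph_components_def)
  have finD: "finite D" unfolding D_def by (rule finite_quotient[OF fin]) (auto simp: Rel_def)
  \<comment> \<open>Each edge of the sum is parallel to an edge of exactly one summand, so the
    choice is forced.\<close>
  define col where "col e = (SOME i. i \<in> I \<and> has_color (P i) e)" for e
  have col: "col e \<in> I" "has_color (P (col e)) e" if e: "e edge_of total" for e
  proof -
    obtain i where "i \<in> I" "has_color (P i) e" by (rule edge_color_exists[OF e])
    then have "\<exists>i. i \<in> I \<and> has_color (P i) e" by blast
    from someI_ex[OF this] show "col e \<in> I" "has_color (P (col e)) e" by (auto simp: col_def)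
  qed
  have col_eq: "col e = i" if "e edge_of total" "i \<in> I" "has_color (P i) e" for e i
    using edge_color_unique[OF that(1) col(1)[OF that(1)] that(2) col(2)[OF that(1)] that(3)] .
  \<comment> \<open>An edge created by stacking inherits the class of the original edge assigned to
    it by \<open>\<rho>\<close>.\<close>
  define comp where "comp e = Rel `` {col (\<rho> e)}" for e
  \<comment> \<open>The generators of the cone: for each component, the indicator vector of the
    edges belonging to it.\<close>
  define v where "v C = (\<lambda>e. if e edge_of Q \<and> comp e = C then 1 else (0::real))" for C
  have comp_D: "comp e \<in> D" if "e edge_of Q" for e
    unfolding comp_def D_def by (rule quotientI) (use col(1) \<rho>1 that in blast)
  \<comment> \<open>No generator vanishes; as their supports are disjoint, they are
    independent.\<close>
  have hit: "\<exists>e. e edge_of Q \<and> comp e = C" if C: "C \<in> D" for C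
  proof -
    obtain i where i: "i \<in> I" "C = Rel `` {i}" using C unfolding D_def by (rule quotientE)
    obtain e where e: "e edge_of total" "has_color (P i) e" by (rule colored_edge_exists[OF i(1)])
    then have "comp e = C" using col_eq[OF e(1) i(1) e(2)] \<rho>2[OF e(1)] i(2) by (simp add: comp_def)
    then show ?thesis using SQ[OF e(1)] by blast
  qed
  have comb: "(\<Sum>C\<in>D. y C *\<^sub>R v C) e = (if e edge_of Q then y (comp e) else 0)" for y e
  proof -
    have "(\<Sum>C\<in>D. y C *\<^sub>R v C) e = (\<Sum>C\<in>D. if C = comp e then (if e edge_of Q then y C else 0) else 0)"
      unfolding sum_scaleR_fun_apply[OF finD] by (rule sum.cong) (auto simp: v_def)
    then show ?thesis using comp_D finD by auto
  qed
  have zero: "\<forall>C\<in>D. y C = 0" if s: "(\<Sum>C\<in>D. y C *\<^sub>R v C) = 0" for y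
  proof
    fix C assume "C \<in> D"
    then obtain e where e: "e edge_of Q" "comp e = C" using hit by blast
    have "(\<Sum>C\<in>D. y C *\<^sub>R v C) e = 0" unfolding s by simp
    then show "y C = 0" unfolding comb using e by simp
  qed
  have arcs: "(i, j) \<in> A" if "F \<in> Fs" "e edge_of F" "e' edge_of F" "i = col e" "j = col e'"
    for F e e' i j
  proof -
    have "has_color (P (col e)) F" "has_color (P (col e')) F"
      using has_color_face_iff[OF pF[OF that(1)]] col(2) eF that by blast+
    then show ?thesis unfolding A_iff using that col(1) eF by blast
  qed
  have "deformation_cone Q = {w. \<exists>y. (\<forall>C\<in>D. 0 \<le> y C) \<and> w = (\<Sum>C\<in>D. y C *\<^sub>R v C)}" (is "_ = ?K")
  proof (intro equalityI subsetI)
    fix l assume "l \<in> deformation_cone Q"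
    then have off: "\<And>e. \<not> e edge_of Q \<Longrightarrow> l e = 0" and ex: "\<exists>f. edge_map Q l f"
      using deformation_cone_iff[OF pQ] by auto
    have l: "\<exists>f. edge_map total l f" "\<And>e. e edge_of Q \<Longrightarrow> l e = l (\<rho> e)"
      "\<And>F e e'. F \<in> Fs \<Longrightarrow> e edge_of F \<Longrightarrow> e' edge_of F \<Longrightarrow> l e = l e'"
      using iffD1[OF em ex] by blast+
    obtain c where c: "\<And>i. i \<in> I \<Longrightarrow> 0 \<le> c i"
      "\<And>i e. i \<in> I \<Longrightarrow> e edge_of total \<Longrightarrow> has_color (P i) e \<Longrightarrow> l e = c i"
      using l(1) edge_map_constant_on_colors by blast
    \<comment> \<open>A facet in \<open>Fs\<close> with edges of both colours forces one common
      factor on all its edges.\<close>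
    have cA: "c i = c j" if ij: "(i, j) \<in> A" for i j
    proof -
      obtain F where F: "F \<in> Fs" "has_color (P i) F" "has_color (P j) F" and I: "i \<in> I" "j \<in> I"
        using ij A_iff by blast
      obtain e e' where e: "e edge_of F" "has_color (P i) e" "e' edge_of F" "has_color (P j) e'"
        using has_color_face_iff[OF pF[OF F(1)]] F by blast
      have "l e = c i" by (rule c(2)[OF I(1) eF[OF F(1) e(1)] e(2)])
      moreover have "l e' = c j" by (rule c(2)[OF I(2) eF[OF F(1) e(3)] e(4)])
      ultimately show ?thesis using l(3)[OF F(1) e(1,3)] by simp
    qed
    have "c i = c j" if "(i, j) \<in> (A \<union> A\<inverse>)\<^sup>*" for i j
      using that
    proof (induction rule: rtrancl_induct)
      case (step k m)
      then have "c k = c m" using cA[of k m] cA[of m k] by auto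
      then show ?case using step.IH by simp
    qed simp
    then have cR: "c i = c j" if "(i, j) \<in> Rel" for i j using that by (auto simp: Rel_def)
    \<comment> \<open>By \<open>cR\<close> the value does not depend on the representative of the
      class.\<close>
    define y where "y C = c (SOME i. i \<in> C)" for C
    have y: "y (Rel `` {i}) = c i" if i: "i \<in> I" for i
    proof -
      have "i \<in> Rel `` {i}" using equiv_class_self[OF eqv i] .
      then have "(SOME j. j \<in> Rel `` {i}) \<in> Rel `` {i}" by (rule someI)
      then show ?thesis using cR by (auto simp: y_def)
    qed
    have "\<forall>C\<in>D. 0 \<le> y C" unfolding D_def using y c(1) by (metis quotientE)
    moreover have "l = (\<Sum>C\<in>D. y C *\<^sub>R v C)"
    proof
      fix e
      show "l e = (\<Sum>C\<in>D. y C *\<^sub>R v C) e"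
      proof (cases "e edge_of Q")
        case True
        have t: "\<rho> e edge_of total" by (rule \<rho>1[OF True])
        have "l e = c (col (\<rho> e))" using l(2)[OF True] c(2)[OF col(1)[OF t] t col(2)[OF t]] by simp
        also have "\<dots> = y (comp e)" unfolding comp_def using y[OF col(1)[OF t]] by simp
        finally show ?thesis unfolding comb using True by simp
      next
        case False
        then show ?thesis unfolding comb using off by simp
      qed
    qed
    ultimately show "l \<in> ?K" by blast
  next
    fix l assume "l \<in> ?K"
    then obtain y where y: "\<forall>C\<in>D. 0 \<le> y C" and l: "l = (\<Sum>C\<in>D. y C *\<^sub>R v C)" by blast
    have le: "l e = (if e edge_of Q then y (comp e) else 0)" for e unfolding l by (rule comb)
    define c where "c i = y (Rel `` {i})" for i
    have c: "0 \<le> c i" if "i \<in> I" for i using y that by (auto simp: c_def D_def intro: quotientI)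
    have lt: "l e = c (col e)" if e: "e edge_of total" for e
      using le SQ[OF e] \<rho>2[OF e] by (simp add: comp_def c_def)
    have lc: "l e = c i" if "i \<in> I" "e edge_of total" "has_color (P i) e" for i e
      using lt[OF that(2)] col_eq[OF that(2,1,3)] by simp
    obtain f where f: "edge_map total l f" using color_edge_map[of c l] c lc by blast
    have "l e = l (\<rho> e)" if e: "e edge_of Q" for e
      using le[of e] e lt[OF \<rho>1[OF e]] by (simp add: comp_def c_def)
    \<comment> \<open>The colours of two edges of a stacked facet are joined by an arc, so both
      edges lie in one class.\<close>
    moreover have "l e = l e'" if F: "F \<in> Fs" and e: "e edge_of F" "e' edge_of F" for F e e'
    proof -
      have t: "e edge_of total" "e' edge_of total" using eF F e by auto
      have "(col e, col e') \<in> A" by (rule arcs[OF F e refl refl])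
      then have "(col e, col e') \<in> Rel" using col(1) t by (auto simp: Rel_def)
      then have "c (col e) = c (col e')" unfolding c_def using equiv_class_eq[OF eqv] by metis
      then show ?thesis using lt t by simp
    qed
    ultimately have "\<exists>f. edge_map Q l f" using f by (intro iffD2[OF em]) blast
    moreover have "\<forall>e. \<not> e edge_of Q \<longrightarrow> l e = 0" using le by simp
    ultimately show "l \<in> deformation_cone Q" using deformation_cone_iff[OF pQ] by blast
  qed
  moreover have "simplicial_cone ?K" "dim ?K = card D"
    using independent_generators_cone[where v = v, OF finD zero] by blast+
  ultimately show ?thesis unfolding D by metis
qed


end
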